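(* Let $W:[0,1]\to\mathbb C$ be $(\sigma_*,2)$-Gevrey regular, $0<\sigma<\sigma_*$, and suppose $\mathcal L_s:\mathcal D^\sigma\to Y^\sigma$ is invertible at some $s_0\in\Omega_\sigma$. Fix $\delta>0$. Then there exist a neighbourhood $U\subset\Omega_\sigma$ of $s_0$ and a constant $C$ depending on $U,\delta,W$ such that for every $f\in Y^\sigma$ with support in $[\delta,1]$ and every $s\in U$, $\|\mathcal L_s^{-1}f\|_{H^2(I)}\le C\|f\|_{L^2(I)}$.
   Context: Let $I=(0,1)$. A function $u\in C^\infty(\overline I)$ is $(\sigma,k)$-Gevrey regular ($\sigma,k>0$) if there is $C>0$ with $\sup_{x\in I}|u^{(n)}(x)|\le C\sigma^{-n}(n!)^k$ for all $n\ge0$. For $\sigma>0$, $u\in C^\infty(\overline I)$, $k\in\{0,1,2\}$: $|u|^{0}_{\sigma,k,0}=\big(\sum_{n=0}^\infty\frac{\sigma^{2n}}{n!^2(n+1)!^2}n^{k}\int_0^1(x/\sigma)^k|\partial_x^nu|^2dx\big)^{1/2}$ (with $0^0:=1$), $\|u\|_{\sigma,0,0}=|u|^0_{\sigma,0,0}$, $[u]^0_\sigma=(\sum_{n=0}^\infty\frac{\sigma^{2n+1}}{n!^2(n+1)!^2}|u^{(n)}(0)|^2)^{1/2}$. $X^\sigma=\{u\in C^\infty(\overline I):u(1)=0,\ \|\partial_xu\|_{\sigma,0,0}+|\partial_xu|^0_{\sigma,1,0}+|\partial_xu|^0_{\sigma,2,0}+[\partial_xu]^0_\sigma<\infty\}$,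 $Y^\sigma=\{u\in C^\infty(\overline I):\|u\|_{\sigma,0,0}+|u|^0_{\sigma,1,0}+[u]^0_\sigma<\infty\}$. $\Omega^1_\sigma=\{s:\Re s\le0,\ \sigma<|\Im s|\}\cup\{s:\Re s>0,\ \sigma<|s|\}$; $\Omega^2_\sigma=\{s:\ \sigma<|s|+\Re s,\ \sigma>\frac{-\Re(s)|s|}{2(|s|+\Re s)}\}$; $\Omega^3_\sigma=\{s\neq0:\ \sigma(|s|-\sigma+\Re s)-(\sigma(1+\frac{\Re s}{|s|})+\frac12\Re s)^2>0\}$; $\Omega_\sigma=\Omega^1_\sigma\cap(\Omega^2_\sigma\cup\Omega^3_\sigma)$. $\mathcal L_su=\frac{d}{dx}(x^2\frac{du}{dx})+s\frac{du}{dx}-Wu$ and $\mathcal D^\sigma=\{u\in X^\sigma:\mathcal L_su\in Y^\sigma\}$. *)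

theory Defs
  imports "HOL-Analysis.Analysis"
begin

text \<open>Functions on the closed interval [0,1] are modelled as maps real => complex;
only their values on [0,1] matter. Derivatives are one-sided at the endpoints.\<close>

fun dn :: "nat \<Rightarrow> (real \<Rightarrow> complex) \<Rightarrow> real \<Rightarrow> complex" where
  "dn 0 u = u"
| "dn (Suc n) u = (\<lambda>x. vector_derivative (dn n u) (at x within {0..1}))"

definition smooth01 :: "(real \<Rightarrow> complex) \<Rightarrow> bool" where
  "smooth01 u \<longleftrightarrow> (\<forall>n. \<forall>x\<in>{0..1}. dn n u differentiable (at x within {0..1}))"

definition gevrey :: "real \<Rightarrow> real \<Rightarrow> (real \<Rightarrow> complex) \<Rightarrow> bool" where
  "gevrey \<sigma> k u \<longleftrightarrow> smooth01 u \<and>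
     (\<exists>C>0. \<forall>n. \<forall>x\<in>{0<..<1}. norm (dn n u x) \<le> C * \<sigma> powr (- real n) * (fact n) powr k)"

text \<open>n-th term of the square of the weighted norm |u|^0_{sigma,k,0}.\<close>
definition wterm :: "real \<Rightarrow> nat \<Rightarrow> (real \<Rightarrow> complex) \<Rightarrow> nat \<Rightarrow> real" where
  "wterm \<sigma> k u n = \<sigma> ^ (2*n) / ((fact n)^2 * (fact (n+1))^2) * (real n) ^ k *
     integral {0..1} (\<lambda>x. (x / \<sigma>) ^ k * (norm (dn n u x))^2)"

text \<open>n-th term of the square of the boundary norm [u]^0_sigma.\<close>
definition bterm :: "real \<Rightarrow> (real \<Rightarrow> complex) \<Rightarrow> nat \<Rightarrow> real" where
  "bterm \<sigma> u n = \<sigma> ^ (2*n+1) / ((fact n)^2 * (fact (n+1))^2) * (norm (dn n u 0))^2"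

definition Xsp :: "real \<Rightarrow> (real \<Rightarrow> complex) set" where
  "Xsp \<sigma> = {u. smooth01 u \<and> u 1 = 0 \<and>
     summable (wterm \<sigma> 0 (dn 1 u)) \<and> summable (wterm \<sigma> 1 (dn 1 u)) \<and>
     summable (wterm \<sigma> 2 (dn 1 u)) \<and> summable (bterm \<sigma> (dn 1 u))}"

definition Ysp :: "real \<Rightarrow> (real \<Rightarrow> complex) set" where
  "Ysp \<sigma> = {u. smooth01 u \<and>
     summable (wterm \<sigma> 0 u) \<and> summable (wterm \<sigma> 1 u) \<and> summable (bterm \<sigma> u)}"

definition Omega1 :: "real \<Rightarrow> complex set" where
  "Omega1 \<sigma> = {s. Re s \<le> 0 \<and> \<sigma> < \<bar>Im s\<bar>} \<union> {s. Re s > 0 \<and> \<sigma> < cmod s}"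

definition Omega2 :: "real \<Rightarrow> complex set" where
  "Omega2 \<sigma> = {s. \<sigma> < cmod s + Re s \<and> \<sigma> > - Re s * cmod s / (2 * (cmod s + Re s))}"

definition Omega3 :: "real \<Rightarrow> complex set" where
  "Omega3 \<sigma> = {s. s \<noteq> 0 \<and>
     \<sigma> * (cmod s - \<sigma> + Re s) - (\<sigma> * (1 + Re s / cmod s) + Re s / 2)^2 > 0}"

definition Omega :: "real \<Rightarrow> complex set" where
  "Omega \<sigma> = Omega1 \<sigma> \<inter> (Omega2 \<sigma> \<union> Omega3 \<sigma>)"

definition Lop :: "(real \<Rightarrow> complex) \<Rightarrow> complex \<Rightarrow> (real \<Rightarrow> complex) \<Rightarrow> real \<Rightarrow> complex" where
  "Lop W s u = (\<lambda>x. dn 1 (\<lambda>y. complex_of_real (y^2) * dn 1 u y) x + s * dn 1 u x - W x * u x)"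

definition Dom :: "(real \<Rightarrow> complex) \<Rightarrow> real \<Rightarrow> complex \<Rightarrow> (real \<Rightarrow> complex) set" where
  "Dom W \<sigma> s = {u \<in> Xsp \<sigma>. Lop W s u \<in> Ysp \<sigma>}"

definition Linvertible :: "(real \<Rightarrow> complex) \<Rightarrow> real \<Rightarrow> complex \<Rightarrow> bool" where
  "Linvertible W \<sigma> s \<longleftrightarrow>
     (\<forall>u\<in>Dom W \<sigma> s. \<forall>v\<in>Dom W \<sigma> s.
        (\<forall>x\<in>{0..1}. Lop W s u x = Lop W s v x) \<longrightarrow> (\<forall>x\<in>{0..1}. u x = v x)) \<and>
     (\<forall>f\<in>Ysp \<sigma>. \<exists>u\<in>Dom W \<sigma> s. \<forall>x\<in>{0..1}. Lop W s u x = f x)"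

definition L2norm :: "(real \<Rightarrow> complex) \<Rightarrow> real" where
  "L2norm f = sqrt (integral {0..1} (\<lambda>x. (norm (f x))^2))"

definition H2norm :: "(real \<Rightarrow> complex) \<Rightarrow> real" where
  "H2norm u = sqrt (integral {0..1} (\<lambda>x. (norm (u x))^2 + (norm (dn 1 u x))^2 + (norm (dn 2 u x))^2))"

end

theory Submission
  imports Defs "HOL-Library.Function_Algebras" "HOL-Real_Asymp.Real_Asymp"
begin

text \<open>
  Since \<open>u \<in> X\<close> forces \<open>u' \<in> Y\<close>, the domain does not depend on \<open>s\<close>, and \<open>L\<^sub>s\<close> is the perturbation
  of \<open>L\<close> at \<open>s0\<close> by \<open>(s - s0) d/dx\<close>. The graph of \<open>L\<close> is closed in the Banach spaces \<open>X\<close> and \<open>Y\<close>, so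
  the inverse at \<open>s0\<close> is bounded by the open mapping theorem, and a Neumann series inverts \<open>L\<^sub>s\<close>
  near \<open>s0\<close> with a uniform bound.

  For the estimate in \<open>L\<^sup>2\<close>, let \<open>f\<close> vanish near the origin and let \<open>z\<close> solve \<open>L\<^sub>s z = f\<close> with zero
  initial data there; this is a regular initial value problem, so \<open>z\<close> is controlled by the \<open>L\<^sup>2\<close> norm
  of \<open>f\<close>. The difference \<open>u - z\<close> solves the homogeneous equation, coincides with \<open>u\<close> near the origin and
  is Gevrey regular of order 2 away from it. As \<open>1 + w\<close>, where \<open>L\<^sub>s w = W\<close>, is another homogeneous
  solution of this regularity and equals \<open>1\<close> at \<open>1\<close>, injectivity gives \<open>u = z - z(1) (1 + w)\<close>.
\<close>

section \<open>Seminormed spaces and closed linear relations\<close>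

locale seminormed_space = vector_space scale
  for scale :: "'k::real_normed_field \<Rightarrow> 'a::ab_group_add \<Rightarrow> 'a" (infixr \<open>*s\<close> 75) +
  fixes S :: "'a set" and N :: "'a \<Rightarrow> real"
  assumes subspace: "subspace S"
    and N_add_le: "f \<in> S \<Longrightarrow> g \<in> S \<Longrightarrow> N (f + g) \<le> N f + N g"
    and N_scale: "f \<in> S \<Longrightarrow> N (c *s f) = norm c * N f"
begin

lemmas zero_mem = subspace_0[OF subspace]
  and add_mem = subspace_add[OF subspace]
  and diff_mem = subspace_diff[OF subspace]
  and scale_mem = subspace_scale[OF subspace]

lemma N_zero: "N 0 = 0"
  using N_scale[OF zero_mem, of 0] by simp

lemma N_minus: "f \<in> S \<Longrightarrow> N (- f) = N f"
  using N_scale[of f "-1"] by simp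

lemma N_commute: "f \<in> S \<Longrightarrow> g \<in> S \<Longrightarrow> N (f - g) = N (g - f)"
  using N_minus[of "f - g"] diff_mem by simp

lemma N_diff_le: "f \<in> S \<Longrightarrow> g \<in> S \<Longrightarrow> N (f - g) \<le> N f + N g"
  using N_add_le[of f "- g"] N_minus[of g] subspace_neg[OF subspace] by simp

lemma N_triangle: "f \<in> S \<Longrightarrow> g \<in> S \<Longrightarrow> h \<in> S \<Longrightarrow> N (f - h) \<le> N (f - g) + N (g - h)"
  using N_add_le[of "f - g" "g - h"] diff_mem by simp

lemma N_nonneg: "f \<in> S \<Longrightarrow> 0 \<le> N f"
  using N_diff_le[of f f] N_zero by simp

lemma N_tendsto_zero_comparison:
  assumes "\<And>i::nat. F i \<in> S" "\<And>i. N (F i) \<le> r i" "r \<longlonglongrightarrow> 0"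
  shows "(\<lambda>i. N (F i)) \<longlonglongrightarrow> 0"
  using assms by (intro tendsto_sandwich[OF always_eventually always_eventually tendsto_const assms(3)])
    (auto intro: N_nonneg)

lemma N_le_limit:
  assumes F: "\<And>i::nat. F i \<in> S" and f: "f \<in> S" and lim: "(\<lambda>i. N (F i - f)) \<longlonglongrightarrow> 0"
    and le: "\<And>i. N (F i) \<le> B"
  shows "N f \<le> B"
proof (rule tendsto_lowerbound)
  show "(\<lambda>i. B + N (F i - f)) \<longlonglongrightarrow> B"
    using tendsto_add[OF tendsto_const lim, of B] by simp
  show "\<forall>\<^sub>F i in sequentially. N f \<le> B + N (F i - f)"
  proof (intro always_eventually allI)
    fix i
    have "N f \<le> N (F i) + N (F i - f)"
      using N_diff_le[OF F diff_mem[OF F f], of i i] by simp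
    then show "N f \<le> B + N (F i - f)" using le[of i] by linarith
  qed
qed simp

text \<open>The category theorem of the library needs a metric, hence a choice of one representative in
  each class of elements at distance zero.\<close>
definition rep :: "'a \<Rightarrow> 'a" where
  "rep f = (SOME g. g \<in> S \<and> N (f - g) = 0)"

definition rep_dist :: "'a \<Rightarrow> 'a \<Rightarrow> real" where
  "rep_dist f g = (if f \<in> S \<and> g \<in> S then N (f - g) else 0)"

lemma
  assumes "f \<in> S"
  shows rep_mem: "rep f \<in> S" and N_diff_rep: "N (f - rep f) = 0"
  using someI[of "\<lambda>g. g \<in> S \<and> N (f - g) = 0" f] assms N_zero by (auto simp: rep_def)

lemma rep_eqI:
  assumes f: "f \<in> S" and g: "g \<in> S" and eq0: "N (f - g) = 0"
  shows "rep f = rep g"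
proof -
  have "N (f - h) = 0 \<longleftrightarrow> N (g - h) = 0" if "h \<in> S" for h
    using N_triangle[OF f g that] N_triangle[OF g f that] eq0 N_commute[OF f g]
      N_nonneg[OF diff_mem[OF f that]] N_nonneg[OF diff_mem[OF g that]] by linarith
  then have "(\<lambda>h. h \<in> S \<and> N (f - h) = 0) = (\<lambda>h. h \<in> S \<and> N (g - h) = 0)"
    by (intro ext conj_cong refl)
  then show ?thesis unfolding rep_def by (rule arg_cong)
qed

lemma rep_imageD:
  assumes "f \<in> rep ` S"
  shows "f \<in> S" "rep f = f"
proof -
  obtain g where g: "g \<in> S" "f = rep g" using assms by blast
  then show "f \<in> S" "rep f = f"
    using rep_mem[OF g(1)] rep_eqI[OF g(1) rep_mem[OF g(1)] N_diff_rep[OF g(1)]] by simp_all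
qed

lemma rep_dist_rep:
  assumes f: "f \<in> S" and g: "g \<in> S"
  shows "rep_dist f (rep g) = N (f - g)"
  using N_triangle[OF f g rep_mem[OF g]] N_triangle[OF f rep_mem[OF g] g] N_diff_rep[OF g]
    N_commute[OF g rep_mem[OF g]] rep_mem[OF g] f by (simp add: rep_dist_def)

sublocale reps: Metric_space "rep ` S" rep_dist
proof
  show "rep_dist f g = 0 \<longleftrightarrow> f = g" if "f \<in> rep ` S" "g \<in> rep ` S" for f g
    using rep_imageD[OF that(1)] rep_imageD[OF that(2)] rep_eqI[of f g] by (auto simp: rep_dist_def N_zero)
  show "rep_dist f h \<le> rep_dist f g + rep_dist g h" if "f \<in> rep ` S" "g \<in> rep ` S" "h \<in> rep ` S" for f g h
    using that[THEN rep_imageD(1)] N_triangle by (simp add: rep_dist_def)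
qed (auto simp: rep_dist_def N_nonneg N_commute diff_mem)

end

locale complete_seminormed_space = seminormed_space +
  assumes complete:
    "\<lbrakk>\<And>i::nat. F i \<in> S; \<And>e. e > 0 \<Longrightarrow> \<exists>M. \<forall>m\<ge>M. \<forall>n\<ge>M. N (F m - F n) < e\<rbrakk>
      \<Longrightarrow> \<exists>f\<in>S. (\<lambda>i. N (F i - f)) \<longlonglongrightarrow> 0"
begin

lemma geometric_convergent:
  assumes F: "\<And>i::nat. F i \<in> S" and q: "0 \<le> q" "q < 1" and B: "0 \<le> B"
    and step: "\<And>i. N (F (Suc i) - F i) \<le> B * q ^ i"
  shows "\<exists>f\<in>S. (\<lambda>i. N (F i - f)) \<longlonglongrightarrow> 0"
proof -
  have ahead: "N (F (n + k) - F n) \<le> B * q ^ n / (1 - q)" for n k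
  proof -
    have "N (F (n + k) - F n) \<le> B * q ^ n * (\<Sum>i<k. q ^ i)"
    proof (induction k)
      case 0 show ?case by (simp add: N_zero)
    next
      case (Suc k)
      have "N (F (n + Suc k) - F n) \<le> B * q ^ (n + k) + B * q ^ n * (\<Sum>i<k. q ^ i)"
        using N_triangle[OF F[of "n + Suc k"] F[of "n + k"] F[of n]] step[of "n + k"] Suc by simp
      then show ?case by (simp add: power_add algebra_simps)
    qed
    also have "\<dots> \<le> B * q ^ n * (\<Sum>i. q ^ i)"
      using q B by (intro mult_left_mono sum_le_suminf) (auto simp: summable_geometric)
    also have "\<dots> = B * q ^ n / (1 - q)" using q by (simp add: suminf_geometric)
    finally show ?thesis .
  qed
  have "\<exists>M. \<forall>m\<ge>M. \<forall>n\<ge>M. N (F m - F n) < e" if "e > 0" for e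
  proof -
    have "(\<lambda>n. B * q ^ n / (1 - q)) \<longlonglongrightarrow> B * 0 / (1 - q)"
      using q by (intro tendsto_intros LIMSEQ_realpow_zero) auto
    then have "\<forall>\<^sub>F n in sequentially. B * q ^ n / (1 - q) < e / 2"
      using that by (intro order_tendstoD(2)) auto
    then obtain M where "B * q ^ M / (1 - q) < e / 2" by (auto simp: eventually_sequentially)
    then have near: "N (F n - F M) < e / 2" if "n \<ge> M" for n
      using le_less_trans[OF ahead[of M "n - M"], of "e / 2"] that by simp
    have "N (F m - F n) < e" if "m \<ge> M" "n \<ge> M" for m n
      using N_triangle[OF F[of m] F[of M] F[of n]] N_commute[OF F[of M] F[of n]]
        near[OF that(1)] near[OF that(2)] by linarith
    then show ?thesis by blast
  qed
  from complete[OF F this] show ?thesis .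
qed

lemma mcomplete_reps: "reps.mcomplete"
  unfolding reps.mcomplete_def
proof (intro allI impI)
  fix F assume F: "reps.MCauchy F"
  then have FS: "F i \<in> rep ` S" for i by (auto simp: reps.MCauchy_def)
  note FS' = rep_imageD(1)[OF FS]
  have "\<exists>K. \<forall>m\<ge>K. \<forall>n\<ge>K. N (F m - F n) < e" if "e > 0" for e
    using F that FS' by (simp add: reps.MCauchy_def rep_dist_def)
  from complete[OF FS' this] obtain f where f: "f \<in> S" "(\<lambda>i. N (F i - f)) \<longlonglongrightarrow> 0" by blast
  have "limitin reps.mtopology F (rep f) sequentially"
    unfolding reps.limitin_metric_dist_null using f FS by (simp add: rep_dist_rep[OF FS'])
  then show "\<exists>x. limitin reps.mtopology F x sequentially" ..
qed

lemma Baire_countable_cover: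
  assumes A: "\<And>k::nat. A k \<subseteq> S" and cover: "S \<subseteq> (\<Union>k. A k)"
  shows "\<exists>k. \<exists>f\<^sub>0\<in>S. \<exists>r>0. \<forall>f\<in>S. N (f - f\<^sub>0) < r \<longrightarrow> (\<forall>e>0. \<exists>a\<in>A k. N (f - a) < e)"
proof -
  let ?C = "\<lambda>k. reps.mtopology closure_of (rep ` A k)"
  have "rep ` S \<subseteq> (\<Union>k. rep ` A k)" using cover by blast
  also have "\<dots> \<subseteq> (\<Union>k. ?C k)"
    using A by (intro UN_mono order_refl closure_of_subset) (simp add: image_mono)
  finally have "rep ` S \<subseteq> (\<Union>k. ?C k)" .
  then have "rep ` S \<subseteq> reps.mtopology interior_of (\<Union>k. ?C k)"
    by (intro interior_of_maximal) auto
  then have "reps.mtopology interior_of (\<Union>k. ?C k) \<noteq> {}" using zero_mem by blast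
  moreover have "reps.mtopology interior_of (\<Union>k. ?C k) = {}" if "\<And>k. reps.mtopology interior_of (?C k) = {}"
    using that by (intro reps.metric_Baire_category_alt mcomplete_reps) auto
  ultimately obtain k where "reps.mtopology interior_of (?C k) \<noteq> {}" by blast
  then obtain f\<^sub>0 r where f\<^sub>0: "f\<^sub>0 \<in> rep ` S" and "r > 0" and ball: "reps.mball f\<^sub>0 r \<subseteq> ?C k"
    by (auto simp: reps.metric_interior_of)
  have "f\<^sub>0 \<in> S" using rep_imageD[OF f\<^sub>0] by auto
  have "\<exists>a\<in>A k. N (f - a) < e" if f: "f \<in> S" "N (f - f\<^sub>0) < r" and e: "e > 0" for f and e :: real
  proof -
    have "rep f \<in> reps.mball f\<^sub>0 r"
      using f f\<^sub>0 rep_dist_rep[OF \<open>f\<^sub>0 \<in> S\<close>] N_commute[OF f(1) \<open>f\<^sub>0 \<in> S\<close>] by simp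
    then obtain a where a: "a \<in> A k" "rep_dist (rep f) (rep a) < e"
      using ball e by (fastforce simp: reps.metric_closure_of)
    have "rep_dist (rep f) (rep a) = N (f - a)"
      using rep_dist_rep[OF rep_mem[OF f(1)]] rep_dist_rep[OF _ f(1)] A a(1) f(1)
        N_commute[of "rep f" a] N_commute[of a f] rep_mem
      by (metis reps.commute rep_dist_def subsetD)
    then show ?thesis using a by auto
  qed
  then show ?thesis using \<open>f\<^sub>0 \<in> S\<close> \<open>r > 0\<close> by blast
qed

end

text \<open>The operator is given by its graph, which need not be that of a function: elements of \<open>X\<close> and of
  \<open>Y\<close> at distance zero, such as functions that agree on the unit interval only, are not identified.\<close>
locale closed_linear_relation =
  X: complete_seminormed_space scaleX X normX + Y: complete_seminormed_space scaleY Y normY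
  for scaleX :: "'k::real_normed_field \<Rightarrow> 'a::ab_group_add \<Rightarrow> 'a" and X normX
    and scaleY :: "'k \<Rightarrow> 'b::ab_group_add \<Rightarrow> 'b" and Y normY +
  fixes G :: "'a \<Rightarrow> 'b \<Rightarrow> bool"
  assumes graph_mem: "G u f \<Longrightarrow> u \<in> X \<and> f \<in> Y"
    and graph_zero: "G 0 0"
    and graph_add: "G u f \<Longrightarrow> G v g \<Longrightarrow> G (u + v) (f + g)"
    and graph_scale: "G u f \<Longrightarrow> G (scaleX c u) (scaleY c f)"
    and graph_closed: "\<lbrakk>\<And>i::nat. G (U i) (F i); u \<in> X; f \<in> Y;
      (\<lambda>i. normX (U i - u)) \<longlonglongrightarrow> 0; (\<lambda>i. normY (F i - f)) \<longlonglongrightarrow> 0\<rbrakk> \<Longrightarrow> G u f"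
begin

definition surjective :: bool where
  "surjective \<longleftrightarrow> (\<forall>f\<in>Y. \<exists>u. G u f)"

definition approx_solvable :: "real \<Rightarrow> real \<Rightarrow> bool" where
  "approx_solvable r k \<longleftrightarrow> (\<forall>f\<in>Y. normY f < r \<longrightarrow>
     (\<forall>e>0. \<exists>u h. G u h \<and> normX u \<le> k \<and> normY (f - h) < e))"

lemma graph_diff: "G u f \<Longrightarrow> G v g \<Longrightarrow> G (u - v) (f - g)"
  using graph_add[of u f "- v" "- g"] graph_scale[of v g "-1"] by simp

lemma approx_solvable_if_surjective:
  assumes surjective
  obtains r k where "r > 0" "k \<ge> 0" "approx_solvable r k"
proof -
  let ?A = "\<lambda>k. {f. \<exists>u. G u f \<and> normX u \<le> real k}"
  have "?A k \<subseteq> Y" for k using graph_mem by auto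
  moreover have "Y \<subseteq> (\<Union>k. ?A k)"
    using assms real_arch_simple unfolding surjective_def by blast
  ultimately obtain f\<^sub>0 r k where "f\<^sub>0 \<in> Y" "r > 0"
    and dense: "\<And>f e. f \<in> Y \<Longrightarrow> normY (f - f\<^sub>0) < r \<Longrightarrow> e > 0 \<Longrightarrow> \<exists>h\<in>?A k. normY (f - h) < e"
    using Y.Baire_countable_cover[of ?A] by blast
  have "approx_solvable r (2 * real k)"
    unfolding approx_solvable_def
  proof (intro ballI impI allI)
    fix f and e :: real assume f: "f \<in> Y" "normY f < r" and e: "e > 0"
    obtain u h where u: "G u h" "normX u \<le> real k" "normY (f\<^sub>0 + f - h) < e / 2"
      using dense[OF Y.add_mem[OF \<open>f\<^sub>0 \<in> Y\<close> f(1)], of "e / 2"] f e by auto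
    obtain v g where v: "G v g" "normX v \<le> real k" "normY (f\<^sub>0 - g) < e / 2"
      using dense[OF \<open>f\<^sub>0 \<in> Y\<close>, of "e / 2"] e \<open>r > 0\<close> by (auto simp: Y.N_zero)
    have "normY (f - (h - g)) \<le> normY (f\<^sub>0 + f - h) + normY (f\<^sub>0 - g)"
      using Y.N_diff_le[of "f\<^sub>0 + f - h" "f\<^sub>0 - g"] graph_mem[OF u(1)] graph_mem[OF v(1)] f \<open>f\<^sub>0 \<in> Y\<close>
      by (simp add: Y.diff_mem Y.add_mem algebra_simps)
    moreover have "normX (u - v) \<le> 2 * real k"
      using X.N_diff_le graph_mem[OF u(1)] graph_mem[OF v(1)] u(2) v(2) by fastforce
    ultimately show "\<exists>u h. G u h \<and> normX u \<le> 2 * real k \<and> normY (f - h) < e"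
      using graph_diff[OF u(1) v(1)] u(3) v(3) by (intro exI[of _ "u - v"] exI[of _ "h - g"]) auto
  qed
  then show thesis using that[of r "2 * real k"] \<open>r > 0\<close> by simp
qed

lemma approx_solvable_scale:
  assumes approx: "approx_solvable r k" and t: "t > 0"
  shows "approx_solvable (t * r) (t * k)"
  unfolding approx_solvable_def
proof (intro ballI impI allI)
  fix f and e :: real assume f: "f \<in> Y" "normY f < t * r" and e: "e > 0"
  have "normY (scaleY (of_real (1 / t)) f) < r"
    using f t by (simp add: Y.N_scale norm_divide pos_divide_less_eq mult.commute)
  then obtain u h where u: "G u h" "normX u \<le> k" "normY (scaleY (of_real (1 / t)) f - h) < e / t"
    using approx Y.scale_mem[OF f(1)] e t unfolding approx_solvable_def by (meson divide_pos_pos)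
  have "f - scaleY (of_real t) h = scaleY (of_real t) (scaleY (of_real (1 / t)) f - h)"
    using t by (simp add: Y.scale_right_diff_distrib)
  then have "normY (f - scaleY (of_real t) h) = t * normY (scaleY (of_real (1 / t)) f - h)"
    using t f graph_mem[OF u(1)] by (simp add: Y.N_scale Y.diff_mem Y.scale_mem)
  also have "\<dots> < e" using u(3) t by (simp add: pos_less_divide_eq mult.commute)
  finally have "normY (f - scaleY (of_real t) h) < e" .
  moreover have "normX (scaleX (of_real t) u) \<le> t * k"
    using u t graph_mem[OF u(1)] by (simp add: X.N_scale)
  ultimately show "\<exists>u h. G u h \<and> normX u \<le> t * k \<and> normY (f - h) < e"
    using graph_scale[OF u(1)] by blast
qed

text \<open>Correct the residual again and again, halving it each time.\<close>
lemma approx_solvable_sequence: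
  assumes approx: "approx_solvable r k" and r: "r > 0" and f: "f \<in> Y" "normY f < r"
  shows "\<exists>U F. \<forall>n. G (U n) (F n) \<and> normY (f - F n) < (1/2)^n * r \<and>
    normX (U n) \<le> 2 * k * (1 - (1/2)^n) \<and> normX (U (Suc n) - U n) \<le> (1/2)^n * k"
proof -
  define good where "good n p \<longleftrightarrow> G (fst p) (snd p) \<and> normY (f - snd p) < (1/2)^n * r \<and>
    normX (fst p) \<le> 2 * k * (1 - (1/2)^n)" for n and p :: "'a \<times> 'b"
  define close where "close n p p' \<longleftrightarrow> normX (fst p' - fst p) \<le> (1/2)^n * k"
    for n and p p' :: "'a \<times> 'b"
  have "\<exists>P. \<forall>n. good n (P n) \<and> close n (P n) (P (Suc n))"
  proof (rule dependent_nat_choice)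
    show "\<exists>p. good 0 p"
      using f graph_zero by (intro exI[of _ "(0, 0)"]) (auto simp: good_def X.N_zero)
    fix p n assume p: "good n p"
    obtain u h where p_eq: "p = (u, h)" by (cases p)
    then have u: "G u h" "normY (f - h) < (1/2)^n * r" "normX u \<le> 2 * k * (1 - (1/2)^n)"
      using p by (auto simp: good_def)
    obtain v g where v: "G v g" "normX v \<le> (1/2)^n * k" "normY (f - h - g) < (1/2)^Suc n * r"
      using approx_solvable_scale[OF approx, of "(1/2)^n"] u r f graph_mem[OF u(1)] Y.diff_mem
      unfolding approx_solvable_def by (metis half_gt_zero_iff mult_pos_pos zero_less_one zero_less_power)
    have "normX (u + v) \<le> 2 * k * (1 - (1/2)^Suc n)"
      using X.N_add_le[of u v] graph_mem[OF u(1)] graph_mem[OF v(1)] u(3) v(2) by (simp add: algebra_simps)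
    then have "good (Suc n) (u + v, h + g)" "close n p (u + v, h + g)"
      using graph_add[OF u(1) v(1)] v by (auto simp: good_def close_def p_eq diff_diff_eq)
    then show "\<exists>p'. good (Suc n) p' \<and> close n p p'" by blast
  qed
  then obtain P where P: "\<And>n. good n (P n) \<and> close n (P n) (P (Suc n))" by blast
  show ?thesis
    by (rule exI[of _ "\<lambda>n. fst (P n)"], rule exI[of _ "\<lambda>n. snd (P n)"])
      (use P in \<open>simp add: good_def close_def\<close>)
qed

lemma solvable_if_approx_solvable:
  assumes approx: "approx_solvable r k" and r: "r > 0" and k: "k \<ge> 0"
    and f: "f \<in> Y" "normY f < r"
  shows "\<exists>u. G u f \<and> normX u \<le> 2 * k"
proof -
  obtain U F where G: "\<And>n. G (U n) (F n)" and F: "\<And>n. normY (f - F n) < (1/2)^n * r"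
    and U: "\<And>n. normX (U n) \<le> 2 * k * (1 - (1/2)^n)" and step: "\<And>n. normX (U (Suc n) - U n) \<le> (1/2)^n * k"
    using approx_solvable_sequence[OF approx r f] by blast
  obtain u where u: "u \<in> X" "(\<lambda>i. normX (U i - u)) \<longlonglongrightarrow> 0"
    using X.geometric_convergent[of U "1/2" k] graph_mem[OF G] k step by (auto simp: mult.commute)
  have "normY (F i - f) \<le> (1/2)^i * r" for i
    using F[of i] Y.N_commute[of f "F i"] graph_mem[OF G] f by simp
  then have "(\<lambda>i. normY (F i - f)) \<longlonglongrightarrow> 0"
    using graph_mem[OF G] f tendsto_mult_left_zero[OF LIMSEQ_realpow_zero[of "1/2"], of r]
    by (intro Y.N_tendsto_zero_comparison[where r="\<lambda>i. (1/2)^i * r"] Y.diff_mem) auto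
  then have "G u f" using graph_closed[OF G u(1) f(1) u(2)] by blast
  moreover have "normX u \<le> 2 * k"
    using graph_mem[OF G] k by (intro X.N_le_limit[OF _ u] order_trans[OF U] mult_left_le) auto
  ultimately show ?thesis by blast
qed

theorem open_mapping:
  assumes surjective
  obtains K where "K \<ge> 0" "\<And>f. f \<in> Y \<Longrightarrow> \<exists>u. G u f \<and> normX u \<le> K * normY f"
proof -
  obtain r k where rk: "r > 0" "k \<ge> 0" "approx_solvable r k"
    using approx_solvable_if_surjective[OF assms] .
  have "\<exists>u. G u f \<and> normX u \<le> 4 * k / r * normY f" if f: "f \<in> Y" for f
  proof (cases "normY f = 0")
    case True
    then have "G 0 f"
      using graph_closed[of "\<lambda>_. 0" "\<lambda>_. 0" 0 f] graph_zero X.zero_mem f Y.N_minus[OF f]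
      by (simp add: X.N_zero)
    then show ?thesis using True X.N_zero by auto
  next
    case False
    then have pos: "normY f > 0" using Y.N_nonneg[OF f] by simp
    define t where "t = 2 * normY f / r"
    have t: "t > 0" "normY f < t * r" using pos rk by (auto simp: t_def)
    then show ?thesis
      using solvable_if_approx_solvable[OF approx_solvable_scale[OF rk(3) t(1)] _ _ f t(2)] rk
      by (auto simp: t_def mult_ac)
  qed
  then show thesis using that[of "4 * k / r"] rk by simp
qed

corollary bounded_inverse:
  assumes surjective and inj: "\<And>u. G u 0 \<Longrightarrow> normX u = 0"
  obtains K where "K \<ge> 0" "\<And>u f. G u f \<Longrightarrow> normX u \<le> K * normY f"
proof -
  obtain K where K: "K \<ge> 0" "\<And>f. f \<in> Y \<Longrightarrow> \<exists>u. G u f \<and> normX u \<le> K * normY f"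
    using open_mapping[OF assms(1)] by blast
  have "normX u \<le> K * normY f" if u: "G u f" for u f
  proof -
    obtain v where v: "G v f" "normX v \<le> K * normY f" using K graph_mem[OF u] by blast
    have "normX (u - v) = 0" using graph_diff[OF u v(1)] inj by simp
    then show ?thesis
      using X.N_add_le[of "u - v" v] graph_mem[OF u] graph_mem[OF v(1)] v(2) by (simp add: X.diff_mem)
  qed
  then show thesis using that K by blast
qed

lemma perturbed_bound:
  assumes bound: "\<And>u f. G u f \<Longrightarrow> normX u \<le> K * normY f" and K: "K \<ge> 0" "K * b < 1"
    and f: "f \<in> Y" and B: "g \<in> Y" "normY g \<le> b * normX u" and u: "G u (f + g)"
  shows "normX u \<le> K / (1 - K * b) * normY f"
proof -
  have "normX u \<le> K * (normY f + b * normX u)"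
    using bound[OF u] K(1) Y.N_add_le[OF f B(1)] B(2) by (meson add_left_mono mult_left_mono order_trans)
  then show ?thesis using K(2) by (simp add: field_simps)
qed

lemma perturbed_solvable:
  assumes surjective and bound: "\<And>u f. G u f \<Longrightarrow> normX u \<le> K * normY f" and K: "K \<ge> 0" "K * b < 1"
    and b: "b \<ge> 0" and B: "\<And>u. u \<in> X \<Longrightarrow> B u \<in> Y"
    and lip: "\<And>u v. u \<in> X \<Longrightarrow> v \<in> X \<Longrightarrow> normY (B u - B v) \<le> b * normX (u - v)"
    and f: "f \<in> Y"
  shows "\<exists>u. G u (f + B u)"
proof -
  obtain J where J: "\<And>g. g \<in> Y \<Longrightarrow> G (J g) g" using assms(1) unfolding surjective_def by metis
  define U where "U = rec_nat 0 (\<lambda>_ u. J (f + B u))"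
  have U_Suc: "U (Suc n) = J (f + B (U n))" for n by (simp add: U_def)
  have U: "U n \<in> X" for n
  proof (induction n)
    case (Suc n)
    then show ?case using graph_mem[OF J[OF Y.add_mem[OF f B]]] by (simp add: U_Suc)
  qed (simp add: U_def X.zero_mem)
  have G: "G (U (Suc n)) (f + B (U n))" for n unfolding U_Suc by (intro J Y.add_mem f B U)
  have step: "normX (U (Suc n) - U n) \<le> normX (U 1 - U 0) * (K * b) ^ n" for n
  proof (induction n)
    case (Suc n)
    have "normX (U (Suc (Suc n)) - U (Suc n)) \<le> K * normY (B (U (Suc n)) - B (U n))"
      using bound[OF graph_diff[OF G G], of "Suc n" n] by simp
    also have "\<dots> \<le> (K * b) * normX (U (Suc n) - U n)"
      using mult_left_mono[OF lip[OF U U] K(1)] by (simp add: mult.assoc)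
    also have "\<dots> \<le> (K * b) * (normX (U 1 - U 0) * (K * b) ^ n)"
      using Suc K(1) b by (intro mult_left_mono) auto
    finally show ?case by (simp add: mult_ac)
  qed simp
  obtain u where u: "u \<in> X" "(\<lambda>i. normX (U i - u)) \<longlonglongrightarrow> 0"
    using X.geometric_convergent[OF U _ K(2) X.N_nonneg[OF X.diff_mem[OF U U]] step] K(1) b by auto
  have "(\<lambda>i. normY (B (U i) - B u)) \<longlonglongrightarrow> 0"
    by (intro Y.N_tendsto_zero_comparison[OF _ lip[OF U u(1)]] Y.diff_mem B U u(1)
        tendsto_mult_right_zero u(2))
  then have "(\<lambda>i. normY ((f + B (U i)) - (f + B u))) \<longlonglongrightarrow> 0" by simp
  from graph_closed[OF G u(1) Y.add_mem[OF f B[OF u(1)]] LIMSEQ_Suc[OF u(2)] this] show ?thesis ..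
qed

end

section \<open>Iterated one-sided derivatives\<close>

declare dn.simps(2) [simp del]

definition scale_fun :: "complex \<Rightarrow> (real \<Rightarrow> complex) \<Rightarrow> real \<Rightarrow> complex" where
  "scale_fun c f = (\<lambda>x. c * f x)"

lemma scale_fun_apply [simp]: "scale_fun c f x = c * f x"
  by (simp add: scale_fun_def)

interpretation scale_fun: vector_space scale_fun
  by standard (auto simp: fun_eq_iff algebra_simps)

lemma at_within_unit_interval_nontrivial:
  "x \<in> {0..1} \<Longrightarrow> at x within {0..1::real} \<noteq> bot"
  by (auto simp: trivial_limit_within intro!: islimpt_closure_open[where s="{0<..<1::real}"])

lemma dn_has_derivative:
  assumes "smooth01 u" "x \<in> {0..1}"
  shows "(dn n u has_vector_derivative dn (Suc n) u x) (at x within {0..1})"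
  using assms by (auto simp: smooth01_def dn.simps(2) vector_derivative_works[symmetric])

lemma dn_Suc_eqI:
  assumes "(g has_vector_derivative y) (at x within {0..1})" "x \<in> {0..1}"
    and "\<And>t. t \<in> {0..1} \<Longrightarrow> dn n u t = g t"
  shows "dn (Suc n) u x = y"
proof -
  have "(dn n u has_vector_derivative y) (at x within {0..1})"
    using assms by (intro has_vector_derivative_transform[OF _ _ assms(1)]) auto
  then show ?thesis
    using vector_derivative_within[OF at_within_unit_interval_nontrivial] assms(2) by (simp add: dn.simps(2))
qed

lemma dn_eqI:
  assumes u: "\<And>x. x \<in> {0..1} \<Longrightarrow> u x = g 0 x"
    and g: "\<And>n x. x \<in> {0..1} \<Longrightarrow> (g n has_vector_derivative g (Suc n) x) (at x within {0..1})"
  shows "smooth01 u" and "x \<in> {0..1} \<Longrightarrow> dn n u x = g n x"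
proof -
  have eq: "\<forall>x\<in>{0..1}. dn n u x = g n x" for n
    by (induction n) (use u dn_Suc_eqI[OF g] in auto)
  show "x \<in> {0..1} \<Longrightarrow> dn n u x = g n x" using eq by auto
  show "smooth01 u"
    unfolding smooth01_def
    using eq by (blast intro: differentiableI_vector has_vector_derivative_transform[OF _ _ g])
qed

lemma smooth01_cong:
  assumes "smooth01 u" "\<And>x. x \<in> {0..1} \<Longrightarrow> u x = v x"
  shows "smooth01 v" and "x \<in> {0..1} \<Longrightarrow> dn n v x = dn n u x"
  by (rule dn_eqI[where g="\<lambda>n. dn n u"]; use assms dn_has_derivative in simp)+

lemma dn_local:
  assumes "open T" "\<And>x. x \<in> {0..1} \<inter> T \<Longrightarrow> u x = v x" "x \<in> {0..1} \<inter> T"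
  shows "dn n u x = dn n v x"
  using assms(3)
proof (induction n arbitrary: x)
  case (Suc n)
  have "eventually (\<lambda>y. y \<in> {0..1} \<longrightarrow> dn n u y = dn n v y) (nhds x)"
    unfolding eventually_nhds by (rule exI[of _ T]) (use assms(1) Suc in auto)
  then have "vector_derivative (dn n u) (at x within {0..1}) =
      vector_derivative (dn n v) (at x within {0..1})"
    by (intro vector_derivative_cong_eq) (use Suc in auto)
  then show ?case by (simp add: dn.simps(2))
qed (use assms in auto)

lemma
  assumes "smooth01 u" "smooth01 v"
  shows smooth01_add: "smooth01 (u + v)"
    and dn_add: "x \<in> {0..1} \<Longrightarrow> dn n (u + v) x = dn n u x + dn n v x"
  by (rule dn_eqI[where g="\<lambda>n x. dn n u x + dn n v x"];
      auto intro!: has_vector_derivative_add dn_has_derivative simp: assms)+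

lemma
  assumes "smooth01 u"
  shows smooth01_scale: "smooth01 (scale_fun c u)"
    and dn_scale: "x \<in> {0..1} \<Longrightarrow> dn n (scale_fun c u) x = c * dn n u x"
  by (rule dn_eqI[where g="\<lambda>n x. c * dn n u x"];
      auto intro!: has_vector_derivative_mult_right dn_has_derivative simp: assms)+

lemma
  assumes "smooth01 u" "smooth01 v"
  shows smooth01_diff: "smooth01 (u - v)"
    and dn_diff: "x \<in> {0..1} \<Longrightarrow> dn n (u - v) x = dn n u x - dn n v x"
  by (rule dn_eqI[where g="\<lambda>n x. dn n u x - dn n v x"];
      auto intro!: has_vector_derivative_diff dn_has_derivative simp: assms)+

lemma
  shows smooth01_one: "smooth01 1"
    and dn_one: "x \<in> {0..1} \<Longrightarrow> dn n 1 x = (if n = 0 then 1 else 0)"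
  by (rule dn_eqI[where g="\<lambda>n x. if n = 0 then 1 else 0"]; auto)+

lemma smooth01_zero: "smooth01 0"
  using smooth01_scale[OF smooth01_one, of 0] by simp

lemma dn_eq_zero: "(\<And>x. x \<in> {0..1} \<Longrightarrow> u x = 0) \<Longrightarrow> x \<in> {0..1} \<Longrightarrow> dn n u x = 0"
  by (rule dn_eqI(2)[where g="\<lambda>n x. 0"]) auto

lemma dn_dn: "dn n (dn k u) = dn (n + k) u"
  by (induction n) (auto simp: dn.simps(2))

lemma smooth01_dn: "smooth01 u \<Longrightarrow> smooth01 (dn k u)"
  by (auto simp: smooth01_def dn_dn)

lemma continuous_on_dn: "smooth01 u \<Longrightarrow> continuous_on {0..1} (dn n u)"
  by (auto simp: smooth01_def intro!: differentiable_imp_continuous_on simp: differentiable_on_def)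

lemma smooth01_continuous_on: "smooth01 u \<Longrightarrow> continuous_on {0..1} u"
  using continuous_on_dn[of u 0] by simp

section \<open>Classical solutions\<close>

definition classical_solution ::
    "(real \<Rightarrow> complex) \<Rightarrow> complex \<Rightarrow> (real \<Rightarrow> complex) \<Rightarrow>
     (real \<Rightarrow> complex) \<Rightarrow> (real \<Rightarrow> complex) \<Rightarrow> (real \<Rightarrow> complex) \<Rightarrow> bool" where
  "classical_solution W s f u u' u'' \<longleftrightarrow> (\<forall>x\<in>{0..1}.
     (u has_vector_derivative u' x) (at x within {0..1}) \<and>
     (u' has_vector_derivative u'' x) (at x within {0..1}) \<and>
     of_real (x\<^sup>2) * u'' x + (of_real (2 * x) + s) * u' x - W x * u x = f x)"

lemma classical_solutionD:
  assumes "classical_solution W s f u u' u''" "x \<in> {0..1}"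
  shows "(u has_vector_derivative u' x) (at x within {0..1})"
    and "(u' has_vector_derivative u'' x) (at x within {0..1})"
    and "of_real (x\<^sup>2) * u'' x + (of_real (2 * x) + s) * u' x - W x * u x = f x"
  using assms by (auto simp: classical_solution_def)

lemma classical_solution_dn:
  assumes sol: "classical_solution W s f u u' u''" and x: "x \<in> {0..1}"
  shows "dn 1 u x = u' x" "dn 2 u x = u'' x"
proof -
  have d1: "dn 1 u t = u' t" if "t \<in> {0..1}" for t
    using dn_Suc_eqI[OF classical_solutionD(1)[OF sol that] that, of 0 u] by simp
  then show "dn 1 u x = u' x" using x .
  show "dn 2 u x = u'' x"
    using dn_Suc_eqI[OF classical_solutionD(2)[OF sol x] x, of 1 u] d1 by (simp add: numeral_2_eq_2)
qed

lemma classical_solution_diff: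
  assumes "classical_solution W s f u u' u''" "classical_solution W s g v v' v''"
  shows "classical_solution W s (f - g) (u - v) (u' - v') (u'' - v'')"
  unfolding classical_solution_def
proof (intro ballI conjI)
  fix x :: real assume x: "x \<in> {0..1}"
  note u = classical_solutionD[OF assms(1) x] and v = classical_solutionD[OF assms(2) x]
  show "(u - v has_vector_derivative (u' - v') x) (at x within {0..1})"
    "(u' - v' has_vector_derivative (u'' - v'') x) (at x within {0..1})"
    using has_vector_derivative_diff[OF u(1) v(1)] has_vector_derivative_diff[OF u(2) v(2)]
    by (simp_all add: fun_diff_def)
  show "of_real (x\<^sup>2) * (u'' - v'') x + (of_real (2 * x) + s) * (u' - v') x - W x * (u - v) x = (f - g) x"
    by (simp add: u(3)[symmetric] v(3)[symmetric] algebra_simps)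
qed

lemma Lop_eq:
  assumes "smooth01 u" "x \<in> {0..1}"
  shows "Lop W s u x = of_real (x\<^sup>2) * dn 2 u x + (of_real (2 * x) + s) * dn 1 u x - W x * u x"
proof -
  have "((\<lambda>y. complex_of_real (y\<^sup>2) * dn 1 u y) has_vector_derivative
      of_real (x\<^sup>2) * dn 2 u x + of_real (2 * x) * dn 1 u x) (at x within {0..1})"
  proof (rule has_vector_derivative_mult)
    show "((\<lambda>y. complex_of_real (y\<^sup>2)) has_vector_derivative complex_of_real (2 * x)) (at x within {0..1})"
      by (rule has_vector_derivative_of_real)
         (auto intro!: derivative_eq_intros simp: has_real_derivative_iff_has_vector_derivative[symmetric])
    show "(dn 1 u has_vector_derivative dn 2 u x) (at x within {0..1})"
      using dn_has_derivative[OF assms, of 1] by (simp add: numeral_2_eq_2)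
  qed
  from dn_Suc_eqI[OF this assms(2), of 0] show ?thesis
    by (simp add: Lop_def algebra_simps)
qed

lemma classical_solution_dnI:
  assumes "smooth01 u" "\<And>x. x \<in> {0..1} \<Longrightarrow> Lop W s u x = f x"
  shows "classical_solution W s f u (dn 1 u) (dn 2 u)"
  using dn_has_derivative[OF assms(1), of _ 0] dn_has_derivative[OF assms(1), of _ 1] assms(2)
  by (auto simp: Lop_eq[OF assms(1)] classical_solution_def numeral_2_eq_2)

lemma Lop_classical_solution:
  assumes "smooth01 u" "classical_solution W s f u u' u''" "x \<in> {0..1}"
  shows "Lop W s u x = f x"
  unfolding Lop_eq[OF assms(1,3)] classical_solution_dn[OF assms(2,3)]
  by (rule classical_solutionD(3)[OF assms(2,3)])

lemma Lop_add:
  "smooth01 u \<Longrightarrow> smooth01 v \<Longrightarrow> x \<in> {0..1} \<Longrightarrow> Lop W s (u + v) x = Lop W s u x + Lop W s v x"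
  by (simp add: Lop_eq smooth01_add dn_add) (simp add: algebra_simps)

lemma Lop_diff:
  "smooth01 u \<Longrightarrow> smooth01 v \<Longrightarrow> x \<in> {0..1} \<Longrightarrow> Lop W s (u - v) x = Lop W s u x - Lop W s v x"
  by (simp add: Lop_eq smooth01_diff dn_diff) (simp add: algebra_simps)

lemma Lop_scale:
  "smooth01 u \<Longrightarrow> x \<in> {0..1} \<Longrightarrow> Lop W s (scale_fun c u) x = c * Lop W s u x"
  by (simp add: Lop_eq smooth01_scale dn_scale) (simp add: algebra_simps)

lemma Lop_one: "x \<in> {0..1} \<Longrightarrow> Lop W s 1 x = - W x"
  by (simp add: Lop_eq smooth01_one dn_one)

lemma Lop_shift:
  "smooth01 u \<Longrightarrow> x \<in> {0..1} \<Longrightarrow> Lop W s u x = Lop W t u x + (s - t) * dn 1 u x"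
  by (simp add: Lop_eq algebra_simps)

section \<open>Elementary integral inequalities\<close>

lemma square_integral_le:
  fixes g :: "real \<Rightarrow> real"
  assumes g: "continuous_on {a..b} g" and "a < b"
  shows "(integral {a..b} g)\<^sup>2 \<le> (b - a) * integral {a..b} (\<lambda>x. (g x)\<^sup>2)"
proof -
  define I J where "I = integral {a..b} g" and "J = integral {a..b} (\<lambda>x. (g x)\<^sup>2)"
  let ?l = "b - a"
  have "(g has_integral I) {a..b}" "((\<lambda>x. (g x)\<^sup>2) has_integral J) {a..b}"
    unfolding I_def J_def using g
    by (auto intro!: integrable_integral integrable_continuous_real continuous_intros)
  moreover have "((\<lambda>x. I\<^sup>2) has_integral ?l * I\<^sup>2) {a..b}"
    using has_integral_const_real[of "I\<^sup>2" a b] \<open>a < b\<close> by simp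
  ultimately have "((\<lambda>x. ?l\<^sup>2 * (g x)\<^sup>2 - 2 * ?l * I * g x + I\<^sup>2) has_integral
      ?l\<^sup>2 * J - 2 * ?l * I * I + ?l * I\<^sup>2) {a..b}"
    by (intro has_integral_add has_integral_diff has_integral_mult_right)
  moreover have "?l\<^sup>2 * (g x)\<^sup>2 - 2 * ?l * I * g x + I\<^sup>2 = (?l * g x - I)\<^sup>2" for x
    by (simp add: power2_eq_square algebra_simps)
  ultimately have "((\<lambda>x. (?l * g x - I)\<^sup>2) has_integral ?l\<^sup>2 * J - 2 * ?l * I * I + ?l * I\<^sup>2) {a..b}" by simp
  then have "0 \<le> ?l\<^sup>2 * J - 2 * ?l * I * I + ?l * I\<^sup>2" by (rule has_integral_nonneg) simp
  also have "\<dots> = ?l * (?l * J - I\<^sup>2)" by (simp add: power2_eq_square algebra_simps)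
  finally show ?thesis using \<open>a < b\<close> by (simp add: zero_le_mult_iff I_def J_def)
qed

lemma norm_diff_le_integral_norm_derivative:
  fixes g h :: "real \<Rightarrow> 'a::banach"
  assumes der: "\<And>x. x \<in> {a..b} \<Longrightarrow> (g has_vector_derivative h x) (at x within {a..b})"
    and cont: "continuous_on {a..b} h" and x: "x \<in> {a..b}" and y: "y \<in> {a..b}"
  shows "norm (g x - g y) \<le> integral {a..b} (\<lambda>t. norm (h t))"
proof -
  have ordered: "norm (g d - g c) \<le> integral {a..b} (\<lambda>t. norm (h t))" if "a \<le> c" "c \<le> d" "d \<le> b" for c d
  proof -
    have c: "continuous_on {c..d} h" using cont by (rule continuous_on_subset) (use that in auto)
    have "(h has_integral g d - g c) {c..d}"
      using that by (intro fundamental_theorem_of_calculus has_vector_derivative_within_subset[OF der]) auto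
    then have "norm (g d - g c) \<le> integral {c..d} (\<lambda>t. norm (h t))"
      using c by (metis integral_unique integral_norm_bound_integral integrable_continuous_real
          continuous_on_norm order_refl)
    also have "\<dots> \<le> integral {a..b} (\<lambda>t. norm (h t))"
      using that c cont
      by (intro integral_subset_le) (auto intro!: integrable_continuous_real continuous_intros)
    finally show ?thesis .
  qed
  show ?thesis
    using ordered[of x y] ordered[of y x] x y by (cases "x \<le> y") (auto simp: norm_minus_commute)
qed

lemma norm_le_integral_norm_add_derivative:
  fixes g h :: "real \<Rightarrow> 'a::banach"
  assumes der: "\<And>x. x \<in> {a..b} \<Longrightarrow> (g has_vector_derivative h x) (at x within {a..b})"
    and cont: "continuous_on {a..b} h" and x: "x \<in> {a..b}"
  shows "(b - a) * norm (g x) \<le> integral {a..b} (\<lambda>t. norm (g t)) + (b - a) * integral {a..b} (\<lambda>t. norm (h t))"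
proof -
  let ?H = "integral {a..b} (\<lambda>t. norm (h t))"
  have g: "continuous_on {a..b} g"
    using der has_vector_derivative_continuous by (fastforce simp: continuous_on_eq_continuous_within)
  have "integral {a..b} (\<lambda>y. norm (g x)) \<le> integral {a..b} (\<lambda>y. norm (g y) + ?H)"
  proof (rule integral_le)
    fix y assume y: "y \<in> {a..b}"
    show "norm (g x) \<le> norm (g y) + ?H"
      using norm_diff_le_integral_norm_derivative[OF der cont x y] norm_triangle_sub[of "g x" "g y"] by simp
  qed (use g in \<open>auto intro!: integrable_continuous_real continuous_intros\<close>)
  also have "\<dots> = integral {a..b} (\<lambda>t. norm (g t)) + (b - a) * ?H"
    using g x by (subst integral_add) (auto intro!: integrable_continuous_real continuous_intros)
  finally show ?thesis using x by simp
qed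

lemma norm_add_square_le:
  fixes x y :: "'a::real_normed_vector"
  assumes "0 < t" "t < 1"
  shows "(norm (x + y))\<^sup>2 \<le> (norm x)\<^sup>2 / t + (norm y)\<^sup>2 / (1 - t)"
proof -
  have "(norm (x + y))\<^sup>2 \<le> (norm x + norm y)\<^sup>2"
    by (intro power_mono norm_triangle_ineq) auto
  also have "0 \<le> ((1 - t) * norm x - t * norm y)\<^sup>2 / (t * (1 - t))" using assms by simp
  then have "(norm x + norm y)\<^sup>2 \<le> (norm x)\<^sup>2 / t + (norm y)\<^sup>2 / (1 - t)"
    using assms by (simp add: field_simps power2_eq_square)
  finally show ?thesis .
qed

lemma sqrt_le_add_sqrt_if_convex_bound:
  assumes "0 \<le> a" "0 \<le> b" "0 \<le> c"
    and bound: "\<And>t. 0 < t \<Longrightarrow> t < 1 \<Longrightarrow> c \<le> a / t + b / (1 - t)"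
  shows "sqrt c \<le> sqrt a + sqrt b"
proof -
  have "sqrt c \<le> sqrt a + sqrt b + 2 * e" if e: "e > 0" for e :: real
  proof -
    let ?p = "sqrt a + e" and ?q = "sqrt b + e"
    have pq: "?p > 0" "?q > 0" "a \<le> ?p\<^sup>2" "b \<le> ?q\<^sup>2"
      using assms e by (auto simp: power2_sum add_nonneg_pos)
    have "c \<le> a / (?p / (?p + ?q)) + b / (1 - ?p / (?p + ?q))"
      using pq by (intro bound) (auto simp: field_simps)
    also have "1 - ?p / (?p + ?q) = ?q / (?p + ?q)" using pq by (simp add: field_simps)
    also have "a / (?p / (?p + ?q)) + b / (?q / (?p + ?q)) \<le>
        ?p\<^sup>2 / (?p / (?p + ?q)) + ?q\<^sup>2 / (?q / (?p + ?q))"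
      using pq by (intro add_mono divide_right_mono) auto
    also have "\<dots> = (?p + ?q)\<^sup>2"
      using pq(1,2) by (simp add: power2_eq_square) (simp add: algebra_simps)
    finally show ?thesis using pq by (intro real_le_lsqrt) (auto simp: algebra_simps)
  qed
  then show ?thesis
    by (metis field_le_epsilon field_sum_of_halves half_gt_zero mult_2)
qed

lemma has_vector_derivative_uniform_limit:
  fixes f f' :: "nat \<Rightarrow> real \<Rightarrow> 'a::banach"
  assumes "convex S" and x: "x \<in> S"
    and der: "\<And>i x. x \<in> S \<Longrightarrow> (f i has_vector_derivative f' i x) (at x within S)"
    and f': "uniform_limit S f' g' sequentially"
    and f: "\<And>x. x \<in> S \<Longrightarrow> (\<lambda>i. f i x) \<longlonglongrightarrow> g x"
  shows "(g has_vector_derivative g' x) (at x within S)"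
proof -
  have "\<exists>h. \<forall>x\<in>S. (\<lambda>i. f i x) \<longlonglongrightarrow> h x \<and> (h has_derivative (\<lambda>y. y *\<^sub>R g' x)) (at x within S)"
  proof (rule has_derivative_sequence)
    show "convex S" "x \<in> S" "(\<lambda>i. f i x) \<longlonglongrightarrow> g x" using \<open>convex S\<close> x f by auto
    show "(f i has_derivative (\<lambda>y. y *\<^sub>R f' i x)) (at x within S)" if "x \<in> S" for i x
      using der[OF that] by (simp add: has_vector_derivative_def)
    fix e :: real assume "e > 0"
    then have "\<forall>\<^sub>F i in sequentially. \<forall>x\<in>S. dist (f' i x) (g' x) < e"
      using f' by (simp add: uniform_limit_iff)
    then show "\<forall>\<^sub>F i in sequentially. \<forall>x\<in>S. \<forall>y. norm (y *\<^sub>R f' i x - y *\<^sub>R g' x) \<le> e * norm y"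
    proof eventually_elim
      case (elim i)
      then have "norm (f' i x - g' x) \<le> e" if "x \<in> S" for x
        using that by (auto simp: dist_norm less_imp_le)
      then show ?case by (simp add: mult.commute[of e] mult_left_mono flip: scaleR_diff_right)
    qed
  qed
  then obtain h where h: "\<And>x. x \<in> S \<Longrightarrow> (\<lambda>i. f i x) \<longlonglongrightarrow> h x"
      "(h has_vector_derivative g' x) (at x within S)"
    using x by (auto simp: has_vector_derivative_def)
  then show ?thesis
    using f by (intro has_vector_derivative_transform[OF x _ h(2)]) (blast intro: LIMSEQ_unique)
qed

section \<open>Spaces of smooth functions with weighted derivatives\<close>

locale weighted_smooth_space =
  fixes w :: "nat \<Rightarrow> real \<Rightarrow> real" and b :: "nat \<Rightarrow> real"
  assumes continuous_weight: "continuous_on {0..1} (w n)"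
    and weight_pos: "x \<in> {0..1} \<Longrightarrow> 0 < w n x"
    and boundary_weight_nonneg: "0 \<le> b n"
begin

definition energy :: "(real \<Rightarrow> complex) \<Rightarrow> nat \<Rightarrow> real" where
  "energy f n = integral {0..1} (\<lambda>x. w n x * (norm (dn n f x))\<^sup>2) + b n * (norm (dn n f 0))\<^sup>2"

definition carrier :: "(real \<Rightarrow> complex) set" where
  "carrier = {f. smooth01 f \<and> summable (energy f)}"

definition total_norm :: "(real \<Rightarrow> complex) \<Rightarrow> real" where
  "total_norm f = sqrt (\<Sum>n. energy f n)"

definition mass :: "nat \<Rightarrow> real" where
  "mass n = integral {0..1} (w n) + b n"

lemma carrier_smooth: "f \<in> carrier \<Longrightarrow> smooth01 f"
  by (simp add: carrier_def)

lemma integrable_weighted: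
  "smooth01 f \<Longrightarrow> (\<lambda>x. w n x * (norm (dn n f x))\<^sup>2) integrable_on {0..1}"
  by (intro integrable_continuous_real continuous_intros continuous_weight continuous_on_dn)

lemma weight_nonneg: "x \<in> {0..1} \<Longrightarrow> 0 \<le> w n x"
  using weight_pos[of x n] by simp

lemma mass_nonneg: "0 \<le> mass n"
  unfolding mass_def by (intro add_nonneg_nonneg integral_nonneg integrable_continuous_real
      continuous_weight weight_nonneg boundary_weight_nonneg)

lemma energy_nonneg: "smooth01 f \<Longrightarrow> 0 \<le> energy f n"
  unfolding energy_def
  by (intro add_nonneg_nonneg integral_nonneg integrable_weighted mult_nonneg_nonneg
      weight_nonneg boundary_weight_nonneg zero_le_power2)

lemma energy_cong:
  assumes "smooth01 f" "\<And>x. x \<in> {0..1} \<Longrightarrow> f x = g x"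
  shows "energy g = energy f"
proof
  fix n
  have "integral {0..1} (\<lambda>x. w n x * (norm (dn n g x))\<^sup>2) = integral {0..1} (\<lambda>x. w n x * (norm (dn n f x))\<^sup>2)"
    by (rule integral_cong) (use smooth01_cong(2)[OF assms] in auto)
  then show "energy g n = energy f n"
    using smooth01_cong(2)[OF assms, of 0 n] by (simp add: energy_def)
qed

lemma energy_add_le:
  assumes f: "smooth01 f" and g: "smooth01 g" and t: "0 < t" "t < 1"
  shows "energy (f + g) n \<le> energy f n / t + energy g n / (1 - t)"
proof -
  let ?I = "\<lambda>f. integral {0..1} (\<lambda>x. w n x * (norm (dn n f x))\<^sup>2)"
  have i: "(\<lambda>x. w n x * (norm (dn n f x))\<^sup>2 / t) integrable_on {0..1}"
    "(\<lambda>x. w n x * (norm (dn n g x))\<^sup>2 / (1 - t)) integrable_on {0..1}"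
    by (intro integrable_on_divide integrable_weighted f g)+
  have pointwise: "c * (norm (dn n (f + g) x))\<^sup>2 \<le>
      c * (norm (dn n f x))\<^sup>2 / t + c * (norm (dn n g x))\<^sup>2 / (1 - t)"
    if "x \<in> {0..1}" "0 \<le> c" for x c
    using mult_left_mono[OF norm_add_square_le[OF t] that(2)] that(1) f g by (simp add: dn_add distrib_left)
  have "?I (f + g) \<le>
      integral {0..1} (\<lambda>x. w n x * (norm (dn n f x))\<^sup>2 / t + w n x * (norm (dn n g x))\<^sup>2 / (1 - t))"
    by (intro integral_le integrable_add i integrable_weighted smooth01_add f g pointwise weight_nonneg)
  also have "\<dots> = ?I f / t + ?I g / (1 - t)"
    by (subst integral_add[OF i]) simp
  finally show ?thesis
    unfolding energy_def using pointwise[of 0 "b n"] boundary_weight_nonneg[of n]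
    by (simp add: add_divide_distrib)
qed

lemma energy_scale: "smooth01 f \<Longrightarrow> energy (scale_fun c f) n = (norm c)\<^sup>2 * energy f n"
proof -
  assume f: "smooth01 f"
  have "integral {0..1} (\<lambda>x. w n x * (norm (dn n (scale_fun c f) x))\<^sup>2) =
     integral {0..1} (\<lambda>x. (norm c)\<^sup>2 * (w n x * (norm (dn n f x))\<^sup>2))"
    by (intro integral_cong) (simp add: dn_scale f norm_mult power_mult_distrib)
  also have "\<dots> = (norm c)\<^sup>2 * integral {0..1} (\<lambda>x. w n x * (norm (dn n f x))\<^sup>2)" by simp
  finally show ?thesis
    unfolding energy_def by (simp add: dn_scale f norm_mult power_mult_distrib distrib_left mult.left_commute)
qed

lemma energy_zero: "energy 0 = (\<lambda>n. 0)"
  using energy_scale[OF smooth01_zero, of 0] by auto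

lemma energy_le_if_dominated:
  assumes u: "smooth01 u" and v: "smooth01 v"
    and le: "\<And>x. x \<in> {0..1} \<Longrightarrow> norm (dn n v x) \<le> max (norm (dn n u x)) B"
  shows "energy v n \<le> energy u n + mass n * B\<^sup>2"
proof -
  have square: "(norm (dn n v x))\<^sup>2 \<le> (norm (dn n u x))\<^sup>2 + B\<^sup>2" if "x \<in> {0..1}" for x
    using power_mono[OF le[OF that] norm_ge_zero, of 2]
    by (auto simp: max_def add_increasing add_increasing2 split: if_splits)
  have i: "(\<lambda>x. w n x * B\<^sup>2) integrable_on {0..1}"
    by (intro integrable_continuous_real continuous_intros continuous_weight)
  have "integral {0..1} (\<lambda>x. w n x * (norm (dn n v x))\<^sup>2) \<le>
      integral {0..1} (\<lambda>x. w n x * (norm (dn n u x))\<^sup>2 + w n x * B\<^sup>2)"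
    using mult_left_mono[OF square weight_nonneg]
    by (intro integral_le integrable_add integrable_weighted u v i) (simp add: distrib_left)
  also have "\<dots> = integral {0..1} (\<lambda>x. w n x * (norm (dn n u x))\<^sup>2) + integral {0..1} (w n) * B\<^sup>2"
    by (simp add: integral_add[OF integrable_weighted[OF u] i])
  finally show ?thesis
    unfolding energy_def mass_def
    using mult_left_mono[OF square boundary_weight_nonneg, of 0 n] by (simp add: algebra_simps)
qed

lemma sum_energy_le: "f \<in> carrier \<Longrightarrow> (\<Sum>n<K. energy f n) \<le> (total_norm f)\<^sup>2"
  unfolding total_norm_def
  by (auto simp: carrier_def energy_nonneg suminf_nonneg intro!: sum_le_suminf)

lemma carrier_total_norm_leI:
  assumes f: "smooth01 f" and B: "0 \<le> B" and le: "\<And>K. (\<Sum>n<K. energy f n) \<le> B\<^sup>2"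
  shows "f \<in> carrier" "total_norm f \<le> B"
proof -
  have sum: "summable (energy f)" by (rule summableI_nonneg_bounded[OF energy_nonneg[OF f] le])
  then show "f \<in> carrier" using f by (simp add: carrier_def)
  show "total_norm f \<le> B"
    unfolding total_norm_def using suminf_le_const[OF sum le] B by (simp add: real_le_lsqrt)
qed

lemma
  assumes "f \<in> carrier" "\<And>x. x \<in> {0..1} \<Longrightarrow> f x = g x"
  shows carrier_cong: "g \<in> carrier" and total_norm_cong: "total_norm g = total_norm f"
  using energy_cong[OF carrier_smooth[OF assms(1)] assms(2)] assms(1)
    smooth01_cong(1)[OF carrier_smooth[OF assms(1)] assms(2)]
  by (auto simp: carrier_def total_norm_def)

lemma carrier_if_dominated:
  assumes u: "u \<in> carrier" and v: "smooth01 v"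
    and le: "\<And>n x. x \<in> {0..1} \<Longrightarrow> norm (dn n v x) \<le> max (norm (dn n u x)) (B n)"
    and B: "summable (\<lambda>n. mass n * (B n)\<^sup>2)"
  shows "v \<in> carrier"
proof -
  have "summable (\<lambda>n. energy u n + mass n * (B n)\<^sup>2)"
    using u B by (intro summable_add) (auto simp: carrier_def)
  moreover have "norm (energy v n) \<le> energy u n + mass n * (B n)\<^sup>2" for n
    using energy_le_if_dominated[OF carrier_smooth[OF u] v le] energy_nonneg[OF v] by simp
  ultimately have "summable (energy v)" by (rule summable_comparison_test')
  then show ?thesis using v by (simp add: carrier_def)
qed

lemma
  assumes f: "f \<in> carrier" and g: "g \<in> carrier"
  shows carrier_add: "f + g \<in> carrier"
    and total_norm_add_le: "total_norm (f + g) \<le> total_norm f + total_norm g"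
proof -
  note smooth = carrier_smooth[OF f] carrier_smooth[OF g]
  have summable: "summable (energy f)" "summable (energy g)" using f g by (auto simp: carrier_def)
  have "summable (\<lambda>n. energy f n / (1/2) + energy g n / (1 - 1/2))"
    by (intro summable_add summable_divide summable)
  moreover have "norm (energy (f + g) n) \<le> energy f n / (1/2) + energy g n / (1 - 1/2)" for n
    using energy_add_le[OF smooth, of "1/2" n] energy_nonneg[OF smooth01_add[OF smooth], of n] by simp
  ultimately have sum: "summable (energy (f + g))" by (rule summable_comparison_test')
  then show "f + g \<in> carrier" by (simp add: carrier_def smooth01_add smooth)
  show "total_norm (f + g) \<le> total_norm f + total_norm g"
    unfolding total_norm_def
  proof (rule sqrt_le_add_sqrt_if_convex_bound)
    fix t :: real assume t: "0 < t" "t < 1"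
    have "(\<Sum>n. energy (f + g) n) \<le> (\<Sum>n. energy f n / t + energy g n / (1 - t))"
      by (intro suminf_le sum summable_add summable_divide summable energy_add_le smooth t)
    also have "\<dots> = suminf (energy f) / t + suminf (energy g) / (1 - t)"
      by (subst suminf_add[symmetric]) (auto intro!: summable_divide summable simp: suminf_divide summable)
    finally show "(\<Sum>n. energy (f + g) n) \<le> suminf (energy f) / t + suminf (energy g) / (1 - t)" .
  qed (intro suminf_nonneg sum summable energy_nonneg smooth01_add smooth)+
qed

lemma
  assumes f: "f \<in> carrier"
  shows carrier_scale: "scale_fun c f \<in> carrier"
    and total_norm_scale: "total_norm (scale_fun c f) = norm c * total_norm f"
proof -
  have "energy (scale_fun c f) = (\<lambda>n. (norm c)\<^sup>2 * energy f n)"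
    using energy_scale[OF carrier_smooth[OF f]] by auto
  then show "scale_fun c f \<in> carrier" "total_norm (scale_fun c f) = norm c * total_norm f"
    using f by (auto simp: carrier_def total_norm_def smooth01_scale summable_mult suminf_mult real_sqrt_mult)
qed

lemma zero_in_carrier: "0 \<in> carrier"
  by (simp add: carrier_def smooth01_zero energy_zero)

sublocale seminormed_space scale_fun carrier total_norm
proof
  show "scale_fun.subspace carrier"
    by (intro scale_fun.subspaceI zero_in_carrier carrier_add carrier_scale)
qed (fact total_norm_add_le total_norm_scale)+

lemma integral_norm_dn_le:
  "\<exists>C\<ge>0. \<forall>f\<in>carrier. integral {0..1} (\<lambda>x. norm (dn n f x)) \<le> C * total_norm f"
proof -
  obtain x where x: "x \<in> {0..1}" "\<And>y. y \<in> {0..1} \<Longrightarrow> w n x \<le> w n y"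
    using continuous_attains_inf[OF _ _ continuous_weight[of n]] by auto
  have "integral {0..1} (\<lambda>x. norm (dn n f x)) \<le> 1 / sqrt (w n x) * total_norm f" if f: "f \<in> carrier" for f
  proof -
    note s = carrier_smooth[OF f]
    have i: "(\<lambda>y. w n x * (norm (dn n f y))\<^sup>2) integrable_on {0..1}"
      by (intro integrable_continuous_real continuous_intros continuous_on_dn s)
    have "w n x * (integral {0..1} (\<lambda>y. norm (dn n f y)))\<^sup>2 \<le>
        w n x * integral {0..1} (\<lambda>y. (norm (dn n f y))\<^sup>2)"
      using square_integral_le[of 0 1 "\<lambda>y. norm (dn n f y)"] weight_pos[OF x(1), of n]
      by (intro mult_left_mono) (auto intro: continuous_intros continuous_on_dn s)
    also have "\<dots> = integral {0..1} (\<lambda>y. w n x * (norm (dn n f y))\<^sup>2)" by simp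
    also have "\<dots> \<le> integral {0..1} (\<lambda>y. w n y * (norm (dn n f y))\<^sup>2)"
      using x(2) by (intro integral_le i integrable_weighted s mult_right_mono) auto
    also have "\<dots> \<le> energy f n" unfolding energy_def using boundary_weight_nonneg[of n] by simp
    also have "\<dots> \<le> (\<Sum>n<Suc n. energy f n)" using energy_nonneg[OF s] by (simp add: sum_nonneg)
    also have "\<dots> \<le> (total_norm f)\<^sup>2" by (rule sum_energy_le[OF f])
    finally have "(sqrt (w n x) * integral {0..1} (\<lambda>y. norm (dn n f y)))\<^sup>2 \<le> (total_norm f)\<^sup>2"
      using weight_pos[OF x(1), of n] by (simp add: power_mult_distrib)
    then have "sqrt (w n x) * integral {0..1} (\<lambda>y. norm (dn n f y)) \<le> total_norm f"
      using N_nonneg[OF f] by (rule power2_le_imp_le)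
    then show ?thesis using weight_pos[OF x(1), of n] by (simp add: field_simps)
  qed
  then show ?thesis using weight_pos[OF x(1), of n] by (intro exI[of _ "1 / sqrt (w n x)"]) auto
qed

lemma norm_dn_le_total_norm:
  "\<exists>C\<ge>0. \<forall>f\<in>carrier. \<forall>x\<in>{0..1}. norm (dn n f x) \<le> C * total_norm f"
proof -
  obtain C where "C \<ge> 0"
    and C: "\<And>f. f \<in> carrier \<Longrightarrow> integral {0..1} (\<lambda>x. norm (dn n f x)) \<le> C * total_norm f"
    using integral_norm_dn_le by blast
  obtain D where "D \<ge> 0"
    and D: "\<And>f. f \<in> carrier \<Longrightarrow> integral {0..1} (\<lambda>x. norm (dn (Suc n) f x)) \<le> D * total_norm f"
    using integral_norm_dn_le by blast
  have "norm (dn n f x) \<le> (C + D) * total_norm f" if f: "f \<in> carrier" and x: "x \<in> {0..1}" for f x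
  proof -
    note s = carrier_smooth[OF f]
    have "norm (dn n f x) \<le>
        integral {0..1} (\<lambda>t. norm (dn n f t)) + integral {0..1} (\<lambda>t. norm (dn (Suc n) f t))"
      using norm_le_integral_norm_add_derivative[OF dn_has_derivative[OF s] continuous_on_dn[OF s] x] by simp
    also have "\<dots> \<le> (C + D) * total_norm f"
      using C[OF f] D[OF f] by (simp add: distrib_right)
    finally show ?thesis .
  qed
  then show ?thesis using \<open>C \<ge> 0\<close> \<open>D \<ge> 0\<close> by (intro exI[of _ "C + D"]) auto
qed

lemma energy_diff_tendsto_zero:
  assumes F: "\<And>i. smooth01 (F i)" and f: "smooth01 f"
    and lim: "uniform_limit {0..1} (\<lambda>i. dn n (F i)) (dn n f) sequentially"
  shows "(\<lambda>i. energy (f - F i) n) \<longlonglongrightarrow> 0"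
proof (rule tendstoI)
  fix e :: real assume e: "e > 0"
  define r where "r = sqrt (e / (mass n + 1))"
  have r: "r > 0" "mass n * r\<^sup>2 < e"
    using e mass_nonneg[of n] by (auto simp: r_def field_simps)
  have "\<forall>\<^sub>F i in sequentially. \<forall>x\<in>{0..1}. dist (dn n (F i) x) (dn n f x) < r"
    using lim r(1) by (simp add: uniform_limit_iff)
  then show "\<forall>\<^sub>F i in sequentially. dist (energy (f - F i) n) 0 < e"
  proof eventually_elim
    case (elim i)
    then have "norm (dn n (f - F i) x) \<le> r" if "x \<in> {0..1}" for x
      using that by (auto simp: dn_diff f F dist_norm norm_minus_commute less_imp_le)
    then have "energy (f - F i) n \<le> energy 0 n + mass n * r\<^sup>2"
      by (intro energy_le_if_dominated smooth01_zero smooth01_diff f F max.coboundedI2)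
    then show ?case
      using r(2) energy_nonneg[OF smooth01_diff[OF f F], of i n] by (simp add: energy_zero)
  qed
qed

lemma
  assumes F: "\<And>i. F i \<in> carrier" and f: "smooth01 f"
    and lim: "\<And>n. uniform_limit {0..1} (\<lambda>i. dn n (F i)) (dn n f) sequentially"
    and bound: "\<And>i. total_norm (F i) \<le> B"
  shows carrier_uniform_limit: "f \<in> carrier" and total_norm_uniform_limit_le: "total_norm f \<le> B"
proof -
  note s = carrier_smooth[OF F]
  have B: "0 \<le> B" using order_trans[OF N_nonneg[OF F] bound] .
  have "t * (\<Sum>n<K. energy f n) \<le> B\<^sup>2" if t: "0 < t" "t < 1" for t K
  proof -
    have "(\<Sum>n<K. energy f n) \<le> B\<^sup>2 / t"
    proof (rule tendsto_lowerbound)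
      show "(\<lambda>i. B\<^sup>2 / t + (\<Sum>n<K. energy (f - F i) n) / (1 - t)) \<longlonglongrightarrow> B\<^sup>2 / t"
        using t by (auto intro!: tendsto_eq_intros energy_diff_tendsto_zero s f lim)
      have "(\<Sum>n<K. energy f n) \<le> B\<^sup>2 / t + (\<Sum>n<K. energy (f - F i) n) / (1 - t)" for i
      proof -
        have "(\<Sum>n<K. energy (F i + (f - F i)) n) \<le> (\<Sum>n<K. energy (F i) n / t + energy (f - F i) n / (1 - t))"
          by (intro sum_mono energy_add_le s smooth01_diff f t)
        also have "\<dots> = (\<Sum>n<K. energy (F i) n) / t + (\<Sum>n<K. energy (f - F i) n) / (1 - t)"
          by (simp add: sum.distrib sum_divide_distrib)
        also have "\<dots> \<le> B\<^sup>2 / t + (\<Sum>n<K. energy (f - F i) n) / (1 - t)"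
          using order_trans[OF sum_energy_le[OF F] power_mono[OF bound N_nonneg[OF F]]] t
          by (simp add: divide_right_mono)
        finally show ?thesis by simp
      qed
      then show "\<forall>\<^sub>F i in sequentially. (\<Sum>n<K. energy f n) \<le> B\<^sup>2 / t + (\<Sum>n<K. energy (f - F i) n) / (1 - t)"
        by simp
    qed simp
    then show ?thesis using t by (simp add: field_simps)
  qed
  then have "(\<Sum>n<K. energy f n) \<le> B\<^sup>2" for K by (rule field_le_mult_one_interval)
  then show "f \<in> carrier" "total_norm f \<le> B" using carrier_total_norm_leI[OF f B] by blast+
qed

lemma uniform_limit_dn_if_Cauchy:
  assumes F: "\<And>i. F i \<in> carrier"
    and Cauchy: "\<And>e. e > 0 \<Longrightarrow> \<exists>M. \<forall>m\<ge>M. \<forall>n\<ge>M. total_norm (F m - F n) < e"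
  obtains f where "smooth01 f" "\<And>n. uniform_limit {0..1} (\<lambda>i. dn n (F i)) (dn n f) sequentially"
proof -
  note s = carrier_smooth[OF F]
  have "uniformly_Cauchy_on {0..1} (\<lambda>i. dn n (F i))" for n
  proof (rule uniformly_Cauchy_onI)
    fix e :: real assume "e > 0"
    obtain C where C: "C \<ge> 0" "\<And>g x. g \<in> carrier \<Longrightarrow> x \<in> {0..1} \<Longrightarrow> norm (dn n g x) \<le> C * total_norm g"
      using norm_dn_le_total_norm[of n] by blast
    obtain M where M: "\<forall>i\<ge>M. \<forall>k\<ge>M. total_norm (F i - F k) < e / (C + 1)"
      using Cauchy[of "e / (C + 1)"] \<open>e > 0\<close> C(1) by auto
    have "dist (dn n (F i) x) (dn n (F k) x) < e" if "x \<in> {0..1}" "i \<ge> M" "k \<ge> M" for x i k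
    proof -
      have "dist (dn n (F i) x) (dn n (F k) x) \<le> C * total_norm (F i - F k)"
        using C(2)[OF diff_mem[OF F[of i] F[of k]] that(1)] that(1) by (simp add: dist_norm dn_diff s)
      also have "\<dots> \<le> C * (e / (C + 1))" using M that C(1) by (intro mult_left_mono) (auto intro: less_imp_le)
      also have "\<dots> < e" using C(1) \<open>e > 0\<close> by (simp add: field_simps)
      finally show ?thesis .
    qed
    then show "\<exists>M. \<forall>x\<in>{0..1}. \<forall>i\<ge>M. \<forall>k\<ge>M. dist (dn n (F i) x) (dn n (F k) x) < e" by blast
  qed
  then have "\<exists>g. uniform_limit {0..1} (\<lambda>i. dn n (F i)) g sequentially" for n
    by (simp add: Cauchy_uniformly_convergent flip: uniformly_convergent_on_def)
  then obtain G where G: "\<And>n. uniform_limit {0..1} (\<lambda>i. dn n (F i)) (G n) sequentially" by metis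
  have der: "(G n has_vector_derivative G (Suc n) x) (at x within {0..1})" if "x \<in> {0..1}" for n x
    by (rule has_vector_derivative_uniform_limit[OF convex_real_interval(5) that _ G])
      (use dn_has_derivative[OF s] tendsto_uniform_limitI[OF G] in auto)
  have smooth: "smooth01 (G 0)" and dn_G: "\<And>n x. x \<in> {0..1} \<Longrightarrow> dn n (G 0) x = G n x"
    by (rule dn_eqI[of "G 0" G]; use der in simp)+
  have "uniform_limit {0..1} (\<lambda>i. dn n (F i)) (dn n (G 0)) sequentially" for n
    using G[of n] dn_G by (subst uniform_limit_cong') auto
  then show thesis using that smooth by blast
qed

lemma
  assumes F: "\<And>i. F i \<in> carrier" and f: "smooth01 f"
    and lim: "\<And>n. uniform_limit {0..1} (\<lambda>i. dn n (F i)) (dn n f) sequentially"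
    and le: "\<forall>i\<ge>M. total_norm (F i - F m) \<le> e"
  shows uniform_limit_diff_carrier: "f - F m \<in> carrier"
    and total_norm_uniform_limit_diff_le: "total_norm (f - F m) \<le> e"
proof -
  note s = carrier_smooth[OF F]
  have lim': "uniform_limit {0..1} (\<lambda>i. dn n (F (i + M) - F m)) (dn n (f - F m)) sequentially" for n
  proof -
    have "uniform_limit {0..1} (\<lambda>i x. dn n (F (i + M)) x - dn n (F m) x)
        (\<lambda>x. dn n f x - dn n (F m) x) sequentially"
      by (intro uniform_limit_minus uniform_limit_const
          filterlim_compose[OF lim filterlim_add_const_nat_at_top])
    then show ?thesis by (subst uniform_limit_cong') (auto simp: dn_diff s f)
  qed
  have le': "total_norm (F (i + M) - F m) \<le> e" for i using le by simp
  show "f - F m \<in> carrier"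
    by (rule carrier_uniform_limit[OF diff_mem[OF F F] smooth01_diff[OF f s] lim' le'])
  show "total_norm (f - F m) \<le> e"
    by (rule total_norm_uniform_limit_le[OF diff_mem[OF F F] smooth01_diff[OF f s] lim' le'])
qed

sublocale complete_seminormed_space scale_fun carrier total_norm
proof
  fix F :: "nat \<Rightarrow> real \<Rightarrow> complex"
  assume F: "F i \<in> carrier" and Cauchy: "e > 0 \<Longrightarrow> \<exists>M. \<forall>m\<ge>M. \<forall>n\<ge>M. total_norm (F m - F n) < e" for i e
  obtain f where f: "smooth01 f" and lim: "\<And>n. uniform_limit {0..1} (\<lambda>i. dn n (F i)) (dn n f) sequentially"
    using uniform_limit_dn_if_Cauchy[OF F Cauchy] by blast
  obtain M where "\<forall>m\<ge>M. \<forall>n\<ge>M. total_norm (F m - F n) < 1" using Cauchy[of 1] by auto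
  then have "f - F M \<in> carrier"
    by (intro uniform_limit_diff_carrier[OF F f lim, of M M 1]) (simp add: less_imp_le)
  then have fC: "f \<in> carrier" using add_mem[OF _ F[of M], of "f - F M"] by simp
  have "(\<lambda>i. total_norm (F i - f)) \<longlonglongrightarrow> 0"
  proof (rule tendstoI)
    fix e :: real assume "e > 0"
    then obtain M where "\<forall>m\<ge>M. \<forall>n\<ge>M. total_norm (F m - F n) < e / 2" using Cauchy[of "e / 2"] by auto
    then have "total_norm (f - F m) \<le> e / 2" if "m \<ge> M" for m
      using that by (intro total_norm_uniform_limit_diff_le[OF F f lim, of M m]) (simp add: less_imp_le)
    then have "dist (total_norm (F m - f)) 0 < e" if "m \<ge> M" for m
      using that \<open>e > 0\<close> N_commute[OF F fC, of m] N_nonneg[OF diff_mem[OF F fC], of m] by fastforce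
    then show "\<forall>\<^sub>F i in sequentially. dist (total_norm (F i - f)) 0 < e"
      by (rule eventually_sequentiallyI)
  qed
  then show "\<exists>f\<in>carrier. (\<lambda>i. total_norm (F i - f)) \<longlonglongrightarrow> 0" using fC by blast
qed

end

section \<open>The Gevrey spaces\<close>

definition gevrey_coeff :: "real \<Rightarrow> nat \<Rightarrow> real" where
  "gevrey_coeff \<sigma> n = \<sigma> ^ (2*n) / ((fact n)\<^sup>2 * (fact (n+1))\<^sup>2)"

definition gevrey_weight :: "real \<Rightarrow> real \<Rightarrow> nat \<Rightarrow> real \<Rightarrow> real" where
  "gevrey_weight j \<sigma> n x = gevrey_coeff \<sigma> n * (1 + real n * (x / \<sigma>) + j * (real n)\<^sup>2 * (x / \<sigma>)\<^sup>2)"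

definition gevrey_majorant :: "real \<Rightarrow> nat \<Rightarrow> real" where
  "gevrey_majorant \<tau> n = (1 / \<tau>) ^ n * (fact n)\<^sup>2"

lemma gevrey_majorant_pos: "\<tau> > 0 \<Longrightarrow> gevrey_majorant \<tau> n > 0"
  by (simp add: gevrey_majorant_def)

lemma gevrey_majorant_Suc: "gevrey_majorant \<tau> (Suc n) = gevrey_majorant \<tau> n * ((real n + 1)\<^sup>2 / \<tau>)"
  by (simp add: gevrey_majorant_def power_mult_distrib mult_ac add.commute)

lemma gevrey_le_majorant:
  assumes "gevrey \<tau> 2 W" "\<tau> > 0"
  obtains C where "C > 0" "\<And>n x. x \<in> {0..1} \<Longrightarrow> norm (dn n W x) \<le> C * gevrey_majorant \<tau> n"
proof -
  from assms obtain C where smooth: "smooth01 W" and C: "C > 0"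
    "\<And>n x. x \<in> {0<..<1} \<Longrightarrow> norm (dn n W x) \<le> C * \<tau> powr (- real n) * (fact n) powr 2"
    unfolding gevrey_def by auto
  have "norm (dn n W x) \<le> C * gevrey_majorant \<tau> n" if "x \<in> {0..1}" for n x
  proof (rule continuous_on_closure_norm_le[where s="{0<..<1::real}"])
    show "\<forall>y\<in>{0<..<1}. norm (dn n W y) \<le> C * gevrey_majorant \<tau> n"
      using C(2)[of _ n] assms(2)
      by (auto simp: gevrey_majorant_def powr_minus powr_realpow power_one_over inverse_eq_divide)
  qed (use that continuous_on_dn[OF smooth] in auto)
  then show ?thesis using that C(1) by blast
qed

text \<open>The space \<open>Y\<close> is the case \<open>j = 0\<close>; derivatives of members of \<open>X\<close> form the case \<open>j = 1\<close>.\<close>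
locale gevrey_weighted_space =
  fixes j \<sigma> :: real
  assumes j_nonneg: "j \<ge> 0" and \<sigma>_pos: "\<sigma> > 0"
begin

lemma gevrey_coeff_pos: "gevrey_coeff \<sigma> n > 0"
  using \<sigma>_pos by (simp add: gevrey_coeff_def)

sublocale weighted_smooth_space "gevrey_weight j \<sigma>" "\<lambda>n. gevrey_coeff \<sigma> n * \<sigma>"
proof
  show "continuous_on {0..1} (gevrey_weight j \<sigma> n)" for n
    unfolding gevrey_weight_def using \<sigma>_pos by (intro continuous_intros) auto
  show "0 < gevrey_weight j \<sigma> n x" if "x \<in> {0..1}" for n x
    unfolding gevrey_weight_def using that gevrey_coeff_pos[of n] j_nonneg \<sigma>_pos
    by (intro mult_pos_pos add_pos_nonneg) auto
  show "0 \<le> gevrey_coeff \<sigma> n * \<sigma>" for n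
    using gevrey_coeff_pos[of n] \<sigma>_pos by simp
qed

lemma energy_eq:
  assumes "smooth01 f"
  shows "energy f n = wterm \<sigma> 0 f n + wterm \<sigma> 1 f n + j * wterm \<sigma> 2 f n + bterm \<sigma> f n"
proof -
  have i: "(\<lambda>x. c * ((x / \<sigma>)^k * (norm (dn n f x))\<^sup>2)) integrable_on {0..1}" for c k
    using assms \<sigma>_pos by (intro integrable_continuous_real continuous_intros continuous_on_dn) auto
  have "integral {0..1} (\<lambda>x. gevrey_weight j \<sigma> n x * (norm (dn n f x))\<^sup>2) =
    integral {0..1} (\<lambda>x. gevrey_coeff \<sigma> n * ((x / \<sigma>)^0 * (norm (dn n f x))\<^sup>2) +
      gevrey_coeff \<sigma> n * real n * ((x / \<sigma>)^1 * (norm (dn n f x))\<^sup>2) +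
      gevrey_coeff \<sigma> n * j * (real n)\<^sup>2 * ((x / \<sigma>)^2 * (norm (dn n f x))\<^sup>2))"
    by (intro integral_cong) (simp add: gevrey_weight_def algebra_simps)
  also have "\<dots> = wterm \<sigma> 0 f n + wterm \<sigma> 1 f n + j * wterm \<sigma> 2 f n"
    by (subst integral_add integral_mult_right, (intro i integrable_add)+)+
       (simp add: wterm_def gevrey_coeff_def)
  finally show ?thesis
    unfolding energy_def by (simp add: bterm_def gevrey_coeff_def)
qed

lemma mass_le: "mass n \<le> gevrey_coeff \<sigma> n * (1 + real n / \<sigma> + j * (real n)\<^sup>2 / \<sigma>\<^sup>2 + \<sigma>)"
proof -
  have "gevrey_weight j \<sigma> n x \<le> gevrey_coeff \<sigma> n * (1 + real n / \<sigma> + j * (real n)\<^sup>2 / \<sigma>\<^sup>2)"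
    if "x \<in> {0..1}" for x
  proof -
    have "real n * (x / \<sigma>) \<le> real n * (1 / \<sigma>)" "j * (real n)\<^sup>2 * (x / \<sigma>)\<^sup>2 \<le> j * (real n)\<^sup>2 * (1 / \<sigma>)\<^sup>2"
      using that \<sigma>_pos j_nonneg by (intro mult_left_mono power_mono divide_right_mono; simp)+
    then show ?thesis
      unfolding gevrey_weight_def using gevrey_coeff_pos[of n]
      by (intro mult_left_mono) (auto simp: power_divide)
  qed
  then have "integral {0..1} (gevrey_weight j \<sigma> n) \<le>
      integral {0..1} (\<lambda>x::real. gevrey_coeff \<sigma> n * (1 + real n / \<sigma> + j * (real n)\<^sup>2 / \<sigma>\<^sup>2))"
    by (intro integral_le integrable_continuous_real continuous_weight continuous_intros)
  then show ?thesis by (simp add: mass_def distrib_left)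
qed

lemma gevrey_coeff_mult_majorant:
  "gevrey_coeff \<sigma> n * (gevrey_majorant \<tau> n)\<^sup>2 = ((\<sigma> / \<tau>)\<^sup>2) ^ n / (real n + 1)\<^sup>2"
proof -
  define F m where "F = (fact n :: real)" and "m = real n + 1"
  have "F > 0" "m > 0" "(fact (n + 1) :: real) = m * F" by (simp_all add: F_def m_def add.commute)
  then have "gevrey_coeff \<sigma> n * (gevrey_majorant \<tau> n)\<^sup>2 = \<sigma> ^ (2*n) * ((1 / \<tau>) ^ n)\<^sup>2 / m\<^sup>2"
    by (simp add: gevrey_coeff_def gevrey_majorant_def flip: F_def)
      (simp add: power_mult_distrib power2_eq_square)
  also have "\<sigma> ^ (2*n) * ((1 / \<tau>) ^ n)\<^sup>2 = ((\<sigma> / \<tau>)\<^sup>2) ^ n"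
    by (simp add: power_divide power_mult power_mult[of \<tau> n 2, symmetric] mult.commute[of n 2])
  finally show ?thesis by (simp add: m_def)
qed

lemma gevrey_coeff_mult_majorant_Suc:
  "gevrey_coeff \<sigma> n * (gevrey_majorant \<tau> (Suc n))\<^sup>2 = ((\<sigma> / \<tau>)\<^sup>2) ^ n * (real n + 1)\<^sup>2 / \<tau>\<^sup>2"
proof -
  have "gevrey_coeff \<sigma> n * (gevrey_majorant \<tau> (Suc n))\<^sup>2 =
      gevrey_coeff \<sigma> n * (gevrey_majorant \<tau> n)\<^sup>2 * ((real n + 1)\<^sup>2 / \<tau>)\<^sup>2"
    by (simp only: gevrey_majorant_Suc power_mult_distrib mult.assoc)
  also have "\<dots> = ((\<sigma> / \<tau>)\<^sup>2) ^ n * (real n + 1)\<^sup>2 / \<tau>\<^sup>2"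
    by (simp add: gevrey_coeff_mult_majorant power_divide)
      (simp add: power2_eq_square power4_eq_xxxx)
  finally show ?thesis .
qed

lemma summable_mass_mult_majorant:
  assumes "\<sigma> < \<tau>"
  shows "summable (\<lambda>n. mass n * (A * gevrey_majorant \<tau> (Suc n))\<^sup>2)"
proof -
  define q where "q = (\<sigma> / \<tau>)\<^sup>2"
  define r where "r = (q + 1) / 2"
  have q: "0 < q" "q < r" "r < 1" unfolding q_def r_def using \<sigma>_pos assms by (auto simp: power_less_one_iff)
  let ?p = "\<lambda>n. 1 + real n / \<sigma> + j * (real n)\<^sup>2 / \<sigma>\<^sup>2 + \<sigma>"
  have "summable (\<lambda>n. q ^ n * (?p n * (real n + 1)\<^sup>2))"
  proof (rule summable_comparison_test_bigo)
    show "summable (\<lambda>n. norm (r ^ n))" using q by (simp add: summable_geometric)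
    show "(\<lambda>n. q ^ n * (?p n * (real n + 1)\<^sup>2)) \<in> O(\<lambda>n. r ^ n)" using q \<sigma>_pos by real_asymp
  qed
  then have "summable (\<lambda>n. (A / \<tau>)\<^sup>2 * (q ^ n * (?p n * (real n + 1)\<^sup>2)))" by (rule summable_mult)
  moreover have "norm (mass n * (A * gevrey_majorant \<tau> (Suc n))\<^sup>2) \<le>
      (A / \<tau>)\<^sup>2 * (q ^ n * (?p n * (real n + 1)\<^sup>2))" for n
  proof -
    have "mass n * (A * gevrey_majorant \<tau> (Suc n))\<^sup>2 \<le>
        gevrey_coeff \<sigma> n * ?p n * (A * gevrey_majorant \<tau> (Suc n))\<^sup>2"
      by (intro mult_right_mono mass_le) simp
    also have "\<dots> = A\<^sup>2 * ?p n * (gevrey_coeff \<sigma> n * (gevrey_majorant \<tau> (Suc n))\<^sup>2)"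
      by (simp add: power_mult_distrib)
    also have "\<dots> = (A / \<tau>)\<^sup>2 * (q ^ n * (?p n * (real n + 1)\<^sup>2))"
      unfolding gevrey_coeff_mult_majorant_Suc q_def[symmetric] power_divide[of A]
      by (simp only: times_divide_eq_right times_divide_eq_left mult_ac)
    finally show ?thesis by (simp add: mass_nonneg)
  qed
  ultimately show ?thesis by (rule summable_comparison_test')
qed

lemma carrier_if_majorant_dominated:
  assumes u: "u \<in> carrier" and v: "smooth01 v" and "\<sigma> < \<tau>"
    and le: "\<And>n x. x \<in> {0..1} \<Longrightarrow>
      norm (dn n v x) \<le> max (norm (dn n u x)) (A * gevrey_majorant \<tau> (Suc n))"
  shows "v \<in> carrier"
  using carrier_if_dominated[OF u v le summable_mass_mult_majorant[OF \<open>\<sigma> < \<tau>\<close>]] .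

lemma gevrey_imp_carrier:
  assumes W: "gevrey \<tau> 2 W" and "\<sigma> < \<tau>"
  shows "W \<in> carrier"
proof -
  have \<tau>: "\<tau> > 0" using \<sigma>_pos assms by simp
  obtain C where C: "C > 0" "\<And>n x. x \<in> {0..1} \<Longrightarrow> norm (dn n W x) \<le> C * gevrey_majorant \<tau> n"
    using gevrey_le_majorant[OF W \<tau>] by blast
  have "norm (dn n W x) \<le> (C * \<tau>) * gevrey_majorant \<tau> (Suc n)" if "x \<in> {0..1}" for n x
  proof -
    have "C * gevrey_majorant \<tau> n * 1 \<le> C * gevrey_majorant \<tau> n * (real n + 1)\<^sup>2"
      using C(1) less_imp_le[OF gevrey_majorant_pos[OF \<tau>, of n]] by (intro mult_left_mono) auto
    then show ?thesis using C(2)[OF that, of n] \<tau> by (simp add: gevrey_majorant_Suc)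
  qed
  then show ?thesis
    using W by (intro carrier_if_majorant_dominated[OF zero_in_carrier _ \<open>\<sigma> < \<tau>\<close>] max.coboundedI2)
      (auto simp: gevrey_def)
qed

end

lemma wterm_nonneg:
  assumes "smooth01 f" "\<sigma> > 0"
  shows "wterm \<sigma> k f n \<ge> 0"
proof -
  have "integral {0..1} (\<lambda>x. (x / \<sigma>) ^ k * (norm (dn n f x))\<^sup>2) \<ge> 0"
    using assms by (intro integral_nonneg integrable_continuous_real continuous_intros continuous_on_dn) auto
  then show ?thesis using assms by (simp add: wterm_def)
qed

lemma bterm_nonneg: "\<sigma> > 0 \<Longrightarrow> bterm \<sigma> f n \<ge> 0"
  by (simp add: bterm_def)

lemma summable_add_nonneg_iff:
  fixes a b :: "nat \<Rightarrow> real"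
  assumes "\<And>n. a n \<ge> 0" "\<And>n. b n \<ge> 0"
  shows "summable (\<lambda>n. a n + b n) \<longleftrightarrow> summable a \<and> summable b"
  using assms by (auto intro: summable_add summable_comparison_test'[of "\<lambda>n. a n + b n"])

locale gevrey_spaces =
  fixes \<sigma> :: real
  assumes \<sigma>_pos: "\<sigma> > 0"
begin

sublocale Y: gevrey_weighted_space 0 \<sigma>
  by standard (use \<sigma>_pos in auto)

sublocale V: gevrey_weighted_space 1 \<sigma>
  by standard (use \<sigma>_pos in auto)

lemma Ysp_eq: "Ysp \<sigma> = Y.carrier"
proof -
  have "Y.energy f = (\<lambda>n. wterm \<sigma> 0 f n + wterm \<sigma> 1 f n + bterm \<sigma> f n)" if "smooth01 f" for f
    using Y.energy_eq[OF that] by auto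
  then show ?thesis
    unfolding Ysp_def Y.carrier_def
    using \<sigma>_pos by (auto simp: summable_add_nonneg_iff wterm_nonneg bterm_nonneg)
qed

lemma Xsp_iff: "u \<in> Xsp \<sigma> \<longleftrightarrow> smooth01 u \<and> u 1 = 0 \<and> dn 1 u \<in> V.carrier"
proof -
  have "V.energy f = (\<lambda>n. wterm \<sigma> 0 f n + wterm \<sigma> 1 f n + wterm \<sigma> 2 f n + bterm \<sigma> f n)" if "smooth01 f" for f
    using V.energy_eq[OF that] by auto
  then show ?thesis
    unfolding Xsp_def V.carrier_def using \<sigma>_pos smooth01_dn[of u 1]
    by (auto simp: summable_add_nonneg_iff wterm_nonneg bterm_nonneg)
qed

lemma
  assumes f: "f \<in> V.carrier"
  shows V_carrier_subset_Y: "f \<in> Y.carrier" and Y_norm_le_V_norm: "Y.total_norm f \<le> V.total_norm f"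
proof -
  have s: "smooth01 f" and sum: "summable (V.energy f)" using f by (auto simp: V.carrier_def)
  have le: "Y.energy f n \<le> V.energy f n" for n
    using wterm_nonneg[OF s \<sigma>_pos, of 2 n] by (simp add: Y.energy_eq[OF s] V.energy_eq[OF s])
  then have sum': "summable (Y.energy f)"
    using Y.energy_nonneg[OF s] by (intro summable_comparison_test'[OF sum]) simp
  then show "f \<in> Y.carrier" using s by (simp add: Y.carrier_def)
  show "Y.total_norm f \<le> V.total_norm f"
    unfolding Y.total_norm_def V.total_norm_def by (intro real_sqrt_le_mono suminf_le le sum sum')
qed

definition X_norm :: "(real \<Rightarrow> complex) \<Rightarrow> real" where
  "X_norm u = V.total_norm (dn 1 u)"

lemma Xsp_smooth: "u \<in> Xsp \<sigma> \<Longrightarrow> smooth01 u"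
  by (simp add: Xsp_def)

lemma Xsp_dn1: "u \<in> Xsp \<sigma> \<Longrightarrow> dn 1 u \<in> V.carrier"
  by (simp add: Xsp_iff)

lemma
  assumes u: "smooth01 u" "u 1 = 0" and d: "d \<in> V.carrier" "\<And>x. x \<in> {0..1} \<Longrightarrow> dn 1 u x = d x"
  shows XspI: "u \<in> Xsp \<sigma>" and X_norm_eqI: "X_norm u = V.total_norm d"
  using u V.carrier_cong[OF d(1), of "dn 1 u"] V.total_norm_cong[OF d(1), of "dn 1 u"] d(2)
  by (auto simp: Xsp_iff X_norm_def)

sublocale X: seminormed_space scale_fun "Xsp \<sigma>" X_norm
proof
  have add: "u + v \<in> Xsp \<sigma> \<and> X_norm (u + v) = V.total_norm (dn 1 u + dn 1 v)"
    if u: "u \<in> Xsp \<sigma>" and v: "v \<in> Xsp \<sigma>" for u v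
    using XspI[of "u + v" "dn 1 u + dn 1 v"] X_norm_eqI[of "u + v" "dn 1 u + dn 1 v"]
      V.add_mem[OF Xsp_dn1[OF u] Xsp_dn1[OF v]] u v Xsp_iff
    by (simp add: smooth01_add dn_add)
  have scale: "scale_fun c u \<in> Xsp \<sigma> \<and> X_norm (scale_fun c u) = V.total_norm (scale_fun c (dn 1 u))"
    if u: "u \<in> Xsp \<sigma>" for c u
    using XspI[of "scale_fun c u" "scale_fun c (dn 1 u)"] X_norm_eqI[of "scale_fun c u" "scale_fun c (dn 1 u)"]
      V.scale_mem[OF Xsp_dn1[OF u]] u Xsp_iff
    by (simp add: smooth01_scale dn_scale)
  have "0 \<in> Xsp \<sigma>"
    by (intro XspI[OF smooth01_zero _ V.zero_in_carrier]) (simp_all add: dn_eq_zero)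
  then show "scale_fun.subspace (Xsp \<sigma>)"
    using add scale by (intro scale_fun.subspaceI) auto
  show "X_norm (u + v) \<le> X_norm u + X_norm v" if "u \<in> Xsp \<sigma>" "v \<in> Xsp \<sigma>" for u v
    using add[OF that] V.N_add_le[OF that[THEN Xsp_dn1]] by (simp add: X_norm_def)
  show "X_norm (scale_fun c u) = norm c * X_norm u" if "u \<in> Xsp \<sigma>" for c u
    using scale[OF that] V.N_scale[OF Xsp_dn1[OF that]] by (simp add: X_norm_def)
qed

lemma X_norm_diff:
  assumes u: "u \<in> Xsp \<sigma>" and v: "v \<in> Xsp \<sigma>"
  shows "X_norm (u - v) = V.total_norm (dn 1 u - dn 1 v)"
  using u v X.diff_mem[OF u v] V.diff_mem[OF Xsp_dn1[OF u] Xsp_dn1[OF v]]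
  by (intro X_norm_eqI) (auto simp: Xsp_iff dn_diff)

lemma smooth01_antiderivative:
  assumes v: "smooth01 v"
  obtains u where "smooth01 u" "u 1 = 0" "\<And>x. x \<in> {0..1} \<Longrightarrow> dn 1 u x = v x"
proof -
  define u where "u x = integral {0..x} v - integral {0..1} v" for x
  define g where "g n = (case n of 0 \<Rightarrow> u | Suc k \<Rightarrow> dn k v)" for n
  have der: "(g n has_vector_derivative g (Suc n) x) (at x within {0..1})" if x: "x \<in> {0..1}" for n x
  proof (cases n)
    case 0
    have "(u has_vector_derivative v x - 0) (at x within {0..1})"
      unfolding u_def using x v
      by (intro has_vector_derivative_diff integral_has_vector_derivative smooth01_continuous_on) auto
    then show ?thesis using 0 by (simp add: g_def)
  next
    case (Suc k) then show ?thesis using dn_has_derivative[OF v x] by (simp add: g_def)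
  qed
  have "smooth01 u" and "\<And>x n. x \<in> {0..1} \<Longrightarrow> dn n u x = g n x"
    by (rule dn_eqI[where g=g]; use der in \<open>simp add: g_def\<close>)+
  then show thesis using that[of u] by (simp add: g_def u_def)
qed

sublocale X: complete_seminormed_space scale_fun "Xsp \<sigma>" X_norm
proof
  fix U :: "nat \<Rightarrow> real \<Rightarrow> complex"
  assume U: "U i \<in> Xsp \<sigma>" and Cauchy: "e > 0 \<Longrightarrow> \<exists>M. \<forall>m\<ge>M. \<forall>n\<ge>M. X_norm (U m - U n) < e" for i e
  obtain v where v: "v \<in> V.carrier" "(\<lambda>i. V.total_norm (dn 1 (U i) - v)) \<longlonglongrightarrow> 0"
    using V.complete[of "\<lambda>i. dn 1 (U i)"] Xsp_dn1[OF U] Cauchy X_norm_diff[OF U U] by auto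
  obtain u where u: "smooth01 u" "u 1 = 0" "\<And>x. x \<in> {0..1} \<Longrightarrow> dn 1 u x = v x"
    using smooth01_antiderivative[OF V.carrier_smooth[OF v(1)]] by blast
  have uX: "u \<in> Xsp \<sigma>" using XspI[OF u(1,2) v(1) u(3)] .
  have "X_norm (U i - u) = V.total_norm (dn 1 (U i) - v)" for i
    using u V.diff_mem[OF Xsp_dn1[OF U[of i]] v(1)] X.diff_mem[OF U[of i] uX] Xsp_smooth[OF U]
    by (intro X_norm_eqI) (auto simp: Xsp_iff dn_diff)
  then show "\<exists>u\<in>Xsp \<sigma>. (\<lambda>i. X_norm (U i - u)) \<longlonglongrightarrow> 0"
    using v(2) uX by (intro bexI[of _ u]) simp_all
qed

lemma norm_dn_le_X_norm: "\<exists>C\<ge>0. \<forall>u\<in>Xsp \<sigma>. \<forall>x\<in>{0..1}. norm (dn k u x) \<le> C * X_norm u"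
proof -
  obtain C where C: "C \<ge> 0"
    "\<And>v x. v \<in> V.carrier \<Longrightarrow> x \<in> {0..1} \<Longrightarrow> norm (dn (k - 1) v x) \<le> C * V.total_norm v"
    using V.norm_dn_le_total_norm by blast
  have "norm (dn k u x) \<le> C * X_norm u" if u: "u \<in> Xsp \<sigma>" and x: "x \<in> {0..1}" for u x
  proof -
    note s = Xsp_smooth[OF u]
    have dn_Suc_le: "norm (dn (Suc (k - 1)) u t) \<le> C * X_norm u" if "t \<in> {0..1}" for t
      using C(2)[OF Xsp_dn1[OF u] that] by (simp add: dn_dn X_norm_def)
    show ?thesis
    proof (cases k)
      case 0
      have "norm (u x - u 1) \<le> integral {0..1} (\<lambda>t. norm (dn 1 u t))"
        using norm_diff_le_integral_norm_derivative[of 0 1 u "dn 1 u" x 1] x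
          dn_has_derivative[OF s, of _ 0] continuous_on_dn[OF s, of 1] by simp
      also have "\<dots> \<le> integral {0..1} (\<lambda>t::real. C * X_norm u)"
        using dn_Suc_le 0 continuous_on_dn[OF s, of 1]
        by (intro integral_le integrable_continuous_real continuous_intros) auto
      finally show ?thesis using 0 u by (simp add: Xsp_def)
    qed (use dn_Suc_le x in auto)
  qed
  then show ?thesis using C(1) by blast
qed

end

section \<open>Openness of invertibility\<close>

lemma LinvertibleD_unique:
  "\<lbrakk>Linvertible W \<sigma> s; u \<in> Dom W \<sigma> s; v \<in> Dom W \<sigma> s; \<And>x. x \<in> {0..1} \<Longrightarrow> Lop W s u x = Lop W s v x; x \<in> {0..1}\<rbrakk>
    \<Longrightarrow> u x = v x"
  unfolding Linvertible_def by metis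

lemma LinvertibleD_solvable:
  "\<lbrakk>Linvertible W \<sigma> s; f \<in> Ysp \<sigma>\<rbrakk> \<Longrightarrow> \<exists>u\<in>Dom W \<sigma> s. \<forall>x\<in>{0..1}. Lop W s u x = f x"
  by (simp add: Linvertible_def)

context gevrey_spaces
begin

definition Lgraph ::
    "(real \<Rightarrow> complex) \<Rightarrow> complex \<Rightarrow> (real \<Rightarrow> complex) \<Rightarrow> (real \<Rightarrow> complex) \<Rightarrow> bool" where
  "Lgraph W s u f \<longleftrightarrow> u \<in> Xsp \<sigma> \<and> f \<in> Y.carrier \<and> (\<forall>x\<in>{0..1}. Lop W s u x = f x)"

lemma LgraphD:
  assumes "Lgraph W s u f"
  shows "u \<in> Xsp \<sigma>" "f \<in> Y.carrier" "\<And>x. x \<in> {0..1} \<Longrightarrow> Lop W s u x = f x"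
    "smooth01 u" "continuous_on {0..1} f"
  using assms Xsp_smooth Y.carrier_smooth smooth01_continuous_on by (auto simp: Lgraph_def)

lemma Lgraph_classical_solution: "Lgraph W s u f \<Longrightarrow> classical_solution W s f u (dn 1 u) (dn 2 u)"
  by (rule classical_solution_dnI[OF LgraphD(4) LgraphD(3)])

lemma Dom_iff_Lgraph: "u \<in> Dom W \<sigma> s \<longleftrightarrow> Lgraph W s u (Lop W s u)"
  by (simp add: Dom_def Lgraph_def Ysp_eq)

lemma Lgraph_imp_Dom: "Lgraph W s u f \<Longrightarrow> u \<in> Dom W \<sigma> s"
  using Y.carrier_cong[of f "Lop W s u"] LgraphD[of W s u f] by (simp add: Dom_def Ysp_eq)

lemma Dom_imp_Lgraph:
  "\<lbrakk>u \<in> Dom W \<sigma> s; f \<in> Y.carrier; \<And>x. x \<in> {0..1} \<Longrightarrow> Lop W s u x = f x\<rbrakk> \<Longrightarrow> Lgraph W s u f"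
  by (simp add: Lgraph_def Dom_def)

lemma Lop_tendsto:
  assumes U: "\<And>i::nat. U i \<in> Xsp \<sigma>" and u: "u \<in> Xsp \<sigma>"
    and lim: "(\<lambda>i. X_norm (U i - u)) \<longlonglongrightarrow> 0" and x: "x \<in> {0..1}"
  shows "(\<lambda>i. Lop W s (U i) x) \<longlonglongrightarrow> Lop W s u x"
proof -
  have dn_lim: "(\<lambda>i. dn k (U i - u) x) \<longlonglongrightarrow> 0" for k
  proof -
    obtain C where "\<And>v x. v \<in> Xsp \<sigma> \<Longrightarrow> x \<in> {0..1} \<Longrightarrow> norm (dn k v x) \<le> C * X_norm v"
      using norm_dn_le_X_norm by blast
    then have "norm (dn k (U i - u) x) \<le> C * X_norm (U i - u)" for i
      using X.diff_mem[OF U u] x by blast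
    then show ?thesis
      by (intro Lim_null_comparison[OF always_eventually tendsto_mult_right_zero[OF lim]]) auto
  qed
  have "(\<lambda>i. Lop W s (U i - u) x) \<longlonglongrightarrow> of_real (x\<^sup>2) * 0 + (of_real (2 * x) + s) * 0 - W x * 0"
    using dn_lim[of 0] dn_lim[of 1] dn_lim[of 2]
    unfolding Lop_eq[OF Xsp_smooth[OF X.diff_mem[OF U u]] x] by (intro tendsto_intros) simp_all
  then have "(\<lambda>i. Lop W s (U i) x - Lop W s u x) \<longlonglongrightarrow> 0"
    using Lop_diff[OF Xsp_smooth[OF U] Xsp_smooth[OF u] x] by simp
  then show ?thesis by (rule LIM_zero_cancel)
qed

lemma Y_norm_tendsto_imp_tendsto:
  assumes F: "\<And>i::nat. F i \<in> Y.carrier" and f: "f \<in> Y.carrier"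
    and lim: "(\<lambda>i. Y.total_norm (F i - f)) \<longlonglongrightarrow> 0" and x: "x \<in> {0..1}"
  shows "(\<lambda>i. F i x) \<longlonglongrightarrow> f x"
proof -
  obtain C where "\<And>g x. g \<in> Y.carrier \<Longrightarrow> x \<in> {0..1} \<Longrightarrow> norm (dn 0 g x) \<le> C * Y.total_norm g"
    using Y.norm_dn_le_total_norm by blast
  then have "norm (F i x - f x) \<le> C * Y.total_norm (F i - f)" for i
    using Y.diff_mem[OF F f, of i] x by fastforce
  then have "(\<lambda>i. F i x - f x) \<longlonglongrightarrow> 0"
    by (intro Lim_null_comparison[OF always_eventually tendsto_mult_right_zero[OF lim]]) auto
  then show ?thesis by (rule LIM_zero_cancel)
qed

sublocale L: closed_linear_relation
  scale_fun "Xsp \<sigma>" X_norm scale_fun Y.carrier Y.total_norm "Lgraph W s" for W s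
proof
  show "u \<in> Xsp \<sigma> \<and> f \<in> Y.carrier" if "Lgraph W s u f" for u f
    using that by (simp add: Lgraph_def)
  show "Lgraph W s 0 0"
    using Lop_scale[OF smooth01_one, of _ W s 0] by (auto simp: Lgraph_def X.zero_mem Y.zero_mem)
  show "Lgraph W s (u + v) (f + g)" if "Lgraph W s u f" "Lgraph W s v g" for u v f g
    using LgraphD[OF that(1)] LgraphD[OF that(2)] by (simp add: Lgraph_def X.add_mem Y.add_mem Lop_add)
  show "Lgraph W s (scale_fun c u) (scale_fun c f)" if "Lgraph W s u f" for c u f
    using LgraphD[OF that] by (simp add: Lgraph_def X.scale_mem Y.scale_mem Lop_scale)
  show "Lgraph W s u f"
    if G: "\<And>i::nat. Lgraph W s (U i) (F i)" and u: "u \<in> Xsp \<sigma>" and f: "f \<in> Y.carrier"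
      and U: "(\<lambda>i. X_norm (U i - u)) \<longlonglongrightarrow> 0" and F: "(\<lambda>i. Y.total_norm (F i - f)) \<longlonglongrightarrow> 0" for U F u f
  proof -
    have "Lop W s u x = f x" if x: "x \<in> {0..1}" for x
      using LIMSEQ_unique[OF Lop_tendsto[OF LgraphD(1)[OF G] u U x, of W s]]
        Y_norm_tendsto_imp_tendsto[OF LgraphD(2)[OF G] f F x] LgraphD(3)[OF G x] by simp
    then show ?thesis using u f by (simp add: Lgraph_def)
  qed
qed

lemma X_norm_eq_zero_iff:
  assumes u: "u \<in> Xsp \<sigma>"
  shows "X_norm u = 0 \<longleftrightarrow> (\<forall>x\<in>{0..1}. u x = 0)"
proof
  assume "X_norm u = 0"
  then show "\<forall>x\<in>{0..1}. u x = 0" using norm_dn_le_X_norm[of 0] u by auto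
next
  assume zero: "\<forall>x\<in>{0..1}. u x = 0"
  have dn1: "dn 1 u x = 0 x" if "x \<in> {0..1}" for x using zero dn_eq_zero[of u x 1] that by simp
  have "u 1 = 0" using u by (simp add: Xsp_iff)
  then have "X_norm u = V.total_norm 0" by (rule X_norm_eqI[OF Xsp_smooth[OF u] _ V.zero_mem dn1])
  then show "X_norm u = 0" by (simp only: V.N_zero)
qed

lemma Linvertible_iff:
  "Linvertible W \<sigma> s \<longleftrightarrow> L.surjective W s \<and> (\<forall>u. Lgraph W s u 0 \<longrightarrow> X_norm u = 0)"
proof
  assume inv: "Linvertible W \<sigma> s"
  have "L.surjective W s"
    unfolding L.surjective_def
  proof
    fix f assume f: "f \<in> Y.carrier"
    then obtain u where "u \<in> Dom W \<sigma> s" "\<forall>x\<in>{0..1}. Lop W s u x = f x"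
      using LinvertibleD_solvable[OF inv, of f] by (auto simp: Ysp_eq)
    then show "\<exists>u. Lgraph W s u f" using Dom_imp_Lgraph[OF _ f] by blast
  qed
  moreover have "X_norm u = 0" if u: "Lgraph W s u 0" for u
  proof -
    have "u x = 0 x" if "x \<in> {0..1}" for x
      using LgraphD(3)[OF u] LgraphD(3)[OF L.graph_zero]
      by (intro LinvertibleD_unique[OF inv Lgraph_imp_Dom[OF u] Lgraph_imp_Dom[OF L.graph_zero] _ that]) simp
    then show ?thesis using X_norm_eq_zero_iff[OF LgraphD(1)[OF u]] by simp
  qed
  ultimately show "L.surjective W s \<and> (\<forall>u. Lgraph W s u 0 \<longrightarrow> X_norm u = 0)"
    by blast
next
  assume "L.surjective W s \<and> (\<forall>u. Lgraph W s u 0 \<longrightarrow> X_norm u = 0)"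
  then have surj: "L.surjective W s" and inj: "\<And>u. Lgraph W s u 0 \<Longrightarrow> X_norm u = 0" by auto
  have "u x = v x" if u: "u \<in> Dom W \<sigma> s" and v: "v \<in> Dom W \<sigma> s"
    and eq: "\<forall>x\<in>{0..1}. Lop W s u x = Lop W s v x" and x: "x \<in> {0..1}" for u v x
  proof -
    have v': "Lgraph W s v (Lop W s v)" using v by (simp add: Dom_iff_Lgraph)
    have "Lgraph W s u (Lop W s v)" using eq by (intro Dom_imp_Lgraph u LgraphD(2)[OF v']) simp
    from L.graph_diff[OF this v'] have G: "Lgraph W s (u - v) 0" by simp
    then have "X_norm (u - v) = 0" by (rule inj)
    then show ?thesis using X_norm_eq_zero_iff[OF LgraphD(1)[OF G]] x by simp
  qed
  moreover have "\<exists>u\<in>Dom W \<sigma> s. \<forall>x\<in>{0..1}. Lop W s u x = f x" if f: "f \<in> Ysp \<sigma>" for f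
  proof -
    obtain u where u: "Lgraph W s u f" using surj f unfolding L.surjective_def Ysp_eq by blast
    then show ?thesis using Lgraph_imp_Dom[OF u] LgraphD(3)[OF u] by blast
  qed
  ultimately show "Linvertible W \<sigma> s" by (simp add: Linvertible_def)
qed

lemma scale_dn1_in_Y: "u \<in> Xsp \<sigma> \<Longrightarrow> scale_fun c (dn 1 u) \<in> Y.carrier"
  by (intro Y.scale_mem V_carrier_subset_Y Xsp_dn1)

lemma Lgraph_shift:
  assumes "f \<in> Y.carrier"
  shows "Lgraph W s u (f + scale_fun (s - t) (dn 1 u)) \<longleftrightarrow> Lgraph W t u f"
proof -
  have "scale_fun (s - t) (dn 1 u) \<in> Y.carrier" if "u \<in> Xsp \<sigma>"
    by (rule scale_dn1_in_Y[OF that])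
  moreover have "Lop W s u x = f x + (s - t) * dn 1 u x \<longleftrightarrow> Lop W t u x = f x" if "u \<in> Xsp \<sigma>" "x \<in> {0..1}" for x
    using Lop_shift[OF Xsp_smooth[OF that(1)] that(2), of W s t] by simp
  ultimately show ?thesis using assms by (auto simp: Lgraph_def Y.add_mem)
qed

lemma Y_norm_scale_dn1_le:
  assumes "u \<in> Xsp \<sigma>"
  shows "Y.total_norm (scale_fun c (dn 1 u)) \<le> norm c * X_norm u"
  using Y_norm_le_V_norm[OF Xsp_dn1[OF assms]]
  by (simp add: Y.N_scale[OF V_carrier_subset_Y[OF Xsp_dn1[OF assms]]] X_norm_def mult_left_mono
      del: One_nat_def)

lemma Y_norm_scale_dn1_diff_le:
  assumes u: "u \<in> Xsp \<sigma>" and v: "v \<in> Xsp \<sigma>"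
  shows "Y.total_norm (scale_fun c (dn 1 u) - scale_fun c (dn 1 v)) \<le> norm c * X_norm (u - v)"
proof -
  have "Y.total_norm (scale_fun c (dn 1 u) - scale_fun c (dn 1 v)) =
      Y.total_norm (scale_fun c (dn 1 (u - v)))"
    using X.diff_mem[OF u v] Xsp_smooth[OF u] Xsp_smooth[OF v]
    by (intro Y.total_norm_cong scale_dn1_in_Y) (simp_all add: dn_diff algebra_simps)
  also have "\<dots> \<le> norm c * X_norm (u - v)" by (rule Y_norm_scale_dn1_le[OF X.diff_mem[OF u v]])
  finally show ?thesis .
qed

lemma
  assumes inv: "Linvertible W \<sigma> s" and K: "K \<ge> 0" "K * norm (s - t) < 1"
    and bound: "\<And>u f. Lgraph W s u f \<Longrightarrow> X_norm u \<le> K * Y.total_norm f"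
  shows Linvertible_perturb: "Linvertible W \<sigma> t"
    and Lgraph_perturb_bound: "Lgraph W t u f \<Longrightarrow> X_norm u \<le> K / (1 - K * norm (s - t)) * Y.total_norm f"
proof -
  let ?B = "\<lambda>u. scale_fun (s - t) (dn 1 u)"
  show bound': "X_norm u \<le> K / (1 - K * norm (s - t)) * Y.total_norm f" if u: "Lgraph W t u f" for u f
  proof (rule L.perturbed_bound[OF bound K LgraphD(2)[OF u]])
    show "?B u \<in> Y.carrier" by (rule scale_dn1_in_Y[OF LgraphD(1)[OF u]])
    show "Y.total_norm (?B u) \<le> norm (s - t) * X_norm u"
      by (rule Y_norm_scale_dn1_le[OF LgraphD(1)[OF u]])
    show "Lgraph W s u (f + ?B u)" using u Lgraph_shift[OF LgraphD(2)[OF u]] by blast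
  qed
  have surj: "L.surjective W s" using inv by (simp add: Linvertible_iff)
  have "\<exists>u. Lgraph W t u f" if f: "f \<in> Y.carrier" for f
    using L.perturbed_solvable[of W s K "norm (s - t)" ?B, OF surj bound K norm_ge_zero
        scale_dn1_in_Y Y_norm_scale_dn1_diff_le f]
    unfolding Lgraph_shift[OF f] .
  moreover have "X_norm u = 0" if u: "Lgraph W t u 0" for u
    using bound'[OF u] X.N_nonneg[OF LgraphD(1)[OF u]] by (simp add: Y.N_zero)
  ultimately show "Linvertible W \<sigma> t" by (simp add: Linvertible_iff L.surjective_def)
qed

theorem Linvertible_locally_uniform:
  assumes inv: "Linvertible W \<sigma> s\<^sub>0"
  shows "\<exists>r>0. \<exists>K\<ge>0. \<forall>s\<in>ball s\<^sub>0 r. Linvertible W \<sigma> s \<and>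
    (\<forall>u f. Lgraph W s u f \<longrightarrow> X_norm u \<le> K * Y.total_norm f)"
proof -
  obtain K where K: "K \<ge> 0" "\<And>u f. Lgraph W s\<^sub>0 u f \<Longrightarrow> X_norm u \<le> K * Y.total_norm f"
    using L.bounded_inverse[of W s\<^sub>0] inv unfolding Linvertible_iff by blast
  have "Linvertible W \<sigma> s \<and> (\<forall>u f. Lgraph W s u f \<longrightarrow> X_norm u \<le> 2 * K * Y.total_norm f)"
    if "s \<in> ball s\<^sub>0 (1 / (2 * (K + 1)))" for s
  proof -
    have "K * norm (s\<^sub>0 - s) \<le> K * (1 / (2 * (K + 1)))"
      using that K(1) by (intro mult_left_mono) (auto simp: dist_norm)
    also have "\<dots> \<le> 1 / 2" using K(1) by (simp add: field_simps)
    finally have small: "K * norm (s\<^sub>0 - s) \<le> 1 / 2" .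
    then have lt: "K * norm (s\<^sub>0 - s) < 1" by simp
    have "X_norm u \<le> 2 * K * Y.total_norm f" if u: "Lgraph W s u f" for u f
    proof -
      have "X_norm u \<le> K / (1 - K * norm (s\<^sub>0 - s)) * Y.total_norm f"
        by (rule Lgraph_perturb_bound[OF inv K(1) lt K(2) u])
      also have "\<dots> \<le> K / (1 / 2) * Y.total_norm f"
        using K(1) small by (intro mult_right_mono divide_left_mono Y.N_nonneg LgraphD(2)[OF u]) auto
      finally show ?thesis by simp
    qed
    moreover have "Linvertible W \<sigma> s" by (rule Linvertible_perturb[OF inv K(1) lt K(2)])
    ultimately show ?thesis by blast
  qed
  then show ?thesis
    using K(1) by (intro exI[of _ "1 / (2 * (K + 1))"] conjI exI[of _ "2 * K"]) auto
qed

end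

lemma open_Omega1: "open (Omega1 \<sigma>)"
proof -
  have "\<sigma> < cmod s" if "\<sigma> < \<bar>Im s\<bar>" for s using abs_Im_le_cmod[of s] that by linarith
  then have "Omega1 \<sigma> = {s. \<sigma> < \<bar>Im s\<bar>} \<union> ({s. Re s > 0} \<inter> {s. \<sigma> < cmod s})"
    unfolding Omega1_def by force
  then show ?thesis
    by (simp only:) (intro open_Un open_Int open_Collect_less continuous_intros)
qed

lemma open_Omega2:
  assumes "\<sigma> > 0"
  shows "open (Omega2 \<sigma>)"
proof -
  let ?A = "{s. \<sigma> < cmod s + Re s}" and ?g = "\<lambda>s. \<sigma> - (- Re s * cmod s / (2 * (cmod s + Re s)))"
  have "open ?A" by (intro open_Collect_less continuous_intros)
  moreover have "continuous_on ?A ?g" using assms by (intro continuous_intros) auto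
  moreover have "Omega2 \<sigma> = ?A \<inter> ?g -` {0<..}" unfolding Omega2_def by auto
  ultimately show ?thesis by (simp add: continuous_open_preimage)
qed

lemma open_Omega3: "open (Omega3 \<sigma>)"
proof -
  let ?g = "\<lambda>s. \<sigma> * (cmod s - \<sigma> + Re s) - (\<sigma> * (1 + Re s / cmod s) + Re s / 2)\<^sup>2"
  have "continuous_on (- {0}) ?g" by (intro continuous_intros) auto
  moreover have "Omega3 \<sigma> = (- {0}) \<inter> ?g -` {0<..}" unfolding Omega3_def by auto
  ultimately show ?thesis by (simp add: continuous_open_preimage open_Compl)
qed

lemma open_Omega: "\<sigma> > 0 \<Longrightarrow> open (Omega \<sigma>)"
  unfolding Omega_def by (intro open_Int open_Un open_Omega1 open_Omega2 open_Omega3)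

section \<open>Initial value problems\<close>

lemma integral_exp_le:
  fixes \<kappa> :: real
  assumes "\<kappa> > 0" "a \<le> b"
  shows "integral {a..b} (\<lambda>t. exp (\<kappa> * (t - a))) \<le> exp (\<kappa> * (b - a)) / \<kappa>"
proof -
  have "((\<lambda>t. exp (\<kappa> * (t - a))) has_integral exp (\<kappa> * (b - a)) / \<kappa> - exp (\<kappa> * (a - a)) / \<kappa>) {a..b}"
    using assms by (intro fundamental_theorem_of_calculus)
      (auto intro!: derivative_eq_intros simp: has_real_derivative_iff_has_vector_derivative[symmetric])
  from integral_unique[OF this] show ?thesis using assms by simp
qed

lemma gronwall:
  fixes \<phi> :: "real \<Rightarrow> real"
  assumes cont: "continuous_on {a..b} \<phi>" and M: "M \<ge> 0"
    and le: "\<And>x. x \<in> {a..b} \<Longrightarrow> \<phi> x \<le> B + M * integral {a..x} \<phi>" and x: "x \<in> {a..b}"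
  shows "\<phi> x \<le> B * exp (M * (x - a))"
proof -
  define \<psi> where "\<psi> t = exp (- M * (t - a)) * (B + M * integral {a..t} \<phi>)" for t
  have der: "(\<psi> has_real_derivative exp (- M * (t - a)) * M * (\<phi> t - (B + M * integral {a..t} \<phi>)))
      (at t within {a..b})"
    if "t \<in> {a..b}" for t
    unfolding \<psi>_def using integral_has_real_derivative[OF cont that]
    by (auto intro!: derivative_eq_intros simp: algebra_simps)
  have "\<psi> x \<le> \<psi> a"
  proof (rule DERIV_nonpos_imp_decreasing_open[where f=\<psi>])
    show "a \<le> x" using x by simp
    show "continuous_on {a..x} \<psi>"
      using x by (intro continuous_on_subset[OF DERIV_continuous_on[OF der]]) auto
    show "\<exists>y. (\<psi> has_real_derivative y) (at t) \<and> y \<le> 0" if "a < t" "t < x" for t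
    proof -
      have t: "t \<in> {a..b}" "at t within {a..b} = at t" using that x by (auto intro: at_within_Icc_at)
      then show ?thesis using der[OF t(1)] le[OF t(1)] M by (auto simp: mult_le_0_iff)
    qed
  qed
  have "\<phi> x \<le> B + M * integral {a..x} \<phi>" by (rule le[OF x])
  also have "\<dots> = exp (M * (x - a)) * \<psi> x" by (simp add: \<psi>_def exp_minus)
  also have "\<dots> \<le> exp (M * (x - a)) * \<psi> a" using \<open>\<psi> x \<le> \<psi> a\<close> by (intro mult_left_mono) auto
  finally show ?thesis by (simp add: \<psi>_def mult.commute)
qed

lemma norm_le_if_linear_growth:
  fixes y :: "real \<Rightarrow> 'a::banach"
  assumes der: "\<And>t. t \<in> {a..b} \<Longrightarrow> (y has_vector_derivative y' t) (at t within {a..b})" and "y a = 0"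
    and growth: "\<And>t. t \<in> {a..b} \<Longrightarrow> norm (y' t) \<le> g t + M * norm (y t)"
    and g: "continuous_on {a..b} g" "\<And>t. t \<in> {a..b} \<Longrightarrow> g t \<ge> 0" and M: "M \<ge> 0" and x: "x \<in> {a..b}"
  shows "norm (y x) \<le> exp (M * (x - a)) * integral {a..x} g"
proof -
  have y: "continuous_on {a..b} y"
    using der has_vector_derivative_continuous by (fastforce simp: continuous_on_eq_continuous_within)
  have integrable: "h integrable_on {a..t}"
    if "continuous_on {a..b} h" "t \<in> {a..b}" for h :: "real \<Rightarrow> real" and t
    using that by (intro integrable_continuous_real continuous_on_subset[OF that(1)]) auto
  have "norm (y t) \<le> integral {a..x} g + M * integral {a..t} (\<lambda>t. norm (y t))" if t: "t \<in> {a..x}" for t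
  proof -
    have tb: "t \<in> {a..b}" and sub: "{a..t} \<subseteq> {a..b}" using t x by auto
    have "(y' has_integral y t - y a) {a..t}"
      using t sub by (intro fundamental_theorem_of_calculus has_vector_derivative_within_subset[OF der]) auto
    then have "y' integrable_on {a..t}" "y t = integral {a..t} y'"
      using \<open>y a = 0\<close> by (auto dest: integral_unique)
    moreover have "(\<lambda>t. g t + M * norm (y t)) integrable_on {a..t}"
      by (intro integrable tb continuous_intros g(1) y)
    ultimately have "norm (y t) \<le> integral {a..t} (\<lambda>t. g t + M * norm (y t))"
      using growth sub by (auto intro!: integral_norm_bound_integral)
    also have "\<dots> = integral {a..t} g + M * integral {a..t} (\<lambda>t. norm (y t))"
      using tb by (subst integral_add) (auto intro!: integrable g y continuous_intros)
    also have "integral {a..t} g \<le> integral {a..x} g"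
      using t x g(2) by (intro integral_subset_le integrable g(1)) auto
    finally show ?thesis by simp
  qed
  moreover have "continuous_on {a..x} (\<lambda>t. norm (y t))"
    using x by (intro continuous_intros continuous_on_subset[OF y]) auto
  ultimately have "norm (y x) \<le> integral {a..x} g * exp (M * (x - a))"
    using x by (intro gronwall[of a x "\<lambda>t. norm (y t)"] M) auto
  then show ?thesis by (simp add: mult.commute)
qed

lemma exp_weighted_integral_lipschitz:
  fixes F :: "real \<Rightarrow> 'a::banach \<Rightarrow> 'a"
  assumes "a \<le> b" and cont: "continuous_on {a..b} (\<lambda>t. F t (u t))" "continuous_on {a..b} (\<lambda>t. F t (v t))"
    and lip: "\<And>t y z. t \<in> {a..b} \<Longrightarrow> norm (F t y - F t z) \<le> M * norm (y - z)" and M: "M \<ge> 0"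
    and close: "\<And>t. t \<in> {a..b} \<Longrightarrow> norm (u t - v t) \<le> D * exp (\<kappa> * (t - a))"
    and D: "D \<ge> 0" and \<kappa>: "\<kappa> > 0"
  shows "exp (- \<kappa> * (b - a)) * norm (integral {a..b} (\<lambda>t. F t (u t)) - integral {a..b} (\<lambda>t. F t (v t)))
    \<le> M / \<kappa> * D"
proof -
  have i: "(\<lambda>t. F t (u t)) integrable_on {a..b}" "(\<lambda>t. F t (v t)) integrable_on {a..b}"
    using cont by (auto intro: integrable_continuous_real)
  have "norm (integral {a..b} (\<lambda>t. F t (u t)) - integral {a..b} (\<lambda>t. F t (v t))) \<le>
      integral {a..b} (\<lambda>t. M * D * exp (\<kappa> * (t - a)))"
    unfolding integral_diff[OF i, symmetric]
  proof (rule integral_norm_bound_integral)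
    fix t assume t: "t \<in> {a..b}"
    have "norm (F t (u t) - F t (v t)) \<le> M * norm (u t - v t)" by (rule lip[OF t])
    also have "\<dots> \<le> M * (D * exp (\<kappa> * (t - a)))" by (intro mult_left_mono close t M)
    finally show "norm (F t (u t) - F t (v t)) \<le> M * D * exp (\<kappa> * (t - a))" by simp
  qed (intro integrable_diff i integrable_continuous_real continuous_intros)+
  also have "\<dots> = M * D * integral {a..b} (\<lambda>t. exp (\<kappa> * (t - a)))" by simp
  also have "\<dots> \<le> M * D * (exp (\<kappa> * (b - a)) / \<kappa>)"
    using M D by (intro mult_left_mono integral_exp_le \<kappa> \<open>a \<le> b\<close>) auto
  also have "\<dots> = M / \<kappa> * D / exp (- \<kappa> * (b - a))" by (simp add: exp_minus divide_inverse)
  finally show ?thesis by (subst (asm) pos_le_divide_eq) (simp_all add: mult.commute)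
qed

text \<open>Banach's fixed point theorem applies on the whole interval at once if the unknown is
  \<open>exp (- \<kappa> * (t - a)) *\<^sub>R y t\<close> with \<open>\<kappa> > M\<close>.\<close>
lemma volterra_equation_solvable:
  fixes F :: "real \<Rightarrow> 'a::banach \<Rightarrow> 'a"
  assumes "a \<le> b" and cont: "\<And>y. continuous_on {a..b} y \<Longrightarrow> continuous_on {a..b} (\<lambda>t. F t (y t))"
    and lip: "\<And>t y z. t \<in> {a..b} \<Longrightarrow> norm (F t y - F t z) \<le> M * norm (y - z)" and M: "M \<ge> 0"
  shows "\<exists>y. continuous_on {a..b} y \<and> (\<forall>x\<in>{a..b}. y x = y\<^sub>0 + integral {a..x} (\<lambda>t. F t (y t)))"
proof -
  define \<kappa> where "\<kappa> = 2 * M + 1"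
  have \<kappa>: "\<kappa> > 0" "M / \<kappa> \<le> 1 / 2" using M by (auto simp: \<kappa>_def field_simps)
  define E where "E w t = exp (\<kappa> * (t - a)) *\<^sub>R apply_bcontfun w t" for w :: "real \<Rightarrow>\<^sub>C 'a" and t
  define V where "V w x = exp (- \<kappa> * (x - a)) *\<^sub>R (y\<^sub>0 + integral {a..x} (\<lambda>t. F t (E w t)))" for w x
  have E: "continuous_on {a..b} (E w)" for w unfolding E_def by (intro continuous_intros) auto
  have FE: "continuous_on {a..b} (\<lambda>t. F t (E w t))" for w by (intro cont E)
  have "continuous_on (cbox a b) (V w)" for w
    unfolding V_def box_real using FE
    by (intro continuous_intros indefinite_integral_continuous_1 integrable_continuous_real)
  then have "\<exists>v. \<forall>x. apply_bcontfun v x = V w (clamp a b x)" for w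
    using continuous_on_cbox_bcontfunE by metis
  then obtain T where T: "\<And>w x. apply_bcontfun (T w) x = V w (clamp a b x)" by metis
  have "dist (T w) (T v) \<le> 1 / 2 * dist w v" for w v
  proof (rule dist_bound)
    fix x
    define c where "c = clamp a b x"
    have c: "c \<in> {a..b}" unfolding c_def using clamp_in_interval[of a b x] \<open>a \<le> b\<close> by simp
    have "dist (apply_bcontfun (T w) x) (apply_bcontfun (T v) x) = exp (- \<kappa> * (c - a)) *
        norm (integral {a..c} (\<lambda>t. F t (E w t)) - integral {a..c} (\<lambda>t. F t (E v t)))"
      by (simp add: T V_def dist_norm flip: scaleR_diff_right c_def)
    also have "\<dots> \<le> M / \<kappa> * dist w v"
    proof (rule exp_weighted_integral_lipschitz[where F=F])
      show "norm (E w t - E v t) \<le> dist w v * exp (\<kappa> * (t - a))" for t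
        using dist_bounded[of w t v] by (simp add: E_def dist_norm mult.commute flip: scaleR_diff_right)
    qed (use c M \<kappa> lip in \<open>auto intro: continuous_on_subset[OF FE]\<close>)
    also have "\<dots> \<le> 1 / 2 * dist w v" using \<kappa>(2) by (rule mult_right_mono) simp
    finally show "dist (apply_bcontfun (T w) x) (apply_bcontfun (T v) x) \<le> 1 / 2 * dist w v" .
  qed
  then obtain w where "T w = w" using banach_fix_type[of "1/2" T] by auto
  then have "E w x = y\<^sub>0 + integral {a..x} (\<lambda>t. F t (E w t))" if "x \<in> {a..b}" for x
    using T[of w x] that by (simp add: E_def[of w x] V_def exp_minus)
  then show ?thesis using E by blast
qed

theorem picard_lindelof_global:
  fixes F :: "real \<Rightarrow> 'a::banach \<Rightarrow> 'a"
  assumes "a \<le> b" and cont: "\<And>y. continuous_on {a..b} y \<Longrightarrow> continuous_on {a..b} (\<lambda>t. F t (y t))"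
    and lip: "\<And>t y z. t \<in> {a..b} \<Longrightarrow> norm (F t y - F t z) \<le> M * norm (y - z)" and M: "M \<ge> 0"
  shows "\<exists>y. y a = y\<^sub>0 \<and> (\<forall>t\<in>{a..b}. (y has_vector_derivative F t (y t)) (at t within {a..b}))"
proof -
  have "\<exists>y. continuous_on {a..b} y \<and> (\<forall>x\<in>{a..b}. y x = y\<^sub>0 + integral {a..x} (\<lambda>t. F t (y t)))"
    by (rule volterra_equation_solvable[OF assms])
  then obtain y where y: "continuous_on {a..b} y"
      "\<And>x. x \<in> {a..b} \<Longrightarrow> y x = y\<^sub>0 + integral {a..x} (\<lambda>t. F t (y t))"
    by blast
  have "(y has_vector_derivative F t (y t)) (at t within {a..b})" if t: "t \<in> {a..b}" for t
  proof (rule has_vector_derivative_transform[OF t y(2)])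
    have "((\<lambda>x. y\<^sub>0 + integral {a..x} (\<lambda>t. F t (y t))) has_vector_derivative 0 + F t (y t))
        (at t within {a..b})"
      by (intro has_vector_derivative_add has_vector_derivative_const
          integral_has_vector_derivative cont[OF y(1)] t)
    then show "((\<lambda>x. y\<^sub>0 + integral {a..x} (\<lambda>t. F t (y t))) has_vector_derivative F t (y t))
        (at t within {a..b})"
      by simp
  qed
  moreover have "y a = y\<^sub>0" using y(2)[of a] \<open>a \<le> b\<close> by simp
  ultimately show ?thesis by blast
qed

text \<open>The equation as a first-order system, with the singular coefficient \<open>1 / x\<^sup>2\<close> frozen on \<open>{0..d}\<close>.\<close>
definition cutoff_field ::
    "(real \<Rightarrow> complex) \<Rightarrow> complex \<Rightarrow> real \<Rightarrow> (real \<Rightarrow> complex) \<Rightarrow> real \<Rightarrow>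
     complex \<times> complex \<Rightarrow> complex \<times> complex" where
  "cutoff_field W s d f t y =
     (snd y, of_real (1 / (max t d)\<^sup>2) * (f t - (of_real (2 * t) + s) * snd y + W t * fst y))"

lemma cutoff_field_diff:
  "cutoff_field W s d f t y - cutoff_field W s d f t z = cutoff_field W s d 0 t (y - z)"
  by (simp add: cutoff_field_def algebra_simps add_divide_distrib diff_divide_distrib)

lemma continuous_on_cutoff_field:
  assumes "0 < d" "continuous_on S W" "continuous_on S f" "continuous_on S y"
  shows "continuous_on S (\<lambda>t. cutoff_field W s d f t (y t))"
  unfolding cutoff_field_def using assms by (intro continuous_intros) auto

lemma
  fixes y :: "complex \<times> complex"
  assumes d: "0 < d" and t: "t \<in> {0..1}" and W: "norm (W t) \<le> B" and s: "norm s \<le> R"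
  shows norm_snd_cutoff_field_le:
      "norm (snd (cutoff_field W s d f t y)) \<le> (norm (f t) + (2 + R + B) * norm y) / d\<^sup>2"
    and norm_cutoff_field_le:
      "norm (cutoff_field W s d f t y) \<le> norm (f t) / d\<^sup>2 + (1 + (2 + R + B) / d\<^sup>2) * norm y"
proof -
  have nonneg: "0 \<le> R" "0 \<le> B" using order_trans[OF norm_ge_zero s] order_trans[OF norm_ge_zero W] by simp_all
  have fst: "norm (fst y) \<le> norm y" and snd: "norm (snd y) \<le> norm y"
    using norm_fst_le[of "fst y" "snd y"] norm_snd_le[of "snd y" "fst y"] by simp_all
  have "norm ((of_real (2 * t) + s) * snd y) \<le> (2 + R) * norm y"
    unfolding norm_mult using norm_triangle_ineq[of "of_real (2 * t)" s] t s snd nonneg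
    by (intro mult_mono) (auto simp: norm_mult)
  moreover have "norm (W t * fst y) \<le> B * norm y"
    unfolding norm_mult using W fst nonneg by (intro mult_mono) auto
  moreover have "norm (f t - (of_real (2 * t) + s) * snd y + W t * fst y) \<le>
      norm (f t) + norm ((of_real (2 * t) + s) * snd y) + norm (W t * fst y)"
    by (intro order_trans[OF norm_triangle_ineq] add_mono norm_triangle_ineq4) auto
  ultimately have num: "norm (f t - (of_real (2 * t) + s) * snd y + W t * fst y) \<le>
      norm (f t) + (2 + R + B) * norm y"
    by (simp add: algebra_simps)
  have "norm (snd (cutoff_field W s d f t y)) =
      1 / (max t d)\<^sup>2 * norm (f t - (of_real (2 * t) + s) * snd y + W t * fst y)"
    by (simp add: cutoff_field_def norm_mult norm_divide norm_power)
  also have "\<dots> \<le> 1 / d\<^sup>2 * (norm (f t) + (2 + R + B) * norm y)"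
    using d by (intro mult_mono num divide_left_mono power_mono) auto
  finally show le: "norm (snd (cutoff_field W s d f t y)) \<le> (norm (f t) + (2 + R + B) * norm y) / d\<^sup>2" by simp
  have "norm (cutoff_field W s d f t y) \<le>
      norm (fst (cutoff_field W s d f t y)) + norm (snd (cutoff_field W s d f t y))"
    unfolding norm_prod_def by (simp add: sqrt_sum_squares_le_sum)
  also have "\<dots> \<le> norm y + (norm (f t) + (2 + R + B) * norm y) / d\<^sup>2"
    using le snd by (intro add_mono) (auto simp: cutoff_field_def)
  finally show "norm (cutoff_field W s d f t y) \<le> norm (f t) / d\<^sup>2 + (1 + (2 + R + B) / d\<^sup>2) * norm y"
    by (simp add: algebra_simps add_divide_distrib)
qed

lemma cutoff_field_solution:
  assumes W: "continuous_on {0..1} W" "\<And>t. t \<in> {0..1} \<Longrightarrow> norm (W t) \<le> B"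
    and f: "continuous_on {0..1} f" and d: "0 < d" and s: "norm s \<le> R"
  shows "\<exists>y. (\<forall>t\<in>{0..1}. (y has_vector_derivative cutoff_field W s d f t (y t)) (at t within {0..1})) \<and>
    (\<forall>t\<in>{0..1}. norm (y t) \<le> exp (1 + (2 + R + B) / d\<^sup>2) / d\<^sup>2 * integral {0..t} (\<lambda>t. norm (f t)))"
proof -
  define M where "M = 1 + (2 + R + B) / d\<^sup>2"
  have M: "M \<ge> 0"
    unfolding M_def using order_trans[OF norm_ge_zero W(2)[of 0]] order_trans[OF norm_ge_zero s] by simp
  have growth: "norm (cutoff_field W s d f t y) \<le> norm (f t) / d\<^sup>2 + M * norm y" if "t \<in> {0..1}" for f t y
    unfolding M_def by (rule norm_cutoff_field_le[of d t W, OF d that W(2)[OF that] s])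
  have lip: "norm (cutoff_field W s d f t y - cutoff_field W s d f t z) \<le> M * norm (y - z)"
    if "t \<in> {0..1}" for t y z
    using growth[OF that, of 0 "y - z"] by (simp add: cutoff_field_diff)
  have "\<exists>y. y 0 = 0 \<and>
      (\<forall>t\<in>{0..1}. (y has_vector_derivative cutoff_field W s d f t (y t)) (at t within {0..1}))"
    by (rule picard_lindelof_global[OF _ continuous_on_cutoff_field[OF d W(1) f] lip M]) simp
  then obtain y where y: "y 0 = 0"
      "\<And>t. t \<in> {0..1} \<Longrightarrow> (y has_vector_derivative cutoff_field W s d f t (y t)) (at t within {0..1})"
    by blast
  have "norm (y t) \<le> exp M / d\<^sup>2 * integral {0..t} (\<lambda>t. norm (f t))" if t: "t \<in> {0..1}" for t
  proof -
    have "continuous_on {0..1} (\<lambda>t. norm (f t) / d\<^sup>2)" using d f by (intro continuous_intros) auto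
    then have "norm (y t) \<le> exp (M * (t - 0)) * integral {0..t} (\<lambda>t. norm (f t) / d\<^sup>2)"
      using growth M t by (intro norm_le_if_linear_growth[OF y(2,1)]) auto
    also have "\<dots> = exp (M * t) / d\<^sup>2 * integral {0..t} (\<lambda>t. norm (f t))" by simp
    also have "\<dots> \<le> exp M / d\<^sup>2 * integral {0..t} (\<lambda>t. norm (f t))"
      using t M continuous_on_subset[OF f, of "{0..t}"]
      by (intro mult_right_mono divide_right_mono integral_nonneg integrable_continuous_real
          continuous_intros) (auto simp: mult_left_le)
    finally show ?thesis .
  qed
  then show ?thesis using y(2) unfolding M_def by blast
qed

lemma classical_solution_if_cutoff_field_solution:
  assumes d: "0 < d"
    and y: "\<And>t. t \<in> {0..1} \<Longrightarrow> (y has_vector_derivative cutoff_field W s d f t (y t)) (at t within {0..1})"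
    and zero: "\<And>x. x \<in> {0..d} \<Longrightarrow> y x = 0" "\<And>x. x \<in> {0..d} \<Longrightarrow> f x = 0"
  shows "classical_solution W s f (\<lambda>x. fst (y x)) (\<lambda>x. snd (y x)) (\<lambda>x. snd (cutoff_field W s d f x (y x)))"
  unfolding classical_solution_def
proof (intro ballI conjI)
  fix x :: real assume x: "x \<in> {0..1}"
  show "((\<lambda>x. fst (y x)) has_vector_derivative snd (y x)) (at x within {0..1})"
    "((\<lambda>x. snd (y x)) has_vector_derivative snd (cutoff_field W s d f x (y x))) (at x within {0..1})"
    using bounded_linear.has_vector_derivative[OF bounded_linear_fst y[OF x]]
      bounded_linear.has_vector_derivative[OF bounded_linear_snd y[OF x]]
    by (simp_all add: cutoff_field_def)
  show "of_real (x\<^sup>2) * snd (cutoff_field W s d f x (y x)) + (of_real (2 * x) + s) * snd (y x) -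
      W x * fst (y x) = f x"
  proof (cases "x \<le> d")
    case True then show ?thesis using zero[of x] x by (simp add: cutoff_field_def)
  next
    case False
    then have "complex_of_real (x\<^sup>2) * of_real (1 / (max x d)\<^sup>2) = 1" using d by (simp flip: of_real_mult)
    then have "of_real (x\<^sup>2) * snd (cutoff_field W s d f x (y x)) =
        f x - (of_real (2 * x) + s) * snd (y x) + W x * fst (y x)"
      unfolding cutoff_field_def snd_conv by (simp only: mult.assoc[symmetric]) simp
    then show ?thesis by simp
  qed
qed

lemma integral_norm_le_L2norm:
  assumes "continuous_on {0..1} f"
  shows "integral {0..1} (\<lambda>x. norm (f x)) \<le> L2norm f"
  unfolding L2norm_def using square_integral_le[of 0 1 "\<lambda>x. norm (f x)"] assms
  by (intro real_le_rsqrt) (auto intro: continuous_intros)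

lemma L2norm_nonneg: "L2norm f \<ge> 0"
  unfolding L2norm_def by (cases "(\<lambda>x. (norm (f x))\<^sup>2) integrable_on {0..1}")
    (auto simp: not_integrable_integral intro: integral_nonneg)

lemma cutoff_field_solution_le_L2norm:
  assumes W: "continuous_on {0..1} W" "\<And>t. t \<in> {0..1} \<Longrightarrow> norm (W t) \<le> B"
    and f: "continuous_on {0..1} f" "\<And>x. x \<in> {0..d} \<Longrightarrow> f x = 0"
    and d: "0 < d" "d < 1" and s: "norm s \<le> R" and D: "D = exp (1 + (2 + R + B) / d\<^sup>2) / d\<^sup>2"
  shows "\<exists>y. (\<forall>t\<in>{0..1}. (y has_vector_derivative cutoff_field W s d f t (y t)) (at t within {0..1})) \<and>
    (\<forall>t\<in>{0..d}. y t = 0) \<and> (\<forall>t\<in>{0..1}. norm (y t) \<le> D * L2norm f)"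
proof -
  obtain y where
    y: "\<forall>t\<in>{0..1}. (y has_vector_derivative cutoff_field W s d f t (y t)) (at t within {0..1})"
    and y_le: "\<And>t. t \<in> {0..1} \<Longrightarrow> norm (y t) \<le> D * integral {0..t} (\<lambda>t. norm (f t))"
    using cutoff_field_solution[OF W f(1) d(1) s] unfolding D by blast
  have "y t = 0" if t: "t \<in> {0..d}" for t
  proof -
    have "integral {0..t} (\<lambda>t. norm (f t)) = integral {0..t} (\<lambda>t. 0)"
      by (intro integral_cong) (use f(2) t in auto)
    then show ?thesis using y_le[of t] t d by simp
  qed
  moreover have "norm (y t) \<le> D * L2norm f" if t: "t \<in> {0..1}" for t
  proof -
    have "integral {0..t} (\<lambda>t. norm (f t)) \<le> integral {0..1} (\<lambda>t. norm (f t))"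
      using t by (intro integral_subset_le integrable_continuous_real continuous_intros
          continuous_on_subset[OF f(1)]) auto
    also have "\<dots> \<le> L2norm f" by (rule integral_norm_le_L2norm[OF f(1)])
    finally have "D * integral {0..t} (\<lambda>t. norm (f t)) \<le> D * L2norm f"
      unfolding D by (rule mult_left_mono) simp
    then show ?thesis by (rule order_trans[OF y_le[OF t]])
  qed
  ultimately show ?thesis using y by blast
qed

definition controlled_solution ::
    "(real \<Rightarrow> complex) \<Rightarrow> complex \<Rightarrow> (real \<Rightarrow> complex) \<Rightarrow> real \<Rightarrow> real \<Rightarrow>
     (real \<Rightarrow> complex) \<Rightarrow> (real \<Rightarrow> complex) \<Rightarrow> (real \<Rightarrow> complex) \<Rightarrow> bool" where
  "controlled_solution W s f d C z z' z'' \<longleftrightarrow>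
     classical_solution W s f z z' z'' \<and> (\<forall>x\<in>{0..d}. z x = 0) \<and>
     (\<forall>x\<in>{0..1}. norm (z x) \<le> C * L2norm f \<and> norm (z' x) \<le> C * L2norm f \<and>
       norm (z'' x) \<le> C * (norm (f x) + L2norm f))"

lemma controlled_solution_exists:
  assumes W: "continuous_on {0..1} W" "\<And>t. t \<in> {0..1} \<Longrightarrow> norm (W t) \<le> B"
    and f: "continuous_on {0..1} f" "\<And>x. x \<in> {0..d} \<Longrightarrow> f x = 0"
    and d: "0 < d" "d < 1" and s: "norm s \<le> R" and D: "D = exp (1 + (2 + R + B) / d\<^sup>2) / d\<^sup>2"
    and C: "D \<le> C" "1 / d\<^sup>2 \<le> C" "(2 + R + B) * D / d\<^sup>2 \<le> C"
  shows "\<exists>z z' z''. controlled_solution W s f d C z z' z''"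
proof -
  obtain y where
    y: "\<And>t. t \<in> {0..1} \<Longrightarrow> (y has_vector_derivative cutoff_field W s d f t (y t)) (at t within {0..1})"
    and y0: "\<And>t. t \<in> {0..d} \<Longrightarrow> y t = 0"
    and y_le: "\<And>t. t \<in> {0..1} \<Longrightarrow> norm (y t) \<le> D * L2norm f"
    using cutoff_field_solution_le_L2norm[OF W f d s D] by blast
  let ?z'' = "\<lambda>x. snd (cutoff_field W s d f x (y x))"
  have "classical_solution W s f (\<lambda>x. fst (y x)) (\<lambda>x. snd (y x)) ?z''"
    by (rule classical_solution_if_cutoff_field_solution[OF d(1) y y0 f(2)])
  moreover have "norm (fst (y x)) \<le> C * L2norm f" "norm (snd (y x)) \<le> C * L2norm f"
    if "x \<in> {0..1}" for x
    using y_le[OF that] mult_right_mono[OF C(1) L2norm_nonneg[of f]]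
      norm_fst_le[of "fst (y x)" "snd (y x)"] norm_snd_le[of "snd (y x)" "fst (y x)"] by simp_all
  moreover have "norm (?z'' x) \<le> C * (norm (f x) + L2norm f)" if x: "x \<in> {0..1}" for x
  proof -
    have "norm (?z'' x) \<le> (norm (f x) + (2 + R + B) * norm (y x)) / d\<^sup>2"
      by (rule norm_snd_cutoff_field_le[of d x W, OF d(1) x W(2)[OF x] s])
    also have "\<dots> \<le> (norm (f x) + (2 + R + B) * (D * L2norm f)) / d\<^sup>2"
      using y_le[OF x] order_trans[OF norm_ge_zero s] order_trans[OF norm_ge_zero W(2)[OF x]]
      by (intro divide_right_mono add_left_mono mult_left_mono) auto
    also have "\<dots> = 1 / d\<^sup>2 * norm (f x) + (2 + R + B) * D / d\<^sup>2 * L2norm f"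
      by (simp add: add_divide_distrib)
    also have "\<dots> \<le> C * norm (f x) + C * L2norm f"
      by (intro add_mono mult_right_mono C L2norm_nonneg norm_ge_zero)
    finally show ?thesis by (simp add: distrib_left)
  qed
  moreover have "fst (y x) = 0" if "x \<in> {0..d}" for x using y0[OF that] by simp
  ultimately have "controlled_solution W s f d C (\<lambda>x. fst (y x)) (\<lambda>x. snd (y x)) ?z''"
    unfolding controlled_solution_def by blast
  then show ?thesis by blast
qed

proposition controlled_solution_uniform:
  fixes W :: "real \<Rightarrow> complex"
  assumes W: "continuous_on {0..1} W" and d: "0 < d" "d < 1" and R: "0 \<le> R"
  shows "\<exists>C\<ge>0. \<forall>s f. norm s \<le> R \<longrightarrow> continuous_on {0..1} f \<longrightarrow> (\<forall>x\<in>{0..d}. f x = 0) \<longrightarrow>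
    (\<exists>z z' z''. controlled_solution W s f d C z z' z'')"
proof -
  have "bounded (W ` {0..1})" using W by (intro compact_imp_bounded compact_continuous_image) auto
  then obtain B where B: "\<And>x. x \<in> {0..1} \<Longrightarrow> norm (W x) \<le> B" unfolding bounded_iff by (metis imageI)
  have "B \<ge> 0" using order_trans[OF norm_ge_zero B[of 0]] by simp
  define D where "D = exp (1 + (2 + R + B) / d\<^sup>2) / d\<^sup>2"
  define C where "C = D + (1 + (2 + R + B) * D) / d\<^sup>2"
  have D: "D \<ge> 0" by (simp add: D_def)
  have C: "D \<le> C" "1 / d\<^sup>2 \<le> C" "(2 + R + B) * D / d\<^sup>2 \<le> C"
    unfolding C_def using D R \<open>B \<ge> 0\<close> by (auto simp: add_divide_distrib)
  show ?thesis
  proof (intro exI[of _ C] conjI allI impI)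
    show "C \<ge> 0" using C(1) D by simp
    fix s :: complex and f :: "real \<Rightarrow> complex"
    assume "norm s \<le> R" "continuous_on {0..1} f" "\<forall>x\<in>{0..d}. f x = 0"
    then show "\<exists>z z' z''. controlled_solution W s f d C z z' z''"
      by (intro controlled_solution_exists[OF W B _ _ d _ D_def C]) auto
  qed
qed

section \<open>Gevrey regularity away from the origin\<close>

definition leibniz_sum :: "(nat \<Rightarrow> 'a::semiring_1) \<Rightarrow> (nat \<Rightarrow> 'a) \<Rightarrow> nat \<Rightarrow> 'a" where
  "leibniz_sum a b n = (\<Sum>j\<le>n. of_nat (n choose j) * (a j * b (n - j)))"

lemma leibniz_sum_Suc:
  fixes a b :: "nat \<Rightarrow> 'a::comm_ring_1"
  shows "leibniz_sum a b (Suc n) =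
    (\<Sum>j\<le>n. of_nat (n choose j) * (a (Suc j) * b (n - j) + a j * b (Suc (n - j))))"
proof -
  have "leibniz_sum a b (Suc n) =
      a 0 * b (Suc n) + (\<Sum>j\<le>n. of_nat (n choose Suc j) * (a (Suc j) * b (n - j))) +
      (\<Sum>j\<le>n. of_nat (n choose j) * (a (Suc j) * b (n - j)))"
    unfolding leibniz_sum_def by (subst sum.atMost_Suc_shift) (simp add: algebra_simps sum.distrib)
  also have "a 0 * b (Suc n) + (\<Sum>j\<le>n. of_nat (n choose Suc j) * (a (Suc j) * b (n - j))) =
      (\<Sum>j\<le>Suc n. of_nat (n choose j) * (a j * b (Suc n - j)))"
    by (subst sum.atMost_Suc_shift) simp
  also have "\<dots> = (\<Sum>j\<le>n. of_nat (n choose j) * (a j * b (Suc (n - j))))"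
    by (simp add: Suc_diff_le binomial_eq_0)
  finally show ?thesis by (simp add: algebra_simps sum.distrib)
qed

lemma has_vector_derivative_leibniz_sum:
  fixes a b :: "nat \<Rightarrow> real \<Rightarrow> 'a::real_normed_field"
  assumes a: "\<And>i. i \<le> n \<Longrightarrow> (a i has_vector_derivative a (Suc i) x) (at x within S)"
    and b: "\<And>i. i \<le> n \<Longrightarrow> (b i has_vector_derivative b (Suc i) x) (at x within S)"
  shows "((\<lambda>x. leibniz_sum (\<lambda>i. a i x) (\<lambda>i. b i x) n) has_vector_derivative
    leibniz_sum (\<lambda>i. a i x) (\<lambda>i. b i x) (Suc n)) (at x within S)"
  unfolding leibniz_sum_Suc unfolding leibniz_sum_def
proof (intro has_vector_derivative_sum has_vector_derivative_mult_right)
  fix j assume "j \<in> {..n}"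
  then have "((\<lambda>x. a j x * b (n - j) x) has_vector_derivative
      a j x * b (Suc (n - j)) x + a (Suc j) x * b (n - j) x) (at x within S)"
    by (intro has_vector_derivative_mult a b) auto
  then show "((\<lambda>x. a j x * b (n - j) x) has_vector_derivative
      a (Suc j) x * b (n - j) x + a j x * b (Suc (n - j)) x) (at x within S)"
    by (simp add: add.commute)
qed

text \<open>Differentiating \<open>x\<^sup>2 v'' + (2 x + s) v' = w v\<close> \<open>n\<close> times expresses \<open>x\<^sup>2\<close> times the derivative of
  order \<open>n + 2\<close> by those of lower order, here denoted by \<open>h\<close>.\<close>
definition recursion_rhs ::
    "complex \<Rightarrow> (nat \<Rightarrow> real \<Rightarrow> complex) \<Rightarrow> (nat \<Rightarrow> real \<Rightarrow> complex) \<Rightarrow> nat \<Rightarrow> real \<Rightarrow> complex" where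
  "recursion_rhs s w h n x = leibniz_sum (\<lambda>i. w i x) (\<lambda>i. h i x) n -
     (of_real (2 * real (n + 1) * x) + s) * h (Suc n) x - of_nat (n * (n + 1)) * h n x"

lemma recursion_rhs_cong [fundef_cong]:
  assumes "\<And>i. i \<le> Suc n \<Longrightarrow> h i x = h' i x"
  shows "recursion_rhs s w h n x = recursion_rhs s w h' n x"
  using assms by (simp add: recursion_rhs_def leibniz_sum_def)

lemma recursion_rhs_has_derivative:
  assumes w: "\<And>i. i \<le> n \<Longrightarrow> (w i has_vector_derivative w (Suc i) x) (at x within S)"
    and h: "\<And>i. i \<le> Suc n \<Longrightarrow> (h i has_vector_derivative h (Suc i) x) (at x within S)"
  shows "(recursion_rhs s w h n has_vector_derivative
    recursion_rhs s w h (Suc n) x + of_real (2 * x) * h (Suc (Suc n)) x) (at x within S)"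
proof -
  have "((\<lambda>x. complex_of_real (2 * real (n + 1) * x) + s) has_vector_derivative
      of_real (2 * real (n + 1)) + 0) (at x within S)"
    by (intro has_vector_derivative_add has_vector_derivative_const has_vector_derivative_of_real)
       (auto intro!: derivative_eq_intros)
  note coeff = has_vector_derivative_mult[OF this h[of "Suc n"]]
  have "(recursion_rhs s w h n has_vector_derivative
      leibniz_sum (\<lambda>i. w i x) (\<lambda>i. h i x) (Suc n) -
      ((of_real (2 * real (n + 1) * x) + s) * h (Suc (Suc n)) x +
        (of_real (2 * real (n + 1)) + 0) * h (Suc n) x) -
      of_nat (n * (n + 1)) * h (Suc n) x) (at x within S)"
    unfolding recursion_rhs_def
    by (intro has_vector_derivative_diff has_vector_derivative_leibniz_sum
        has_vector_derivative_mult_right coeff w h) auto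
  then show ?thesis by (simp add: recursion_rhs_def algebra_simps)
qed

fun ode_deriv ::
    "(real \<Rightarrow> complex) \<Rightarrow> complex \<Rightarrow> (real \<Rightarrow> complex) \<Rightarrow> (real \<Rightarrow> complex) \<Rightarrow> nat \<Rightarrow> real \<Rightarrow> complex" where
  "ode_deriv W s v v' 0 x = v x"
| "ode_deriv W s v v' (Suc 0) x = v' x"
| "ode_deriv W s v v' (Suc (Suc n)) x =
     inverse (x\<^sup>2) *\<^sub>R recursion_rhs s (\<lambda>i. dn i W) (\<lambda>i x. ode_deriv W s v v' i x) n x"

lemma ode_deriv_has_derivative:
  assumes W: "smooth01 W" and sol: "classical_solution W s 0 v v' v''" and x: "x \<in> {0<..1}"
  shows "(ode_deriv W s v v' n has_vector_derivative ode_deriv W s v v' (Suc n) x) (at x within {0..1})"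
proof (induction n rule: less_induct)
  case (less n)
  let ?h = "ode_deriv W s v v'"
  have x': "x \<in> {0..1}" "x \<noteq> 0" using x by auto
  have h0: "?h 0 = v" and h1: "?h (Suc 0) = v'" by auto
  consider "n = 0" | "n = Suc 0" | k where "n = Suc (Suc k)" by (metis not0_implies_Suc)
  then show ?case
  proof cases
    case 1
    then show ?thesis using classical_solutionD(1)[OF sol x'(1)] h0 by simp
  next
    case 2
    have "x\<^sup>2 *\<^sub>R v'' x = recursion_rhs s (\<lambda>i. dn i W) ?h 0 x"
      using classical_solutionD(3)[OF sol x'(1)]
      by (simp add: recursion_rhs_def leibniz_sum_def scaleR_conv_of_real algebra_simps)
    then have "inverse (x\<^sup>2) *\<^sub>R (x\<^sup>2 *\<^sub>R v'' x) = ?h (Suc (Suc 0)) x" by simp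
    then show ?thesis using classical_solutionD(2)[OF sol x'(1)] x'(2) 2 h1 by simp
  next
    case (3 k)
    let ?r = "recursion_rhs s (\<lambda>i. dn i W) ?h"
    have h: "?h (Suc (Suc k)) = (\<lambda>x. inverse (x\<^sup>2) *\<^sub>R ?r k x)" for k by auto
    have "(?r k has_vector_derivative
        ?r (Suc k) x + of_real (2 * x) * ?h (Suc (Suc k)) x) (at x within {0..1})"
      using less 3 by (intro recursion_rhs_has_derivative dn_has_derivative W x') auto
    then have "(?h (Suc (Suc k)) has_vector_derivative
        inverse (x\<^sup>2) *\<^sub>R (?r (Suc k) x + of_real (2 * x) * ?h (Suc (Suc k)) x) +
        (- 2 * inverse (x ^ 3)) *\<^sub>R ?r k x) (at x within {0..1})"
      unfolding h using x'(2)
      by (intro has_vector_derivative_scaleR)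
         (auto intro!: derivative_eq_intros simp: power2_eq_square power3_eq_cube field_simps)
    moreover have "(- 2 * inverse (x ^ 3)) *\<^sub>R ?r k x =
        - (inverse (x\<^sup>2) *\<^sub>R (of_real (2 * x) * ?h (Suc (Suc k)) x))"
      unfolding h using x'(2) by (simp add: scaleR_conv_of_real field_simps power2_eq_square power3_eq_cube)
    moreover have "?h (Suc n) x = inverse (x\<^sup>2) *\<^sub>R ?r (Suc k) x" unfolding 3 by (simp only: h)
    ultimately show ?thesis by (simp only: 3 scaleR_right_distrib add_uminus_conv_diff add_diff_cancel)
  qed
qed

lemma
  assumes W: "smooth01 W" and u: "smooth01 u" and d: "0 < d"
    and near: "\<And>x. x \<in> {0..1} \<Longrightarrow> x < d \<Longrightarrow> v x = u x"
    and sol: "classical_solution W s 0 v v' v''"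
  shows smooth01_classical_solution: "smooth01 v"
    and dn_classical_solution: "x \<in> {0<..1} \<Longrightarrow> dn n v x = ode_deriv W s v v' n x"
proof -
  have step: "(dn n v has_vector_derivative ode_deriv W s v v' (Suc n) x) (at x within {0..1})"
    if x: "x \<in> {0<..1}" and eq: "\<And>x. x \<in> {0<..1} \<Longrightarrow> dn n v x = ode_deriv W s v v' n x" for n x
  proof (rule has_vector_derivative_transform_within[OF ode_deriv_has_derivative[OF W sol x]])
    show "0 < x" "x \<in> {0..1}" using x by auto
    show "ode_deriv W s v v' n y = dn n v y" if "y \<in> {0..1}" "dist y x < x" for y
      using eq[of y] that by (auto simp: dist_real_def)
  qed
  have eq: "dn n v x = ode_deriv W s v v' n x" if "x \<in> {0<..1}" for n x
    using that
  proof (induction n arbitrary: x)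
    case (Suc n)
    have "vector_derivative (dn n v) (at x within {0..1}) = ode_deriv W s v v' (Suc n) x"
      using Suc by (intro vector_derivative_within at_within_unit_interval_nontrivial step) auto
    then show ?case by (simp only: dn.simps(2))
  qed simp
  show "x \<in> {0<..1} \<Longrightarrow> dn n v x = ode_deriv W s v v' n x" by (rule eq)
  have "dn n v differentiable at x within {0..1}" if x: "x \<in> {0..1}" for n x
  proof (cases "x < d")
    case True
    have "(dn n v has_vector_derivative dn (Suc n) u x) (at x within {0..1})"
    proof (rule has_vector_derivative_transform_within[OF dn_has_derivative[OF u x]])
      show "0 < d - x" "x \<in> {0..1}" using True x by auto
      show "dn n u y = dn n v y" if "y \<in> {0..1}" "dist y x < d - x" for y
        using dn_local[of "{..<d}" u v y n] near that by (auto simp: dist_real_def)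
    qed
    then show ?thesis by (rule differentiableI_vector)
  next
    case False
    then have "x \<in> {0<..1}" using x d by auto
    then show ?thesis using step eq differentiableI_vector by blast
  qed
  then show "smooth01 v" by (simp add: smooth01_def)
qed

lemma binomial_mult_majorant_le:
  assumes "\<tau> > 0" "j \<le> n"
  shows "real (n choose j) * (gevrey_majorant \<tau> j * gevrey_majorant \<tau> (n - j)) \<le> gevrey_majorant \<tau> n"
proof -
  have binomial: "real (n choose j) * (fact j * fact (n - j)) = fact n"
    using binomial_fact_lemma[OF assms(2)] by (metis mult.commute of_nat_fact of_nat_mult)
  have "fact j * fact (n - j) \<le> (fact n :: nat)"
    using fact_fact_dvd_fact[of j "n - j"] assms(2) by (intro dvd_imp_le) auto
  then have le: "fact j * fact (n - j) \<le> (fact n :: real)"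
    by (metis of_nat_fact of_nat_le_iff of_nat_mult)
  have "real (n choose j) * (gevrey_majorant \<tau> j * gevrey_majorant \<tau> (n - j)) =
      (1 / \<tau>) ^ n * ((real (n choose j) * (fact j * fact (n - j))) * (fact j * fact (n - j)))"
    unfolding gevrey_majorant_def using assms(2) by (simp add: power2_eq_square mult_ac flip: power_add)
  also have "\<dots> \<le> (1 / \<tau>) ^ n * (fact n * fact n)"
    unfolding binomial using le assms(1) by (intro mult_left_mono) auto
  finally show ?thesis by (simp add: gevrey_majorant_def power2_eq_square)
qed

lemma norm_leibniz_sum_le_majorant:
  fixes a b :: "nat \<Rightarrow> complex"
  assumes \<tau>: "\<tau> > 0" and A: "A \<ge> 0" and B: "B \<ge> 0"
    and a: "\<And>j. j \<le> n \<Longrightarrow> norm (a j) \<le> A * gevrey_majorant \<tau> j"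
    and b: "\<And>j. j \<le> n \<Longrightarrow> norm (b j) \<le> B * gevrey_majorant \<tau> j"
  shows "norm (leibniz_sum a b n) \<le> (real n + 1) * (A * B * gevrey_majorant \<tau> n)"
proof -
  have "norm (of_nat (n choose j) * (a j * b (n - j))) \<le> A * B * gevrey_majorant \<tau> n" if j: "j \<le> n" for j
  proof -
    have "norm (of_nat (n choose j) * (a j * b (n - j))) \<le>
        real (n choose j) * ((A * gevrey_majorant \<tau> j) * (B * gevrey_majorant \<tau> (n - j)))"
      unfolding norm_mult norm_of_nat using a[OF j] b[of "n - j"] A less_imp_le[OF gevrey_majorant_pos[OF \<tau>]]
      by (intro mult_left_mono mult_mono) auto
    also have "\<dots> = A * B * (real (n choose j) * (gevrey_majorant \<tau> j * gevrey_majorant \<tau> (n - j)))" by simp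
    also have "\<dots> \<le> A * B * gevrey_majorant \<tau> n"
      using A B by (intro mult_left_mono binomial_mult_majorant_le \<tau> j) auto
    finally show ?thesis .
  qed
  then have "norm (leibniz_sum a b n) \<le> (\<Sum>j\<le>n. A * B * gevrey_majorant \<tau> n)"
    unfolding leibniz_sum_def by (intro sum_norm_le) auto
  then show ?thesis by (simp add: add.commute)
qed

lemma norm_recursion_coeff_le:
  assumes "x \<in> {0..1}"
  shows "norm (complex_of_real (2 * real (n + 1) * x) + s) \<le> (real n + 1) * (2 + norm s)"
proof -
  have "norm (complex_of_real (2 * real (n + 1) * x)) = 2 * (real n + 1) * x"
    using assms by (subst norm_of_real) (simp add: add.commute)
  then have "norm (complex_of_real (2 * real (n + 1) * x) + s) \<le> 2 * (real n + 1) * x + norm s"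
    by (metis norm_triangle_ineq)
  also have "\<dots> \<le> 2 * (real n + 1) * 1 + (real n + 1) * norm s"
    using assms by (intro add_mono mult_left_mono) (auto simp: algebra_simps)
  finally show ?thesis by (simp add: algebra_simps)
qed

lemma norm_recursion_rhs_le_majorant:
  assumes \<tau>: "\<tau> > 0" and C: "C \<ge> 0" and A: "A \<ge> 0" and x: "x \<in> {0..1}"
    and w: "\<And>j. j \<le> n \<Longrightarrow> norm (w j x) \<le> C * gevrey_majorant \<tau> j"
    and h: "\<And>j. j \<le> Suc n \<Longrightarrow> norm (h j x) \<le> A * gevrey_majorant \<tau> j"
  shows "norm (recursion_rhs s w h n x) \<le>
    (C + (2 + norm s) / \<tau> + 1) * (real n + 1) ^ 3 * (A * gevrey_majorant \<tau> n)"
proof -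
  let ?m = "real n + 1" and ?G = "A * gevrey_majorant \<tau> n"
  have G: "?G \<ge> 0" using A gevrey_majorant_pos[OF \<tau>, of n] by simp
  have m: "?m \<le> ?m ^ 3" "real n * ?m \<le> ?m ^ 3"
    by (auto simp: power3_eq_cube algebra_simps)
  have "norm (leibniz_sum (\<lambda>i. w i x) (\<lambda>i. h i x) n) \<le> ?m * (C * A * gevrey_majorant \<tau> n)"
    by (intro norm_leibniz_sum_le_majorant \<tau> C A w h) auto
  also have "\<dots> = ?m * (C * ?G)" by simp
  also have "\<dots> \<le> ?m ^ 3 * (C * ?G)" using m(1) C G by (intro mult_right_mono) auto
  finally have sum: "norm (leibniz_sum (\<lambda>i. w i x) (\<lambda>i. h i x) n) \<le> ?m ^ 3 * (C * ?G)" .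
  have "norm ((of_real (2 * real (n + 1) * x) + s) * h (Suc n) x) \<le>
      (?m * (2 + norm s)) * (A * gevrey_majorant \<tau> (Suc n))"
    unfolding norm_mult by (intro mult_mono h norm_recursion_coeff_le x) auto
  also have "\<dots> = ?m ^ 3 * ((2 + norm s) / \<tau> * ?G)"
    by (simp add: gevrey_majorant_Suc power2_eq_square power3_eq_cube)
  finally have middle: "norm ((of_real (2 * real (n + 1) * x) + s) * h (Suc n) x) \<le>
      ?m ^ 3 * ((2 + norm s) / \<tau> * ?G)" .
  have "norm (of_nat (n * (n + 1)) * h n x) = (real n * ?m) * norm (h n x)"
    unfolding norm_mult norm_of_nat by (simp add: algebra_simps)
  also have "\<dots> \<le> ?m ^ 3 * ?G" using m(2) h[of n] by (intro mult_mono) auto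
  finally have last: "norm (of_nat (n * (n + 1)) * h n x) \<le> ?m ^ 3 * ?G" .
  have "norm (recursion_rhs s w h n x) \<le> norm (leibniz_sum (\<lambda>i. w i x) (\<lambda>i. h i x) n) +
      norm ((of_real (2 * real (n + 1) * x) + s) * h (Suc n) x) + norm (of_nat (n * (n + 1)) * h n x)"
    unfolding recursion_rhs_def
    by (intro order_trans[OF norm_triangle_ineq4] add_mono norm_triangle_ineq4) auto
  also have "\<dots> \<le> ?m ^ 3 * (C * ?G) + ?m ^ 3 * ((2 + norm s) / \<tau> * ?G) + ?m ^ 3 * ?G"
    by (intro add_mono sum middle last)
  finally show ?thesis by (simp add: algebra_simps)
qed

lemma recursion_step_le_majorant:
  assumes d: "0 < d" and \<tau>: "\<tau> > 0" and C: "C \<ge> 0" and A: "A \<ge> 0" and x: "x \<in> {d..1}"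
    and n: "(C + (2 + norm s) / \<tau> + 1) * \<tau>\<^sup>2 / d\<^sup>2 \<le> real n"
    and w: "\<And>j. j \<le> n \<Longrightarrow> norm (w j x) \<le> C * gevrey_majorant \<tau> j"
    and h: "\<And>j. j \<le> Suc n \<Longrightarrow> norm (h j x) \<le> A * gevrey_majorant \<tau> j"
  shows "norm (inverse (x\<^sup>2) *\<^sub>R recursion_rhs s w h n x) \<le> A * gevrey_majorant \<tau> (Suc (Suc n))"
proof -
  define c where "c = (C + (2 + norm s) / \<tau> + 1) * \<tau>\<^sup>2"
  let ?m = "real n + 1" and ?E = "gevrey_majorant \<tau>" and ?r = "recursion_rhs s w h n x"
  have "c \<le> d\<^sup>2 * real n" using n d by (simp add: pos_divide_le_eq mult.commute c_def)
  then have "c * ?m \<le> (d\<^sup>2 * (real n + 2)) * (real n + 2)"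
    using d by (intro mult_mono) (auto simp: algebra_simps add_increasing2)
  then have small: "c * ?m \<le> d\<^sup>2 * (real n + 2)\<^sup>2" by (simp add: power2_eq_square mult.assoc)
  have "d\<^sup>2 * norm (inverse (x\<^sup>2) *\<^sub>R ?r) \<le> x\<^sup>2 * norm (inverse (x\<^sup>2) *\<^sub>R ?r)"
    using x d by (intro mult_right_mono power_mono) auto
  also have "\<dots> = norm ?r" using x d by simp
  also have "\<dots> \<le> (C + (2 + norm s) / \<tau> + 1) * ?m ^ 3 * (A * ?E n)"
    using x d by (intro norm_recursion_rhs_le_majorant \<tau> C A w h) auto
  also have "\<dots> = c * ?m * (?m\<^sup>2 / \<tau>\<^sup>2 * (A * ?E n))"
    using \<tau> by (simp add: c_def power2_eq_square power3_eq_cube)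
  also have "\<dots> \<le> d\<^sup>2 * (real n + 2)\<^sup>2 * (?m\<^sup>2 / \<tau>\<^sup>2 * (A * ?E n))"
    using small A less_imp_le[OF gevrey_majorant_pos[OF \<tau>]] by (intro mult_right_mono) auto
  also have "\<dots> = d\<^sup>2 * (A * ?E (Suc (Suc n)))"
    unfolding gevrey_majorant_Suc by (simp add: power2_eq_square add.commute)
  finally show ?thesis using d by simp
qed

lemma recursion_solution_le_majorant:
  fixes h w :: "nat \<Rightarrow> real \<Rightarrow> complex"
  assumes d: "0 < d" and \<tau>: "\<tau> > 0" and C: "C \<ge> 0"
    and cont: "\<And>n. continuous_on {d..1} (h n)"
    and w: "\<And>n x. x \<in> {d..1} \<Longrightarrow> norm (w n x) \<le> C * gevrey_majorant \<tau> n"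
    and rec: "\<And>n x. x \<in> {d..1} \<Longrightarrow> h (Suc (Suc n)) x = inverse (x\<^sup>2) *\<^sub>R recursion_rhs s w h n x"
  shows "\<exists>A\<ge>0. \<forall>n. \<forall>x\<in>{d..1}. norm (h n x) \<le> A * gevrey_majorant \<tau> n"
proof -
  let ?E = "gevrey_majorant \<tau>"
  have E: "?E n > 0" for n by (rule gevrey_majorant_pos[OF \<tau>])
  have "\<exists>b. \<forall>x\<in>{d..1}. norm (h n x) \<le> b" for n
    using compact_imp_bounded[OF compact_continuous_image[OF cont[of n]]] unfolding bounded_iff by auto
  then obtain b where b: "\<And>n x. x \<in> {d..1} \<Longrightarrow> norm (h n x) \<le> b n" by metis
  obtain n\<^sub>0 where n\<^sub>0: "(C + (2 + norm s) / \<tau> + 1) * \<tau>\<^sup>2 / d\<^sup>2 \<le> real n\<^sub>0" using real_arch_simple by blast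
  define A where "A = (\<Sum>k<n\<^sub>0 + 2. \<bar>b k\<bar> / ?E k)"
  have A: "A \<ge> 0" unfolding A_def by (intro sum_nonneg) (auto simp: E less_imp_le)
  have "norm (h n x) \<le> A * ?E n" if x: "x \<in> {d..1}" for n x
  proof (induction n rule: less_induct)
    case (less n)
    show ?case
    proof (cases "n < n\<^sub>0 + 2")
      case True
      then have "\<bar>b n\<bar> / ?E n \<le> A"
        unfolding A_def by (intro member_le_sum) (auto simp: E less_imp_le)
      then have "\<bar>b n\<bar> \<le> A * ?E n" using E[of n] by (simp add: field_simps)
      then show ?thesis using b[OF x, of n] by linarith
    next
      case False
      define k where "k = n - 2"
      have k: "n = Suc (Suc k)" "n\<^sub>0 \<le> k" using False by (auto simp: k_def)
      show ?thesis
        unfolding k(1) rec[OF x]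
        by (rule recursion_step_le_majorant[OF d \<tau> C A x]) (use n\<^sub>0 k less w[OF x] in auto)
    qed
  qed
  then show ?thesis using A by (intro exI[of _ A]) simp
qed

lemma classical_solution_le_majorant:
  assumes W: "gevrey \<tau> 2 W" "\<tau> > 0" and u: "smooth01 u" and d: "0 < d"
    and near: "\<And>x. x \<in> {0..1} \<Longrightarrow> x < d \<Longrightarrow> v x = u x"
    and sol: "classical_solution W s 0 v v' v''"
  shows "\<exists>A\<ge>0. \<forall>n. \<forall>x\<in>{d..1}. norm (dn n v x) \<le> A * gevrey_majorant \<tau> n"
proof -
  have smooth: "smooth01 W" using W by (simp add: gevrey_def)
  have v: "smooth01 v" by (rule smooth01_classical_solution[OF smooth u d near sol])
  have dn_v: "dn n v x = ode_deriv W s v v' n x" if "x \<in> {0<..1}" for n x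
    by (rule dn_classical_solution[OF smooth u d near sol that])
  obtain C where C: "C > 0" "\<And>n x. x \<in> {0..1} \<Longrightarrow> norm (dn n W x) \<le> C * gevrey_majorant \<tau> n"
    using gevrey_le_majorant[OF W] by blast
  show ?thesis
  proof (rule recursion_solution_le_majorant[OF d W(2) less_imp_le[OF C(1)]])
    show "continuous_on {d..1} (dn n v)" for n
      by (rule continuous_on_subset[OF continuous_on_dn[OF v]]) (use d in auto)
    show "norm (dn n W x) \<le> C * gevrey_majorant \<tau> n" if "x \<in> {d..1}" for n x
      using C(2) that d by auto
    fix n x assume "x \<in> {d..1}"
    then have x: "x \<in> {0<..1}" using d by auto
    have "recursion_rhs s (\<lambda>i. dn i W) (\<lambda>i. dn i v) n x =
        recursion_rhs s (\<lambda>i. dn i W) (ode_deriv W s v v') n x"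
      by (intro recursion_rhs_cong dn_v x)
    then show "dn (Suc (Suc n)) v x = inverse (x\<^sup>2) *\<^sub>R recursion_rhs s (\<lambda>i. dn i W) (\<lambda>i. dn i v) n x"
      by (simp add: dn_v[OF x])
  qed
qed

section \<open>The uniform estimate\<close>

context gevrey_spaces
begin

lemma classical_solution_regular:
  assumes W: "gevrey \<tau> 2 W" "\<sigma> < \<tau>" and u: "u \<in> Xsp \<sigma>" and d: "0 < d"
    and near: "\<And>x. x \<in> {0..1} \<Longrightarrow> x < d \<Longrightarrow> v x = u x"
    and sol: "classical_solution W s 0 v v' v''"
  shows "smooth01 v" and "dn 1 v \<in> V.carrier"
proof -
  have "\<tau> > 0" and smooth: "smooth01 W" using W \<sigma>_pos by (auto simp: gevrey_def)
  note us = Xsp_smooth[OF u]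
  show v: "smooth01 v" by (rule smooth01_classical_solution[OF smooth us d near sol])
  have "\<exists>A\<ge>0. \<forall>n. \<forall>x\<in>{d..1}. norm (dn n v x) \<le> A * gevrey_majorant \<tau> n"
    by (rule classical_solution_le_majorant[OF W(1) \<open>\<tau> > 0\<close> us d near sol])
  then obtain A where A: "\<And>n x. x \<in> {d..1} \<Longrightarrow> norm (dn n v x) \<le> A * gevrey_majorant \<tau> n" by blast
  show "dn 1 v \<in> V.carrier"
  proof (rule V.carrier_if_majorant_dominated[OF Xsp_dn1[OF u] smooth01_dn[OF v] W(2)])
    fix n and x :: real assume x: "x \<in> {0..1}"
    show "norm (dn n (dn 1 v) x) \<le> max (norm (dn n (dn 1 u) x)) (A * gevrey_majorant \<tau> (Suc n))"
    proof (cases "x < d")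
      case True
      then have "dn (Suc n) v x = dn (Suc n) u x" using dn_local[of "{..<d}" v u x "Suc n"] near x by auto
      then show ?thesis by (simp add: dn_dn)
    next
      case False
      then show ?thesis using A[of x "Suc n"] x by (simp add: dn_dn max.coboundedI2)
    qed
  qed
qed

text \<open>The remainder \<open>u - z\<close> inherits the regularity of \<open>u\<close> at the origin, and its boundary value at \<open>1\<close>
  is matched by a multiple of the homogeneous solution \<open>1 + w\<close>.\<close>
lemma solution_decomposition:
  assumes W: "gevrey \<tau> 2 W" "\<sigma> < \<tau>" and inv: "Linvertible W \<sigma> s" and d: "0 < d"
    and u: "Lgraph W s u f" and w: "Lgraph W s w W"
    and z: "classical_solution W s f z z' z''" "\<And>x. x \<in> {0..d} \<Longrightarrow> z x = 0" and x: "x \<in> {0..1}"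
  shows "(u - z) x = - z 1 * (1 + w x)"
proof -
  define v where "v = u - z"
  define h where "h = v - scale_fun (v 1) (1 + w)"
  have u1: "u 1 = 0" and w1: "w 1 = 0" using LgraphD(1)[OF u] LgraphD(1)[OF w] by (auto simp: Xsp_iff)
  note ws = LgraphD(4)[OF w]
  from classical_solution_diff[OF Lgraph_classical_solution[OF u] z(1)]
  have v_sol: "classical_solution W s 0 v (dn 1 u - z') (dn 2 u - z'')" by (simp add: v_def)
  have near: "v x = u x" if "x \<in> {0..1}" "x < d" for x using z(2)[of x] that by (simp add: v_def)
  have v: "smooth01 v" "dn 1 v \<in> V.carrier"
    by (rule classical_solution_regular[OF W LgraphD(1)[OF u] d near v_sol]; assumption)+
  have Lop_v: "Lop W s v x = 0" if "x \<in> {0..1}" for x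
    using Lop_classical_solution[OF v(1) v_sol that] by simp
  note smooth = smooth01_add[OF smooth01_one ws] smooth01_scale[OF smooth01_add[OF smooth01_one ws]]
  have hs: "smooth01 h" unfolding h_def by (intro smooth01_diff v(1) smooth)
  have "dn 1 h x = (dn 1 v - scale_fun (v 1) (dn 1 w)) x" if "x \<in> {0..1}" for x
    unfolding h_def using that
    by (simp add: dn_diff[OF v(1) smooth(2)] dn_scale[OF smooth(1)] dn_add[OF smooth01_one ws] dn_one)
  moreover have "dn 1 v - scale_fun (v 1) (dn 1 w) \<in> V.carrier"
    by (intro V.diff_mem V.scale_mem v(2) Xsp_dn1 LgraphD(1)[OF w])
  ultimately have "h \<in> Xsp \<sigma>" using XspI[OF hs] by (simp add: h_def w1)
  moreover have "Lop W s h x = 0" if x: "x \<in> {0..1}" for x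
    unfolding h_def using LgraphD(3)[OF w x] Lop_v[OF x]
    by (simp add: Lop_diff[OF v(1) smooth(2) x] Lop_scale[OF smooth(1) x]
        Lop_add[OF smooth01_one ws x] Lop_one[OF x])
  ultimately have h: "Lgraph W s h 0" by (simp add: Lgraph_def Y.zero_mem)
  then have "h x = 0" using inv X_norm_eq_zero_iff[OF LgraphD(1)[OF h]] x by (simp add: Linvertible_iff)
  then show ?thesis by (simp add: h_def v_def u1 eq_neg_iff_add_eq_0)
qed

lemma solution_decomposition_dn:
  assumes dec: "\<And>x. x \<in> {0..1} \<Longrightarrow> (u - z) x = c * (1 + w x)"
    and u: "Lgraph W s u f" and w: "smooth01 w" and z: "classical_solution W s f z z' z''" and x: "x \<in> {0..1}"
  shows "dn 1 u x = z' x + c * dn 1 w x" and "dn 2 u x = z'' x + c * dn 2 w x"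
proof -
  note sol = classical_solution_diff[OF Lgraph_classical_solution[OF u] z]
  note w1 = smooth01_add[OF smooth01_one w]
  have "dn n (u - z) x = c * dn n w x" if "n > 0" for n
    using smooth01_cong(2)[OF smooth01_scale[OF w1], of c "u - z" x n] dec x that
    by (simp add: dn_scale[OF w1] dn_add[OF smooth01_one w] dn_one)
  from this[of 1] this[of 2] show "dn 1 u x = z' x + c * dn 1 w x" "dn 2 u x = z'' x + c * dn 2 w x"
    using classical_solution_dn[OF sol x] by (simp_all add: algebra_simps)
qed

lemma H2norm_le:
  assumes u: "smooth01 u" and f: "continuous_on {0..1} f" and P: "P \<ge> 0"
    and bound: "\<And>x. x \<in> {0..1} \<Longrightarrow> norm (u x) \<le> P * L2norm f"
      "\<And>x. x \<in> {0..1} \<Longrightarrow> norm (dn 1 u x) \<le> P * L2norm f"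
      "\<And>x. x \<in> {0..1} \<Longrightarrow> norm (dn 2 u x) \<le> P * (norm (f x) + L2norm f)"
  shows "H2norm u \<le> 3 * P * L2norm f"
proof -
  let ?N = "L2norm f"
  have fi: "(\<lambda>x. (norm (f x))\<^sup>2) integrable_on {0..1}"
    using f by (intro integrable_continuous_real continuous_intros)
  have N: "?N\<^sup>2 = integral {0..1} (\<lambda>x. (norm (f x))\<^sup>2)"
    unfolding L2norm_def using integral_nonneg[OF fi] by simp
  have "integral {0..1} (\<lambda>x. (norm (u x))\<^sup>2 + (norm (dn 1 u x))\<^sup>2 + (norm (dn 2 u x))\<^sup>2) \<le>
      integral {0..1} (\<lambda>x. 2 * P\<^sup>2 * (norm (f x))\<^sup>2 + 4 * P\<^sup>2 * ?N\<^sup>2)"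
  proof (rule integral_le)
    show "(\<lambda>x. (norm (u x))\<^sup>2 + (norm (dn 1 u x))\<^sup>2 + (norm (dn 2 u x))\<^sup>2) integrable_on {0..1}"
      by (intro integrable_continuous_real continuous_intros continuous_on_dn smooth01_continuous_on u)
    show "(\<lambda>x. 2 * P\<^sup>2 * (norm (f x))\<^sup>2 + 4 * P\<^sup>2 * ?N\<^sup>2) integrable_on {0..1}"
      using f by (intro integrable_continuous_real continuous_intros)
    fix x :: real assume x: "x \<in> {0..1}"
    have "(norm (u x))\<^sup>2 \<le> (P * ?N)\<^sup>2" "(norm (dn 1 u x))\<^sup>2 \<le> (P * ?N)\<^sup>2"
      "(norm (dn 2 u x))\<^sup>2 \<le> (P * (norm (f x) + ?N))\<^sup>2"
      by (intro power_mono bound x norm_ge_zero)+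
    moreover have "(norm (f x) + ?N)\<^sup>2 \<le> 2 * (norm (f x))\<^sup>2 + 2 * ?N\<^sup>2"
      using zero_le_power2[of "norm (f x) - ?N"] by (simp add: power2_eq_square algebra_simps)
    then have "(P * (norm (f x) + ?N))\<^sup>2 \<le> P\<^sup>2 * (2 * (norm (f x))\<^sup>2 + 2 * ?N\<^sup>2)"
      unfolding power_mult_distrib by (intro mult_left_mono) auto
    ultimately show "(norm (u x))\<^sup>2 + (norm (dn 1 u x))\<^sup>2 + (norm (dn 2 u x))\<^sup>2 \<le>
        2 * P\<^sup>2 * (norm (f x))\<^sup>2 + 4 * P\<^sup>2 * ?N\<^sup>2"
      by (simp add: power_mult_distrib algebra_simps)
  qed
  also have "\<dots> = 6 * P\<^sup>2 * ?N\<^sup>2"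
    unfolding N using integrable_on_cmult_left[OF fi, of "2 * P\<^sup>2"] by (subst integral_add) auto
  also have "\<dots> \<le> (3 * P * ?N)\<^sup>2" by (simp add: power_mult_distrib mult_right_mono)
  finally show ?thesis
    unfolding H2norm_def using L2norm_nonneg[of f] P by (intro real_le_lsqrt) auto
qed

lemma norm_dn_le_graph_bound:
  assumes bound: "\<And>s u f. s \<in> U \<Longrightarrow> Lgraph W s u f \<Longrightarrow> X_norm u \<le> K * Y.total_norm f"
  shows "\<exists>D\<ge>0. \<forall>s\<in>U. \<forall>w. Lgraph W s w W \<longrightarrow> (\<forall>x\<in>{0..1}. \<forall>k\<le>2. norm (dn k w x) \<le> D)"
proof -
  obtain C where C: "\<And>k. C k \<ge> 0" "\<And>k u x. u \<in> Xsp \<sigma> \<Longrightarrow> x \<in> {0..1} \<Longrightarrow> norm (dn k u x) \<le> C k * X_norm u"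
    using norm_dn_le_X_norm by metis
  define D where "D = (\<Sum>k\<le>2. C k) * \<bar>K * Y.total_norm W\<bar>"
  have "norm (dn k w x) \<le> D"
    if s: "s \<in> U" and w: "Lgraph W s w W" and x: "x \<in> {0..1}" and k: "k \<le> 2" for s w x k
  proof -
    have "norm (dn k w x) \<le> C k * X_norm w" by (rule C(2)[OF LgraphD(1)[OF w] x])
    also have "\<dots> \<le> D"
      unfolding D_def using bound[OF s w] C(1) k X.N_nonneg[OF LgraphD(1)[OF w]]
      by (intro mult_mono member_le_sum sum_nonneg) auto
    finally show ?thesis .
  qed
  moreover have "D \<ge> 0" unfolding D_def using C(1) by (intro mult_nonneg_nonneg sum_nonneg) auto
  ultimately show ?thesis by blast
qed

lemma H2norm_decomposition_le:
  assumes W: "gevrey \<tau> 2 W" "\<sigma> < \<tau>" and inv: "Linvertible W \<sigma> s" and d: "0 < d"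
    and u: "Lgraph W s u f" and w: "Lgraph W s w W"
    and z: "controlled_solution W s f d C z z' z''" and C: "C \<ge> 0"
    and D: "D \<ge> 0" and w_le: "\<And>k x. k \<le> 2 \<Longrightarrow> x \<in> {0..1} \<Longrightarrow> norm (dn k w x) \<le> D"
  shows "H2norm u \<le> 3 * (C * (2 + D)) * L2norm f"
proof (rule H2norm_le[OF LgraphD(4)[OF u] LgraphD(5)[OF u]])
  show "0 \<le> C * (2 + D)" using C D by simp
  fix x :: real assume x: "x \<in> {0..1}"
  have sol: "classical_solution W s f z z' z''" and z0: "\<And>t. t \<in> {0..d} \<Longrightarrow> z t = 0"
    and z_le: "\<And>t. t \<in> {0..1} \<Longrightarrow> norm (z t) \<le> C * L2norm f" "norm (z' x) \<le> C * L2norm f"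
      "norm (z'' x) \<le> C * (norm (f x) + L2norm f)"
    using z x by (auto simp: controlled_solution_def)
  have dec: "(u - z) t = - z 1 * (1 + w t)" if "t \<in> {0..1}" for t
    by (rule solution_decomposition[OF W inv d u w sol z0 that])
  have dec_dn: "dn 1 u x = z' x + - z 1 * dn 1 w x" "dn 2 u x = z'' x + - z 1 * dn 2 w x"
    by (rule solution_decomposition_dn[OF dec u LgraphD(4)[OF w] sol x]; assumption)+
  have nonneg: "0 \<le> C * L2norm f" "0 \<le> C * norm (f x)" "0 \<le> D * (C * norm (f x))"
    using C D L2norm_nonneg[of f] by simp_all
  have z1: "norm (- z 1 * g) \<le> C * L2norm f * r" if "norm g \<le> r" for g r
    unfolding norm_mult norm_minus_cancel using z_le(1)[of 1] that nonneg(1) by (intro mult_mono) auto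
  have "norm (1 + w x) \<le> 1 + D" using norm_triangle_ineq[of 1 "w x"] w_le[OF _ x, of 0] by simp
  moreover have "u x = z x + - z 1 * (1 + w x)" using dec[OF x] by (simp add: algebra_simps)
  ultimately have "norm (u x) \<le> C * L2norm f + C * L2norm f * (1 + D)"
    using norm_triangle_le[OF add_mono[OF z_le(1)[OF x] z1]] by simp
  then show "norm (u x) \<le> C * (2 + D) * L2norm f" by (simp add: algebra_simps)
  have "norm (dn 1 u x) \<le> C * L2norm f + C * L2norm f * D"
    unfolding dec_dn(1) by (intro norm_triangle_le add_mono z_le(2) z1 w_le x) simp
  then show "norm (dn 1 u x) \<le> C * (2 + D) * L2norm f" using nonneg(1) by (simp add: algebra_simps)
  have "norm (dn 2 u x) \<le> C * (norm (f x) + L2norm f) + C * L2norm f * D"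
    unfolding dec_dn(2) by (intro norm_triangle_le add_mono z_le(3) z1 w_le x) simp
  also have "\<dots> \<le> C * (2 + D) * (norm (f x) + L2norm f)"
    using nonneg by (simp add: algebra_simps)
  finally show "norm (dn 2 u x) \<le> C * (2 + D) * (norm (f x) + L2norm f)" .
qed

proposition H2_estimate:
  assumes W: "gevrey \<tau> 2 W" "\<sigma> < \<tau>" and "\<delta> > 0" and "bounded U"
    and inv: "\<And>s. s \<in> U \<Longrightarrow> Linvertible W \<sigma> s"
    and bound: "\<And>s u f. s \<in> U \<Longrightarrow> Lgraph W s u f \<Longrightarrow> X_norm u \<le> K * Y.total_norm f"
  shows "\<exists>C. \<forall>s\<in>U. \<forall>u f. Lgraph W s u f \<longrightarrow> (\<forall>x\<in>{0..<\<delta>}. f x = 0) \<longrightarrow> H2norm u \<le> C * L2norm f"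
proof -
  obtain R where R: "R > 0" "\<And>s. s \<in> U \<Longrightarrow> norm s \<le> R" using \<open>bounded U\<close> by (auto simp: bounded_pos)
  define d where "d = min \<delta> 1 / 2"
  have d: "0 < d" "d < 1" "d < \<delta>" using \<open>\<delta> > 0\<close> by (auto simp: d_def min_def)
  have WY: "W \<in> Y.carrier" by (rule Y.gevrey_imp_carrier[OF W])
  have "\<exists>C\<ge>0. \<forall>s f. norm s \<le> R \<longrightarrow> continuous_on {0..1} f \<longrightarrow> (\<forall>x\<in>{0..d}. f x = 0) \<longrightarrow>
      (\<exists>z z' z''. controlled_solution W s f d C z z' z'')"
    using WY d R(1) by (intro controlled_solution_uniform smooth01_continuous_on Y.carrier_smooth) auto
  then obtain C where C: "C \<ge> 0"
    "\<And>s f. norm s \<le> R \<Longrightarrow> continuous_on {0..1} f \<Longrightarrow> \<forall>x\<in>{0..d}. f x = 0 \<Longrightarrow>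
      \<exists>z z' z''. controlled_solution W s f d C z z' z''"
    by blast
  have "\<exists>D\<ge>0. \<forall>s\<in>U. \<forall>w. Lgraph W s w W \<longrightarrow> (\<forall>x\<in>{0..1}. \<forall>k\<le>2. norm (dn k w x) \<le> D)"
    by (rule norm_dn_le_graph_bound[OF bound])
  then obtain D where D: "D \<ge> 0"
    "\<And>s w k x. s \<in> U \<Longrightarrow> Lgraph W s w W \<Longrightarrow> k \<le> 2 \<Longrightarrow> x \<in> {0..1} \<Longrightarrow> norm (dn k w x) \<le> D"
    by blast
  have "H2norm u \<le> 3 * (C * (2 + D)) * L2norm f"
    if s: "s \<in> U" and u: "Lgraph W s u f" and f0: "\<forall>x\<in>{0..<\<delta>}. f x = 0" for s u f
  proof -
    have "\<forall>x\<in>{0..d}. f x = 0" using f0 d(3) by auto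
    then obtain z z' z'' where z: "controlled_solution W s f d C z z' z''"
      using C(2)[OF R(2)[OF s] LgraphD(5)[OF u]] by blast
    obtain w where w: "Lgraph W s w W"
      using inv[OF s] WY unfolding Linvertible_iff L.surjective_def by blast
    show ?thesis
      by (rule H2norm_decomposition_le[OF W inv[OF s] d(1) u w z C(1) D(1) D(2)[OF s w]])
  qed
  then show ?thesis by blast
qed

end

theorem mainTheorem16:
  fixes W :: "real \<Rightarrow> complex" and \<sigma> \<sigma>s \<delta> :: real and s0 :: complex
  assumes "gevrey \<sigma>s 2 W"
    and "0 < \<sigma>" and "\<sigma> < \<sigma>s"
    and "s0 \<in> Omega \<sigma>"
    and "Linvertible W \<sigma> s0"
    and "\<delta> > 0"
  shows "\<exists>U. open U \<and> s0 \<in> U \<and> U \<subseteq> Omega \<sigma> \<and>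
           (\<forall>s\<in>U. Linvertible W \<sigma> s) \<and>
           (\<exists>C. \<forall>f\<in>Ysp \<sigma>. (\<forall>x\<in>{0..<\<delta>}. f x = 0) \<longrightarrow>
              (\<forall>s\<in>U. \<forall>u\<in>Dom W \<sigma> s. (\<forall>x\<in>{0..1}. Lop W s u x = f x) \<longrightarrow>
                 H2norm u \<le> C * L2norm f))"
proof -
  interpret gevrey_spaces \<sigma> by standard fact
  obtain r K where r: "r > 0" and inv: "\<And>s. s \<in> ball s0 r \<Longrightarrow> Linvertible W \<sigma> s"
    and bound: "\<And>s u f. s \<in> ball s0 r \<Longrightarrow> Lgraph W s u f \<Longrightarrow> X_norm u \<le> K * Y.total_norm f"
    using Linvertible_locally_uniform[OF assms(5)] by blast
  have "\<exists>C. \<forall>s\<in>ball s0 r. \<forall>u f. Lgraph W s u f \<longrightarrow> (\<forall>x\<in>{0..<\<delta>}. f x = 0) \<longrightarrow> H2norm u \<le> C * L2norm f"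
    by (rule H2_estimate[OF assms(1,3,6) bounded_ball inv bound])
  then obtain C where C: "\<And>s u f. s \<in> ball s0 r \<Longrightarrow> Lgraph W s u f \<Longrightarrow> \<forall>x\<in>{0..<\<delta>}. f x = 0 \<Longrightarrow>
      H2norm u \<le> C * L2norm f"
    by blast
  show ?thesis
  proof (intro exI[of _ "ball s0 r \<inter> Omega \<sigma>"] conjI exI[of _ C] ballI impI)
    show "open (ball s0 r \<inter> Omega \<sigma>)" by (intro open_Int open_ball open_Omega assms(2))
    fix f s u
    assume "f \<in> Ysp \<sigma>" "\<forall>x\<in>{0..<\<delta>}. f x = 0" "s \<in> ball s0 r \<inter> Omega \<sigma>"
      and "u \<in> Dom W \<sigma> s" "\<forall>x\<in>{0..1}. Lop W s u x = f x"
    then show "H2norm u \<le> C * L2norm f" using C Dom_imp_Lgraph[of u W s f] by (auto simp: Ysp_eq)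
  qed (use r inv assms(4) in auto)
qed

end
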